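(* Let a tiling of the regular $N$-gon $R_N$ with triangles of angles $\alpha,\beta,\gamma$ be given, where $\alpha,\beta,\gamma$ are rational multiples of $\pi$, and let $V_1,\ldots,V_N$ be the vertices of $R_N$. Suppose $N>6$. Then the equations at the vertices $V_1,\ldots,V_N$ are the same. More precisely, after a suitable permutation of $\alpha,\beta,\gamma$, one of the following is true: (i) The equation at every vertex $V_j$ is $\alpha=\delta_N$. (ii) The equation at every vertex $V_j$ is $\alpha+\beta=\delta_N$. (iii) The equation at every vertex $V_j$ is $2\alpha=\delta_N$.
   Context: A tiling (or dissection) of a polygon $A$ is a decomposition of $A$ into finitely many nonoverlapping polygons; no other condition is imposed, so two pieces may have a common boundary point without having a common side. Here all the pieces are triangles with angles $\alpha,\beta,\gamma$ (so they are similar to each other, but not necessarily of the same size). $R_N$ denotes the regular $N$-gon and $\delta_N=(N-2)\pi/N$ denotes its angle. If the number of angles $\alpha,\beta,\gamma$ meeting at the vertex $V_j$ of $R_N$ is $p_j,q_j,r_j$, respectively, then $p_j\alpha+q_j\beta+r_j\gamma=\delta_N$ is called the equation at the vertex $V_j$ $(1\le j\le N)$. *)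

theory Defs
  imports "HOL-Analysis.Analysis" "HOL-Library.Multiset"
begin

definition angle_at :: "complex \<Rightarrow> complex \<Rightarrow> complex \<Rightarrow> real" where
  "angle_at B A C = arccos (((B - A) \<bullet> (C - A)) / (norm (B - A) * norm (C - A)))"

definition triangle_with_angles :: "real \<Rightarrow> real \<Rightarrow> real \<Rightarrow> complex set \<Rightarrow> bool" where
  "triangle_with_angles \<alpha> \<beta> \<gamma> t \<longleftrightarrow>
     (\<exists>A B C. \<not> collinear {A, B, C} \<and> t = convex hull {A, B, C} \<and>
        angle_at B A C = \<alpha> \<and> angle_at C B A = \<beta> \<and> angle_at A C B = \<gamma>)"

(* The vertices of a nondegenerate triangle are determined by its point set, so for a triangle t
   at most one \<theta> satisfies this, and one does exactly when V is a vertex of t. *)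
definition has_vertex_angle :: "complex set \<Rightarrow> complex \<Rightarrow> real \<Rightarrow> bool" where
  "has_vertex_angle t V \<theta> \<longleftrightarrow>
     (\<exists>B C. \<not> collinear {V, B, C} \<and> t = convex hull {V, B, C} \<and> angle_at B V C = \<theta>)"

definition is_tiling :: "complex set set \<Rightarrow> complex set \<Rightarrow> bool" where
  "is_tiling T P \<longleftrightarrow>
     finite T \<and> \<Union>T = P \<and> pairwise (\<lambda>s t. interior s \<inter> interior t = {}) T"

(* An arbitrary regular N-gon: c is the centre and c + w one of the vertices (w \<noteq> 0). *)
definition regular_vertex :: "nat \<Rightarrow> complex \<Rightarrow> complex \<Rightarrow> nat \<Rightarrow> complex" where
  "regular_vertex N c w j = c + w * cis (2 * pi * real j / real N)"

definition regular_polygon :: "nat \<Rightarrow> complex \<Rightarrow> complex \<Rightarrow> complex set" where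
  "regular_polygon N c w = convex hull (regular_vertex N c w ` {..<N})"

definition regular_angle :: "nat \<Rightarrow> real" where
  "regular_angle N = (real N - 2) * pi / real N"

(* "p \<alpha> + q \<beta> + r \<gamma> = \<delta> is the equation at V": the multiset of the tile angles at V consists of
   p copies of \<alpha>, q copies of \<beta> and r copies of \<gamma> (so that if, say, \<alpha> = \<beta>, such an angle may be
   counted under either name), and the equation holds. *)
definition vertex_equation ::
    "complex set set \<Rightarrow> complex \<Rightarrow> real \<Rightarrow> real \<Rightarrow> real \<Rightarrow> real \<Rightarrow> nat \<Rightarrow> nat \<Rightarrow> nat \<Rightarrow> bool" where
  "vertex_equation T V \<delta> \<alpha> \<beta> \<gamma> p q r \<longleftrightarrow>
     (\<forall>\<theta>. card {t \<in> T. has_vertex_angle t V \<theta>} =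
        count (replicate_mset p \<alpha> + replicate_mset q \<beta> + replicate_mset r \<gamma>) \<theta>) \<and>
     real p * \<alpha> + real q * \<beta> + real r * \<gamma> = \<delta>"

end

theory Submission
  imports Defs "HOL-Computational_Algebra.Polynomial_Factorial" "HOL-Number_Theory.Cong"
begin

text \<open>Let \<open>n\<close> be a suitable common denominator of the angles. Every \<open>k\<close> prime to \<open>n\<close> gives a Galois
conjugation \<open>\<zeta> \<mapsto> \<zeta>\<^sup>k\<close> of the \<open>n\<close>-th roots of unity, and there is an additive map \<open>\<phi>\<close> of the
plane with \<open>\<phi>(\<zeta> z) = \<zeta>\<^sup>k \<phi>(z)\<close> which preserves lines with the directions that occur in the tiling, and
which can be chosen not to degenerate any given finite set of segments (\<open>semilinear_exists\<close>). The map
\<open>\<phi>\<close> takes the tiles to triangles with the angles \<open>k \<alpha>\<close>, \<open>k \<beta>\<close>, \<open>k \<gamma>\<close> up to sign and multiples of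
\<open>\<pi>\<close>, all with the same orientation (\<open>conjugate_triangle\<close>), and the regular \<open>N\<close>-gon to the star
polygon with step \<open>k / N\<close>.

The images of the tiles need not form a tiling, but sums over the boundary survive: if a function of
directed segments is additive along each line, then its sum over the sides of all tiles is its sum over the
sides of the polygon (\<open>polygon_boundary_sum\<close>). This is applied to the angle under which the image of a
segment is seen from the image of a vertex \<open>V\<close> of the polygon. If \<open>{k / N} < 1 / 2\<close>, then the polygon gives
\<open>\<pi> (1 - 2 {k / N})\<close>, each tile gives a nonnegative number, and a tile with the angle \<open>\<pi> x\<close> at \<open>V\<close> gives
\<open>\<pi> {k x}\<close>. So \<open>\<Sum> {k x} \<le> 1 - 2 {k / N}\<close>, where the sum is over the angles \<open>\<pi> x\<close> of the tiles at \<open>V\<close>.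
Equality holds for \<open>k = 1\<close>; this is the equation at \<open>V\<close>. Consequently the two sides always differ by an
integer, and equality holds for all these \<open>k\<close> (\<open>vertex_angle_sum_conjugate\<close>).

The rest is arithmetic. For a \<open>k\<close> with \<open>k / N\<close> close to \<open>1 / 2\<close> the right hand side is \<open>1 / N\<close>, \<open>2 / N\<close> or
\<open>4 / N\<close>, depending on \<open>N\<close> modulo \<open>4\<close>. Since \<open>{k x}\<close> has to be that small for all \<open>k\<close> in the same class modulo
\<open>N\<close>, the denominator of \<open>x\<close> divides \<open>lcm(2, N)\<close> , or \<open>30\<close> if \<open>N = 10\<close>
(\<open>small_conjugates_denominator\<close>), and then the equations leave room for at most two angles. With \<open>\<delta> = 1 - 2 / N\<close>, it turns out that either there is one angle, \<open>x = \<delta>\<close>, or there are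
two equal ones, \<open>x = \<delta> / 2\<close>; only for \<open>N = 10\<close> the pairs \<open>1/10, 7/10\<close> and \<open>7/30, 17/30\<close> are possible as
well (\<open>star_angle_system_solutions\<close>). Two different ones of these solutions cannot occur at different vertices,
because the angles of the tile add up to \<open>\<pi>\<close>.\<close>

section \<open>Galois conjugates of roots of unity\<close>

text \<open>The value at \<open>w\<close> of a polynomial with integer coefficients.\<close>
definition eval_int_poly :: "int poly \<Rightarrow> complex \<Rightarrow> complex" where
  "eval_int_poly f w = poly (map_poly of_int f) w"

lemma eval_int_poly_0 [simp]: "eval_int_poly 0 w = 0"
  by (simp add: eval_int_poly_def)

lemma eval_int_poly_pCons [simp]:
  "eval_int_poly (pCons a f) w = of_int a + w * eval_int_poly f w"
  by (simp add: eval_int_poly_def map_poly_pCons)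

lemma eval_int_poly_1 [simp]: "eval_int_poly 1 w = 1"
  by (simp add: one_pCons)

lemma eval_int_poly_add [simp]:
  "eval_int_poly (f + g) w = eval_int_poly f w + eval_int_poly g w"
proof -
  have "map_poly of_int (f + g) = (map_poly of_int f + map_poly of_int g :: complex poly)"
    by (rule poly_eqI) (simp add: coeff_map_poly)
  then show ?thesis by (simp add: eval_int_poly_def)
qed

lemma eval_int_poly_smult [simp]:
  "eval_int_poly (smult a f) w = of_int a * eval_int_poly f w"
proof -
  have "map_poly of_int (smult a f) = (smult (of_int a) (map_poly of_int f) :: complex poly)"
    by (rule poly_eqI) (simp add: coeff_map_poly)
  then show ?thesis by (simp add: eval_int_poly_def)
qed

lemma eval_int_poly_minus [simp]: "eval_int_poly (- f) w = - eval_int_poly f w"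
  using eval_int_poly_smult[of "-1" f w] by simp

lemma eval_int_poly_diff [simp]:
  "eval_int_poly (f - g) w = eval_int_poly f w - eval_int_poly g w"
  using eval_int_poly_add[of f "- g" w] by simp

lemma eval_int_poly_mult [simp]:
  "eval_int_poly (f * g) w = eval_int_poly f w * eval_int_poly g w"
  by (induction f) (auto simp: algebra_simps)

lemma eval_int_poly_power [simp]:
  "eval_int_poly (f ^ k) w = eval_int_poly f w ^ k"
  by (induction k) auto

lemma eval_int_poly_monom [simp]: "eval_int_poly (monom a k) w = of_int a * w ^ k"
  by (simp add: eval_int_poly_def map_poly_monom poly_monom)

lemma eval_int_poly_sum [simp]:
  "eval_int_poly (\<Sum>i\<in>A. f i) w = (\<Sum>i\<in>A. eval_int_poly (f i) w)"
  by (induction A rule: infinite_finite_induct) auto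

lemma eval_int_poly_prod_mset_eq_0:
  assumes "eval_int_poly (prod_mset M) w = 0"
  shows "\<exists>g\<in>#M. eval_int_poly g w = 0"
  using assms by (induction M) auto

text \<open>The Frobenius congruence: \<open>f(w)\<^sup>p\<close> and \<open>f(w\<^sup>p)\<close> agree modulo \<open>p\<close> in the ring \<open>\<int>[w]\<close>.\<close>
lemma eval_int_poly_frobenius:
  assumes p: "prime (p::nat)"
  shows "\<exists>q. eval_int_poly f w ^ p = eval_int_poly f (w ^ p) + of_nat p * eval_int_poly q w"
proof (induction f)
  case 0
  then show ?case using p by (intro exI[of _ 0]) (auto simp: prime_gt_0_nat)
next
  case (pCons a f)
  then obtain q where q: "eval_int_poly f w ^ p = eval_int_poly f (w ^ p) + of_nat p * eval_int_poly q w"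
    by blast
  have "int p dvd a ^ p - a"
  proof -
    have "\<exists>c. (int m) ^ p - int m = int p * c" for m
    proof (induction m)
      case 0
      then show ?case using p by (intro exI[of _ 0]) (auto simp: prime_gt_0_nat)
    next
      case (Suc m)
      then obtain c where c: "(int m) ^ p - int m = int p * c" by blast
      have "(int m + 1) ^ p = (\<Sum>k\<le>p. of_nat (p choose k) * int m ^ k)"
        by (subst binomial_ring) auto
      also have "{..p} = insert 0 (insert p {1..<p})"
        using prime_gt_0_nat[OF p] by auto
      also have "(\<Sum>k\<in>\<dots>. of_nat (p choose k) * int m ^ k)
          = 1 + int m ^ p + (\<Sum>k\<in>{1..<p}. of_nat (p choose k) * int m ^ k)"
        using prime_gt_0_nat[OF p] by (subst sum.insert) auto
      also have "(\<Sum>k\<in>{1..<p}. of_nat (p choose k) * int m ^ k)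
          = int p * (\<Sum>k\<in>{1..<p}. of_nat ((p choose k) div p) * int m ^ k)"
        unfolding sum_distrib_left
      proof (rule sum.cong)
        fix k assume "k \<in> {1..<p}"
        then have "p dvd p choose k"
          by (intro dvd_choose_prime) (use p in auto)
        then show "int (p choose k) * int m ^ k = int p * (int ((p choose k) div p) * int m ^ k)"
          by (auto elim!: dvdE simp: p prime_gt_0_nat)
      qed auto
      finally show ?case using c by (auto simp: algebra_simps intro!: exI[of _ "c + _"])
    qed
    then have nn: "int p dvd (int m) ^ p - int m" for m by (metis dvdI)
    show ?thesis
    proof (cases "a \<ge> 0")
      case True
      then show ?thesis using nn[of "nat a"] by simp
    next
      case False
      define b where "b = nat (- a)"
      have ab: "a = - int b" using False by (simp add: b_def)
      show ?thesis
      proof (cases "p = 2")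
        case True
        have "even (int b ^ 2 - int b)" by auto
        then show ?thesis using ab True by auto
      next
        case False
        then have "odd p" using p prime_odd_nat prime_ge_2_nat
          by (metis order_le_imp_less_or_eq)
        then have "a ^ p - a = - (int b ^ p - int b)" using ab by simp
        then show ?thesis using nn[of b] by (metis dvd_minus_iff)
      qed
    qed
  qed
  then obtain c where c: "a ^ p = a + int p * c"
    by (metis add_diff_cancel_left' diff_add_cancel add.commute dvdE)
  define y where "y = w * eval_int_poly f w"
  define r where "r = (\<Sum>k\<in>{1..<p}. smult (int ((p choose k) div p) * a ^ k) ((pCons 0 f) ^ (p - k)))"
  have "(of_int a + y) ^ p = (\<Sum>k\<le>p. of_nat (p choose k) * of_int a ^ k * y ^ (p - k))"
    by (rule binomial_ring)
  also have "{..p} = insert 0 (insert p {1..<p})"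
    using prime_gt_0_nat[OF p] by auto
  also have "(\<Sum>k\<in>\<dots>. of_nat (p choose k) * of_int a ^ k * y ^ (p - k))
      = y ^ p + of_int a ^ p + (\<Sum>k\<in>{1..<p}. of_nat (p choose k) * of_int a ^ k * y ^ (p - k))"
    using prime_gt_0_nat[OF p] by (subst sum.insert) auto
  also have "(\<Sum>k\<in>{1..<p}. of_nat (p choose k) * of_int a ^ k * y ^ (p - k))
      = of_nat p * eval_int_poly r w"
    unfolding r_def eval_int_poly_sum sum_distrib_left
  proof (rule sum.cong)
    fix k assume "k \<in> {1..<p}"
    then have "p dvd p choose k"
      by (intro dvd_choose_prime) (use p in auto)
    then obtain d where "p choose k = p * d" by blast
    then show "of_nat (p choose k) * of_int a ^ k * y ^ (p - k) = of_nat p *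
        eval_int_poly (smult (int ((p choose k) div p) * a ^ k) (pCons 0 f ^ (p - k))) w"
      using prime_gt_0_nat[OF p] by (simp add: y_def)
  qed auto
  also have "y ^ p = w ^ p * eval_int_poly f (w ^ p) + of_nat p * (w ^ p * eval_int_poly q w)"
    by (simp add: y_def power_mult_distrib q algebra_simps)
  also have "(of_int a :: complex) ^ p = of_int a + of_nat p * of_int c"
    using arg_cong[OF c, of "of_int :: int \<Rightarrow> complex"] by simp
  finally have "eval_int_poly (pCons a f) w ^ p = eval_int_poly (pCons a f) (w ^ p) +
      of_nat p * eval_int_poly (monom 1 p * q + [:c:] + r) w"
    by (simp add: y_def algebra_simps)
  then show ?case by blast
qed

lemma unit_lead_coeff_division:
  fixes f g :: "int poly"
  assumes "\<bar>lead_coeff g\<bar> = 1"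
  shows "\<exists>q r. f = g * q + r \<and> (r = 0 \<or> degree r < degree g)"
proof -
  from assms have g: "g \<noteq> 0" by auto
  obtain q r where qr: "pseudo_divmod f g = (q, r)" by force
  define c where "c = lead_coeff g ^ (Suc (degree f) - degree g)"
  have cc: "\<bar>c\<bar> = 1" unfolding c_def using assms by (simp add: power_abs)
  then have c2: "c * c = 1" by (metis abs_mult abs_mult_self_eq mult_1)
  have "smult c f = g * q + r" unfolding c_def using pseudo_divmod(1)[OF g qr] .
  then have "smult c (smult c f) = g * smult c q + smult c r"
    by (simp add: smult_add_right)
  then have "f = g * smult c q + smult c r" by (simp add: c2)
  moreover have "smult c r = 0 \<or> degree (smult c r) < degree g"
    using pseudo_divmod(2)[OF g qr] by auto
  ultimately show ?thesis by blast
qed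

text \<open>A prime divisor \<open>g\<close> of \<open>X\<^sup>n - 1\<close> in \<open>\<int>[X]\<close> with root \<open>w\<close> has the least degree among
  the polynomials vanishing at \<open>w\<close>, and it divides all of these.\<close>
lemma cyclotomic_factor_exists:
  assumes n: "n > 0" and w: "w ^ n = 1"
  obtains g h :: "int poly" where "monom 1 n - 1 = g * h" "\<bar>lead_coeff g\<bar> = 1" "degree g > 0"
    "eval_int_poly g w = 0" "\<And>f. eval_int_poly f w = 0 \<Longrightarrow> g dvd f"
proof -
  define X where "X = (monom 1 n - 1 :: int poly)"
  have cX: "coeff X n = 1" using n by (simp add: X_def)
  have X0: "X \<noteq> 0" using cX by auto
  have degX: "degree X = n"
    using n cX by (intro antisym le_degree degree_le) (auto simp: X_def)
  have eX: "eval_int_poly X w = 0" using w by (simp add: X_def)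
  define P where "P = prime_factorization X"
  have "normalize (prod_mset P) = normalize X"
    unfolding P_def by (rule prod_mset_prime_factorization_weak[OF X0])
  then have "X dvd prod_mset P" by (metis dvd_normalize_iff dvd_refl)
  then have "eval_int_poly (prod_mset P) w = 0" using eX by (auto elim!: dvdE)
  then obtain g where g: "g \<in># P" "eval_int_poly g w = 0"
    using eval_int_poly_prod_mset_eq_0 by blast
  have pg: "prime g" and gX: "g dvd X" using g(1) by (auto simp: P_def)
  obtain h where h: "X = g * h" using gX by blast
  have "lead_coeff g * lead_coeff h = 1"
    using cX degX unfolding h by (metis lead_coeff_mult)
  then have lg: "\<bar>lead_coeff g\<bar> = 1" by (simp add: zmult_eq_1_iff) auto
  have g0: "g \<noteq> 0" using lg by auto
  have nonconst: "degree f > 0" if "f \<noteq> 0" "eval_int_poly f w = 0" for f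
  proof (rule ccontr)
    assume "\<not> degree f > 0"
    then obtain c where "f = [:c:]" by (metis degree_eq_zeroE gr0I)
    then show False using that by simp
  qed
  define S where "S = {f. f \<noteq> 0 \<and> eval_int_poly f w = 0}"
  \<comment> \<open>\<open>r\<close> has the least degree among all nonzero integer polynomials vanishing at \<open>w\<close>; it need not be primitive\<close>
  obtain r where r: "r \<in> S" "\<And>f. f \<in> S \<Longrightarrow> degree r \<le> degree f"
    using ex_has_least_nat[of "\<lambda>f. f \<in> S" g degree] g0 g(2) S_def by blast
  have r0: "r \<noteq> 0" and er: "eval_int_poly r w = 0" using r(1) by (auto simp: S_def)
  have "g dvd r"
  proof -
    obtain a q where aq: "a \<noteq> 0" "smult a g = r * q + pseudo_mod g r"
      using pseudo_mod(1)[OF r0] by blast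
    have "eval_int_poly (smult a g) w = 0" using g by simp
    then have "eval_int_poly (pseudo_mod g r) w = 0" unfolding aq(2) by (simp add: er)
    moreover have "pseudo_mod g r = 0 \<or> degree (pseudo_mod g r) < degree r"
      using pseudo_mod(2)[OF r0] .
    ultimately have "pseudo_mod g r = 0"
      using r(2)[of "pseudo_mod g r"] by (force simp: S_def)
    then have eq: "smult a g = r * q" using aq by simp
    then have "g dvd r * q" by (metis dvd_refl dvd_smult)
    then consider "g dvd r" | "g dvd q" using pg prime_dvd_mult_iff by blast
    then show ?thesis
    proof cases
      case 2
      then obtain s where s: "q = g * s" by blast
      have "g * [:a:] = g * (r * s)" using eq s by (simp add: mult_ac)
      then have "[:a:] = r * s" using g0 by (metis mult_left_cancel)
      moreover have "s \<noteq> 0" using calculation aq(1) by auto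
      ultimately have "degree r = 0"
        using degree_mult_eq[of r s] r0 by (metis add_is_0 degree_pCons_0)
      then show ?thesis using nonconst[OF r0 er] by simp
    qed
  qed
  then have dg: "degree g \<le> degree r" using r0 by (rule dvd_imp_degree_le)
  have "g dvd f" if f: "eval_int_poly f w = 0" for f
  proof -
    obtain q s where qs: "f = g * q + s" "s = 0 \<or> degree s < degree g"
      using unit_lead_coeff_division[OF lg] by blast
    have "eval_int_poly s w = 0" using f g by (simp add: qs(1))
    then have "s = 0" using qs(2) r(2)[of s] dg by (force simp: S_def)
    then show ?thesis using qs by simp
  qed
  then show thesis
    using that[of g h] h lg nonconst[OF g0 g(2)] g(2) by (simp add: X_def)
qed

text \<open>The classical argument for the irreducibility of cyclotomic polynomials. If the minimal polynomial \<open>g\<close>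
  of \<open>w\<close> does not vanish at \<open>w\<^sup>p\<close>, then the cofactor \<open>h = (X\<^sup>n - 1) / g\<close> does, and so \<open>p\<close> divides
  \<open>h(w)\<^sup>p\<close>. As \<open>h(w)\<close> divides \<open>n\<close>, this makes \<open>p\<close> a divisor of \<open>n\<^sup>p\<close> in \<open>\<int>[w]\<close>, hence in \<open>\<int>\<close>.\<close>
lemma eval_int_poly_root_prime_power:
  assumes n: "n > 0" and w: "w ^ n = 1" and p: "prime p" and pn: "\<not> p dvd n"
    and f: "eval_int_poly f w = 0"
  shows "eval_int_poly f (w ^ p) = 0"
proof -
  obtain g h where gh: "monom 1 n - 1 = g * h" and lg: "\<bar>lead_coeff g\<bar> = 1" and dg: "degree g > 0"
    and g: "eval_int_poly g w = 0" and dv: "\<And>f. eval_int_poly f w = 0 \<Longrightarrow> g dvd f"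
    using cyclotomic_factor_exists[OF n w] by blast
  have "eval_int_poly g (w ^ p) = 0"
  proof (rule ccontr)
    assume ne: "eval_int_poly g (w ^ p) \<noteq> 0"
    have "eval_int_poly (g * h) (w ^ p) = 0"
      unfolding gh[symmetric] using w by (simp flip: power_mult) (metis mult.commute power_mult power_one)
    then have "eval_int_poly h (w ^ p) = 0" using ne by simp
    then obtain q where q: "eval_int_poly h w ^ p = of_nat p * eval_int_poly q w"
      using eval_int_poly_frobenius[OF p, of h w] by auto
    \<comment> \<open>differentiating \<open>X\<^sup>n - 1 = g h\<close> at \<open>w\<close> shows that \<open>h(w)\<close> divides \<open>n\<close>\<close>
    have "pderiv (monom 1 n - 1 :: int poly) = pderiv g * h + g * pderiv h"
      unfolding gh by (simp add: pderiv_mult algebra_simps)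
    then have "of_nat n * w ^ (n - 1) = eval_int_poly (pderiv g) w * eval_int_poly h w"
      using arg_cong[of "pderiv (monom 1 n - 1 :: int poly)" _ "\<lambda>f. eval_int_poly f w"] g
      by (simp add: pderiv_diff pderiv_monom del: of_nat_eq_iff) (metis eval_int_poly_add
        eval_int_poly_monom eval_int_poly_mult mult_zero_left add.right_neutral of_int_of_nat_eq)
    then have "of_nat n * (w * w ^ (n - 1)) = w * eval_int_poly (pderiv g) w * eval_int_poly h w"
      by (simp add: algebra_simps)
    also have "w * w ^ (n - 1) = 1" using n w by (metis power_minus_mult mult.commute)
    finally have "of_nat n ^ p = (w * eval_int_poly (pderiv g) w) ^ p * eval_int_poly h w ^ p"
      by (simp flip: power_mult_distrib)
    then have *: "of_nat n ^ p = of_nat p * eval_int_poly (pCons 0 (pderiv g) ^ p * q) w"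
      by (simp add: q)
    define Q where "Q = pCons 0 (pderiv g) ^ p * q"
    have "eval_int_poly (smult (int p) Q - [:int n ^ p:]) w = 0"
      using * by (simp add: Q_def)
    then obtain s where s: "smult (int p) Q - [:int n ^ p:] = g * s" using dv by blast
    \<comment> \<open>modulo \<open>p\<close> the left side is constant; as \<open>g\<close> is nonconstant, \<open>s\<close> vanishes modulo \<open>p\<close>\<close>
    have ps: "int p dvd coeff s i" for i
    proof (rule ccontr)
      assume nd: "\<not> int p dvd coeff s i"
      define I where "I = {i. \<not> int p dvd coeff s i}"
      have sub: "I \<subseteq> {..degree s}"
        unfolding I_def using coeff_eq_0[of s] by (auto intro!: leI)
      then have fI: "finite I" by (rule finite_subset) auto
      define m where "m = Max I"
      have mI: "m \<in> I" unfolding m_def using nd fI by (intro Max_in) (auto simp: I_def)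
      have big: "int p dvd coeff s i" if "i > m" for i
        using Max_ge[OF fI, of i] that by (auto simp: m_def I_def)
      define d where "d = degree g"
      have "coeff (g * s) (d + m) = (\<Sum>i\<le>d + m. coeff g i * coeff s (d + m - i))"
        by (rule coeff_mult)
      also have "\<dots> = lead_coeff g * coeff s m + (\<Sum>i\<in>{..d + m} - {d}. coeff g i * coeff s (d + m - i))"
        by (subst sum.remove[of _ d]) (auto simp: d_def)
      finally have e: "coeff (g * s) (d + m) = lead_coeff g * coeff s m + (\<Sum>i\<in>{..d + m} - {d}. coeff g i * coeff s (d + m - i))" .
      have "int p dvd (\<Sum>i\<in>{..d + m} - {d}. coeff g i * coeff s (d + m - i))"
      proof (rule dvd_sum)
        fix i assume i: "i \<in> {..d + m} - {d}"
        show "int p dvd coeff g i * coeff s (d + m - i)"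
        proof (cases "i < d")
          case True
          then show ?thesis using big[of "d + m - i"] by simp
        next
          case False
          then show ?thesis using i coeff_eq_0[of g i] by (simp add: d_def)
        qed
      qed
      moreover have "int p dvd coeff (g * s) (d + m)"
        unfolding s[symmetric] using dg by (simp add: d_def coeff_pCons split: nat.splits)
      ultimately have "int p dvd lead_coeff g * coeff s m"
        unfolding e by (simp add: dvd_add_left_iff)
      moreover have "lead_coeff g = 1 \<or> lead_coeff g = -1" using lg by linarith
      ultimately have "int p dvd coeff s m" by auto
      then show False using mI by (simp add: I_def)
    qed
    have "coeff (g * s) 0 = coeff g 0 * coeff s 0" by (simp add: coeff_mult)
    then have "int p * coeff Q 0 - int n ^ p = coeff g 0 * coeff s 0"
      unfolding s[symmetric] by simp
    then have "int p dvd int n ^ p"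
      using ps[of 0] by (metis diff_diff_eq2 diff_eq_eq dvd_diff dvd_mult dvd_triv_left add_diff_cancel_left')
    then have "p dvd n ^ p" by (metis int_dvd_int_iff of_nat_power)
    then show False using pn p prime_dvd_power_nat by blast
  qed
  then show ?thesis using dv[OF f] by (auto elim!: dvdE)
qed

lemma eval_int_poly_root_coprime_power:
  assumes n: "n > 0" and w: "w ^ n = 1" and k: "coprime k n" "k > 0"
    and f: "eval_int_poly f w = 0"
  shows "eval_int_poly f (w ^ k) = 0"
  using k w f
proof (induction k arbitrary: w rule: prime_divisors_induct)
  case zero
  then show ?case by simp
next
  case (unit k)
  then show ?case by simp
next
  case (factor p k)
  have c: "coprime p n" "coprime k n" using factor.prems by auto
  have "\<not> p dvd n" using c(1) factor.hyps
    by (metis coprime_absorb_left not_prime_unit)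
  then have "eval_int_poly f (w ^ p) = 0"
    using eval_int_poly_root_prime_power[OF n] factor by blast
  moreover have "(w ^ p) ^ n = 1" using factor.prems
    by (metis mult.commute power_mult power_one)
  ultimately have "eval_int_poly f ((w ^ p) ^ k) = 0"
    using factor.IH c factor.prems by (metis gr0I mult_0_right)
  then show ?case by (simp flip: power_mult)
qed

text \<open>Galois conjugation of a linear relation with rational coefficients between powers of a root
  of unity.\<close>
lemma rational_relation_conjugate:
  fixes c :: "nat \<Rightarrow> rat"
  assumes n: "n > 0" and w: "w ^ n = 1" and k: "coprime k n" "k > 0"
    and c: "(\<Sum>i<m. of_rat (c i) * w ^ i) = (0 :: complex)"
  shows "(\<Sum>i<m. of_rat (c i) * (w ^ k) ^ i) = (0 :: complex)"
proof -
  define d where "d i = snd (quotient_of (c i))" for i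
  define D where "D = (\<Prod>i<m. d i)"
  have d0: "d i > 0" for i by (simp add: d_def quotient_of_denom_pos')
  then have D0: "D > 0" by (simp add: D_def prod_pos)
  have "\<exists>e. of_int D * c i = of_int e" if "i < m" for i
  proof -
    have "c i = of_int (fst (quotient_of (c i))) / of_int (d i)"
      by (simp add: d_def) (metis prod.collapse quotient_of_div)
    moreover have "D = d i * (\<Prod>j\<in>{..<m} - {i}. d j)"
      unfolding D_def using that by (subst prod.remove[of _ i]) auto
    ultimately have "of_int D * c i = of_int (fst (quotient_of (c i)) * (\<Prod>j\<in>{..<m} - {i}. d j))"
      using d0[of i] by (simp add: field_simps)
    then show ?thesis by blast
  qed
  then obtain e where e: "\<And>i. i < m \<Longrightarrow> of_int D * c i = of_int (e i)" by metis
  have e': "of_int (e i) = (of_int D * of_rat (c i) :: complex)" if "i < m" for i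
    using arg_cong[OF e[OF that], of "of_rat :: rat \<Rightarrow> complex"] by (simp add: of_rat_mult)
  define f where "f = (\<Sum>i<m. monom (e i) i)"
  have ef: "eval_int_poly f x = of_int D * (\<Sum>i<m. of_rat (c i) * x ^ i)" for x
    unfolding f_def eval_int_poly_sum sum_distrib_left
    by (rule sum.cong) (auto simp: e' mult_ac)
  have "eval_int_poly f w = 0" by (simp add: ef c)
  then have "eval_int_poly f (w ^ k) = 0"
    using eval_int_poly_root_coprime_power[OF n w k] by blast
  then show ?thesis using D0 by (simp add: ef)
qed

section \<open>Semilinear maps of the complex plane\<close>

lemma sum_periodic_shift:
  fixes g :: "int \<Rightarrow> 'a::ab_group_add"
  assumes "\<And>i. g (i + int n) = g i"
  shows "(\<Sum>i<n. g (int i + 1)) = (\<Sum>i<n. g (int i))"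
proof (cases n)
  case (Suc m)
  have "(\<Sum>i<n. g (int i)) = g 0 + (\<Sum>i<m. g (int i + 1))"
    unfolding Suc by (subst sum.lessThan_Suc_shift) (simp add: add.commute)
  moreover have "(\<Sum>i<n. g (int i + 1)) = (\<Sum>i<m. g (int i + 1)) + g (0 + int n)"
    unfolding Suc by (simp add: add.commute)
  ultimately show ?thesis using assms[of 0] by (simp add: add.commute)
qed auto

lemma sum_periodic_reflect:
  fixes g :: "int \<Rightarrow> 'a::ab_group_add"
  assumes "\<And>i. g (i + int n) = g i"
  shows "(\<Sum>i<n. g (- int i)) = (\<Sum>i<n. g (int i))"
proof -
  have "(\<Sum>i<n. g (- int i)) = (\<Sum>i<n. g (- (int i + 1)))"
    using sum_periodic_shift[of "\<lambda>i. g (- i)" n] assms[of "- _ - int n"] by (simp add: algebra_simps)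
  also have "\<dots> = (\<Sum>i<n. g (int (n - Suc i)))"
  proof (rule sum.cong)
    fix i assume "i \<in> {..<n}"
    then have "int (n - Suc i) = - (int i + 1) + int n" by auto
    then show "g (- (int i + 1)) = g (int (n - Suc i))" using assms by metis
  qed auto
  also have "\<dots> = (\<Sum>i<n. g (int i))" by (rule sum.nat_diff_reindex)
  finally show ?thesis .
qed

lemma cis_eq_1_iff_int: "cis t = 1 \<longleftrightarrow> (\<exists>m::int. t = 2 * pi * of_int m)"
proof
  assume "cis t = 1"
  then have "cos t = 1" by (metis cis.sel(1) one_complex.sel(1))
  then show "\<exists>m::int. t = 2 * pi * of_int m" by (auto simp: cos_one_2pi_int mult_ac)
qed auto

lemma complex_of_real_of_rat: "complex_of_real (of_rat q) = of_rat q"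
  by (cases q) (simp add: of_rat_rat)

text \<open>An additive map of the plane compatible with the Galois conjugation \<open>\<zeta> \<mapsto> \<zeta>\<^sup>k\<close> of the \<open>n\<close>-th roots
  of unity: it satisfies \<open>\<phi>(\<zeta> z) = \<zeta>\<^sup>k \<phi>(z)\<close> and maps the real line into itself. Such a map takes every line
  whose direction is an \<open>n\<close>-th root of unity into a line; on the line itself it is in general not monotone,
  not even continuous.\<close>
definition semilinear :: "nat \<Rightarrow> nat \<Rightarrow> (complex \<Rightarrow> complex) \<Rightarrow> bool" where
  "semilinear n k \<phi> \<longleftrightarrow>
     (\<forall>x y. \<phi> (x + y) = \<phi> x + \<phi> y) \<and>
     (\<forall>m::int. \<forall>z. \<phi> (cis (2 * pi * of_int m / real n) * z) = cis (real k * (2 * pi * of_int m / real n)) * \<phi> z) \<and>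
     (\<forall>x::real. Im (\<phi> (of_real x)) = 0)"

lemma semilinear_combination:
  assumes "semilinear n k \<phi>" "semilinear n k \<psi>"
  shows "semilinear n k (\<lambda>z. \<phi> z + of_real t * \<psi> z)"
  using assms by (simp add: semilinear_def algebra_simps)

text \<open>Averaging over the roots of unity turns every additive functional \<open>l\<close> of the reals into a semilinear
  map. No field automorphism is needed for this; one is implicit only in the question whether the map vanishes.\<close>
lemma semilinear_trace:
  assumes n: "n > 0" and l: "\<And>x y. l (x + y) = l x + l (y::real)"
  shows "semilinear n k (\<lambda>z. \<Sum>i<n. of_real (l (Re (cis (- (2 * pi * real i / real n)) * z))) *
           cis (real k * (2 * pi * real i / real n)))"
    (is "semilinear n k ?\<phi>")
proof -
  define th where "th i = 2 * pi * of_int i / real n" for i :: int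
  have th_n: "th (i + int n) = th i + 2 * pi" for i
    using n by (simp add: th_def field_simps)
  have cis_th: "cis (th (i + int n)) = cis (th i)" for i
    unfolding th_n by (simp add: cis_mult[symmetric])
  have cis_kth: "cis (real j * th (i + int n)) = cis (real j * th i)" for i j
    unfolding th_n distrib_left by (simp add: cis_mult[symmetric] cis_eq_1_iff_int)
      (metis of_int_of_nat_eq mult.commute)
  have cis_mth: "cis (- th (i + int n)) = cis (- th i)" for i
    using cis_th[of i] by (metis cis_cnj)
  define g where "g z i = of_real (l (Re (cis (- th i) * z))) * cis (real k * th i)" for z i
  have g_per: "g z (i + int n) = g z i" for z i
    by (simp add: g_def cis_kth cis_mth)
  define F where "F = ?\<phi>"
  have phi: "F z = (\<Sum>i<n. g z (int i))" for z
    by (simp add: F_def g_def th_def)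
  have add: "F (x + y) = F x + F y" for x y
    by (simp add: phi g_def ring_distribs l sum.distrib)
  have th_add: "th (i + j) = th i + th j" for i j
    by (simp add: th_def ring_distribs add_divide_distrib)
  have step: "F (cis (th 1) * z) = cis (real k * th 1) * F z" for z
  proof -
    have "F (cis (th 1) * z) = (\<Sum>i<n. g (cis (th 1) * z) (int i + 1))"
      unfolding phi by (rule sum_periodic_shift[symmetric]) (rule g_per)
    also have "\<dots> = (\<Sum>i<n. cis (real k * th 1) * g z (int i))"
    proof (rule sum.cong)
      fix i
      have "cis (- th (int i + 1)) * cis (th 1) = cis (- th (int i))"
        by (simp add: th_add cis_mult)
      then have 1: "cis (- th (int i + 1)) * (cis (th 1) * z) = cis (- th (int i)) * z"
        by (metis mult.assoc)
      have 2: "cis (real k * th (int i + 1)) = cis (real k * th 1) * cis (real k * th (int i))"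
        by (simp add: th_add ring_distribs cis_mult add.commute)
      show "g (cis (th 1) * z) (int i + 1) = cis (real k * th 1) * g z (int i)"
        unfolding g_def 1 2 by (simp only: mult_ac)
    qed auto
    finally show ?thesis unfolding phi sum_distrib_left .
  qed
  have nat: "F (cis (th (int m)) * z) = cis (real k * th (int m)) * F z" for m z
  proof (induction m arbitrary: z)
    case (Suc m)
    have "th (int (Suc m)) = th (int m) + th 1" by (simp add: add.commute flip: th_add)
    then have "cis (th (int (Suc m))) * z = cis (th (int m)) * (cis (th 1) * z)"
      "cis (real k * th (int (Suc m))) = cis (real k * th (int m)) * cis (real k * th 1)"
      by (simp_all add: cis_mult[symmetric] ring_distribs)
    then show ?case using Suc step by (metis mult.assoc)
  qed (simp add: th_def)
  have per: "cis (real j * th (i + int n * int m)) = cis (real j * th i)" for i j m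
  proof (induction m)
    case (Suc m)
    have "i + int n * int (Suc m) = (i + int n * int m) + int n" by (simp add: algebra_simps)
    then show ?case using Suc cis_kth by metis
  qed simp
  have "F (cis (th m) * z) = cis (real k * th m) * F z" for m z
  proof -
    define r where "r = m mod int n"
    have "r \<ge> 0" using n by (simp add: r_def)
    have "cis (real j * th m) = cis (real j * th r)" for j
    proof (cases "m \<ge> r")
      case True
      have "int n dvd m - r" by (simp add: r_def)
      then obtain q where q: "m - r = int n * q" by blast
      then have "q \<ge> 0" using True n by (smt (verit) mult_le_0_iff of_nat_0_less_iff mult_pos_neg)
      then have "m = r + int n * int (nat q)" using q by simp
      then show ?thesis using per by metis
    next
      case False
      have "int n dvd r - m" by (simp add: r_def mod_eq_dvd_iff[symmetric])
      then obtain q where q: "r - m = int n * q" by blast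
      then have "q \<ge> 0" using False n by (smt (verit) mult_le_0_iff of_nat_0_less_iff mult_pos_neg)
      then have "r = m + int n * int (nat q)" using q by simp
      then show ?thesis using per by metis
    qed
    from this[of 1] this[of k] nat[of "nat r" z] \<open>r \<ge> 0\<close> show ?thesis by simp
  qed
  moreover have "Im (F (of_real x)) = 0" for x
  proof -
    define h where "h i = Im (g (of_real x) i)" for i
    have "h (i + int n) = h i" for i by (simp add: h_def g_per)
    then have "(\<Sum>i<n. h (- int i)) = (\<Sum>i<n. h (int i))" by (rule sum_periodic_reflect)
    moreover have "h (- i) = - h i" for i
      by (simp add: h_def g_def th_def)
    ultimately have "(\<Sum>i<n. h (int i)) = 0" by (simp add: sum_negf)
    then show ?thesis by (simp add: phi h_def)
  qed
  ultimately show ?thesis using add unfolding semilinear_def th_def F_def by blast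
qed

text \<open>If all the maps of the previous lemma vanished at \<open>z\<close> for the coordinate functionals \<open>l\<close> of a basis of
  the reals over the rationals, then, by conjugation, the same would hold with \<open>1\<close> in place of \<open>k\<close>.
  Summing up over the basis would give the map for \<open>k = 1\<close> and \<open>l\<close> the identity, which is
  multiplication by \<open>n / 2\<close>.\<close>
lemma semilinear_nonzero_at:
  assumes n: "n > 2" and k: "coprime k n" and z: "z \<noteq> 0"
  shows "\<exists>\<phi>. semilinear n k \<phi> \<and> \<phi> z \<noteq> 0"
proof (rule ccontr)
  assume none: "\<not> ?thesis"
  interpret Q: vector_space "\<lambda>(q::rat) (x::real). of_rat q * x"
    by unfold_locales (auto simp: algebra_simps of_rat_add of_rat_mult)
  define B where "B = Q.extend_basis {}"
  have iB: "Q.independent B" and sB: "Q.span B = UNIV"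
    using Q.independent_extend_basis[of "{}"] Q.span_extend_basis[of "{}"] Q.independent_empty
    by (simp_all add: B_def)
  define th where "th i = 2 * pi * real i / real n" for i
  define x where "x i = Re (cis (- th i) * z)" for i
  define rp where "rp = Q.representation B"
  define w where "w = cis (real k * th 1)"
  have cw: "cis (real k * th i) = w ^ i" for i
    unfolding w_def Complex.DeMoivre by (rule arg_cong[of _ _ cis]) (simp add: th_def)
  have rel: "(\<Sum>i<n. of_rat (rp (x i) b) * w ^ i) = (0::complex)" for b
  proof -
    define l where "l y = real_of_rat (rp y b)" for y
    have "l (y + y') = l y + l y'" for y y'
      using Q.representation_add[OF iB, of y y'] sB by (simp add: l_def rp_def of_rat_add add.commute)
    then have "semilinear n k (\<lambda>z. \<Sum>i<n. of_real (l (Re (cis (- (2 * pi * real i / real n)) * z))) *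
           cis (real k * (2 * pi * real i / real n)))"
      using n by (intro semilinear_trace) auto
    then have "(\<Sum>i<n. of_real (l (Re (cis (- (2 * pi * real i / real n)) * z))) *
           cis (real k * (2 * pi * real i / real n))) = 0" using none by blast
    then show ?thesis unfolding cw[symmetric] x_def th_def l_def by (simp add: complex_of_real_of_rat)
  qed
  obtain k' where k': "[k * k' = 1] (mod n)" using cong_solve_coprime_nat[OF k] by (metis One_nat_def)
  have k'c: "coprime k' n" using k' by (metis coprime_mult_left_iff cong_imp_coprime cong_sym coprime_1_left)
  have k'0: "k' > 0" using k'c n by (intro gr0I) auto
  have wn: "w ^ n = 1"
    using n by (simp add: w_def Complex.DeMoivre th_def cis_eq_1_iff_int) (metis of_int_of_nat_eq mult.commute)
  define ze where "ze = cis (th 1)"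
  have ze: "w ^ k' = ze"
  proof -
    have zen: "ze ^ n = 1" using n by (simp add: ze_def Complex.DeMoivre th_def)
    have "w = ze ^ k" by (simp add: w_def ze_def Complex.DeMoivre)
    then have "w ^ k' = ze ^ (k * k')" by (simp add: power_mult)
    also have "\<dots> = ze ^ ((k * k') mod n)"
      by (metis zen mult.right_neutral div_mult_mod_eq power_add power_mult power_one mult.commute mult_1)
    also have "(k * k') mod n = 1" using k' n by (simp add: cong_def)
    finally show ?thesis by simp
  qed
  have rel': "(\<Sum>i<n. of_rat (rp (x i) b) * ze ^ i) = (0::complex)" for b
    using rational_relation_conjugate[OF _ wn k'c k'0 rel[of b]] n by (simp add: ze)
  define U where "U = (\<Union>i<n. {b. rp (x i) b \<noteq> 0})"
  have fU: "finite U" unfolding U_def rp_def using Q.finite_representation by auto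
  have xi: "x i = (\<Sum>b\<in>U. of_rat (rp (x i) b) * b)" if "i < n" for i
  proof -
    have "x i = (\<Sum>b | rp (x i) b \<noteq> 0. of_rat (rp (x i) b) * b)"
      unfolding rp_def by (subst Q.sum_nonzero_representation_eq[OF iB]) (auto simp: sB)
    also have "\<dots> = (\<Sum>b\<in>U. of_rat (rp (x i) b) * b)"
      using fU that by (intro sum.mono_neutral_left) (auto simp: U_def)
    finally show ?thesis .
  qed
  have "(\<Sum>i<n. of_real (x i) * ze ^ i) = (\<Sum>i<n. \<Sum>b\<in>U. of_real b * (of_rat (rp (x i) b) * ze ^ i))"
  proof (rule sum.cong)
    fix i assume "i \<in> {..<n}"
    then have "complex_of_real (x i) = (\<Sum>b\<in>U. of_rat (rp (x i) b) * of_real b)"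
      by (subst xi) (auto simp: complex_of_real_of_rat)
    then show "of_real (x i) * ze ^ i = (\<Sum>b\<in>U. of_real b * (of_rat (rp (x i) b) * ze ^ i))"
      by (simp add: sum_distrib_right sum_distrib_left mult_ac)
  qed auto
  also have "\<dots> = (\<Sum>b\<in>U. of_real b * (\<Sum>i<n. of_rat (rp (x i) b) * ze ^ i))"
    by (subst sum.swap) (simp add: sum_distrib_left)
  also have "\<dots> = 0" by (simp add: rel')
  finally have zero: "(\<Sum>i<n. of_real (x i) * ze ^ i) = 0" .
  \<comment> \<open>\<open>x i\<close> is the real part of \<open>ze\<^sup>-\<^sup>i z\<close>, and the part of the sum with \<open>cnj z\<close> vanishes because of \<open>ze\<^sup>2 \<noteq> 1\<close>\<close>
  have summand: "of_real (x i) * ze ^ i = z / 2 + cnj z / 2 * (ze ^ 2) ^ i" for i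
  proof -
    have "of_real (x i) = (cis (- th i) * z + cis (th i) * cnj z) / 2"
      by (simp add: x_def complex_eq_iff)
    moreover have "ze ^ i = cis (th i)" by (simp add: ze_def Complex.DeMoivre th_def mult_ac)
    moreover have "(ze ^ 2) ^ i = (ze ^ i) ^ 2" by (metis power_mult mult.commute)
    moreover have "cis (- th i) * cis (th i) = 1" by (simp add: cis_mult)
    ultimately show ?thesis by (simp add: field_simps power2_eq_square)
  qed
  have "ze ^ 2 \<noteq> 1"
  proof
    assume "ze ^ 2 = 1"
    then have "cis (2 * th 1) = 1" by (simp add: ze_def Complex.DeMoivre)
    then obtain m :: int where "2 * th 1 = 2 * pi * of_int m" using cis_eq_1_iff_int by blast
    then have "2 = real n * of_int m" using n by (simp add: th_def field_simps)
    then have "2 = int n * m" by (metis of_int_eq_iff of_int_mult of_int_numeral of_int_of_nat_eq)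
    then have "int n dvd 2" by (rule dvdI)
    then show False using n zdvd_imp_le by fastforce
  qed
  moreover have "(ze ^ 2) ^ n = 1"
    using n by (simp add: ze_def Complex.DeMoivre th_def cis_eq_1_iff_int)
  ultimately have "(\<Sum>i<n. (ze ^ 2) ^ i) = 0" by (simp add: geometric_sum)
  moreover have "(\<Sum>i<n. of_real (x i) * ze ^ i) = of_nat n * (z / 2) + cnj z / 2 * (\<Sum>i<n. (ze ^ 2) ^ i)"
    unfolding summand sum.distrib sum_distrib_left by simp
  ultimately have "(\<Sum>i<n. of_real (x i) * ze ^ i) = of_nat n * (z / 2)" by simp
  then show False using zero z n by simp
qed

lemma semilinear_exists:
  assumes n: "n > 2" and k: "coprime k n" and Z: "finite Z" "0 \<notin> Z"
  shows "\<exists>\<phi>. semilinear n k \<phi> \<and> (\<forall>z\<in>Z. \<phi> z \<noteq> 0)"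
  using Z
proof (induction Z rule: finite_induct)
  case empty
  have "\<exists>\<phi>. semilinear n k \<phi> \<and> \<phi> 1 \<noteq> 0" by (rule semilinear_nonzero_at[OF n k]) simp
  then show ?case by blast
next
  case (insert y Z)
  then obtain \<phi> where \<phi>: "semilinear n k \<phi>" "\<forall>z\<in>Z. \<phi> z \<noteq> 0" by auto
  have "y \<noteq> 0" using insert.prems by auto
  then obtain \<psi> where \<psi>: "semilinear n k \<psi>" "\<psi> y \<noteq> 0"
    using semilinear_nonzero_at[OF n k] by metis
  \<comment> \<open>for each point there is at most one real \<open>t\<close> at which \<open>\<phi> + t \<psi>\<close> vanishes; \<open>0\<close> is avoided as well\<close>
  define bad where "bad = (\<lambda>z. Re (- \<phi> z / \<psi> z)) ` insert y Z"
  have "finite bad" using insert by (simp add: bad_def)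
  then obtain t where t: "t \<notin> insert 0 bad"
    by (meson finite_insert ex_new_if_finite infinite_UNIV_char_0)
  have "\<phi> z + of_real t * \<psi> z \<noteq> 0" if z: "z \<in> insert y Z" for z
  proof
    assume e: "\<phi> z + of_real t * \<psi> z = 0"
    show False
    proof (cases "\<psi> z = 0")
      case True
      then show False using e z \<phi> \<psi> by auto
    next
      case False
      then have "of_real t = - \<phi> z / \<psi> z"
        using e by (simp add: field_simps add_eq_0_iff)
      then have "t = Re (- \<phi> z / \<psi> z)" by (metis Re_complex_of_real)
      then show False using t z by (auto simp: bad_def)
    qed
  qed
  then show ?case using semilinear_combination[OF \<phi>(1) \<psi>(1)] by blast
qed

section \<open>Boundary sums over triangulations\<close>

text \<open>Twice the signed area of the triangle \<open>A B z\<close>; as a function of \<open>z\<close>, a multiple of the signed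
  distance from the line \<open>A B\<close>, positive on its left side.\<close>
definition orient :: "complex \<Rightarrow> complex \<Rightarrow> complex \<Rightarrow> real" where
  "orient A B z = Im (cnj (B - A) * (z - A))"

lemma orient_rotate: "orient B C A = orient A B C"
  by (simp add: orient_def algebra_simps)

lemma orient_sum: "orient A B z + orient B C z + orient C A z = orient A B C"
  by (simp add: orient_def algebra_simps)

lemma orient_affine:
  assumes "u + v + t = 1"
  shows "orient A B (of_real u * x + of_real v * y + of_real t * z) = u * orient A B x + v * orient A B y + t * orient A B z"
proof -
  have u: "u = 1 - v - t" using assms by simp
  show ?thesis unfolding u orient_def by (simp add: algebra_simps)
qed

lemma orient_triv [simp]: "orient A B A = 0" "orient A B B = 0"
  by (simp_all add: orient_def algebra_simps)

lemma barycentric: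
  "of_real (orient A B C) * z = of_real (orient B C z) * A + of_real (orient C A z) * B + of_real (orient A B z) * C"
  by (simp add: orient_def complex_eq_iff algebra_simps)

lemma triangle_iff:
  assumes ccw: "orient A B C > 0"
  shows "z \<in> convex hull {A, B, C} \<longleftrightarrow> orient A B z \<ge> 0 \<and> orient B C z \<ge> 0 \<and> orient C A z \<ge> 0"
proof
  assume "z \<in> convex hull {A, B, C}"
  then obtain u v t where uvt: "0 \<le> u" "0 \<le> v" "0 \<le> t" "u + v + t = 1"
    and z: "z = of_real u * A + of_real v * B + of_real t * C"
    by (auto simp: convex_hull_3 scaleR_conv_of_real)
  have "orient B C A = orient A B C" "orient C A B = orient A B C"
    using orient_rotate by metis+
  then show "orient A B z \<ge> 0 \<and> orient B C z \<ge> 0 \<and> orient C A z \<ge> 0"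
    unfolding z orient_affine[OF uvt(4)] using uvt ccw by simp
next
  assume *: "orient A B z \<ge> 0 \<and> orient B C z \<ge> 0 \<and> orient C A z \<ge> 0"
  define D where "D = orient A B C"
  have D: "D > 0" using ccw by (simp add: D_def)
  have "z = of_real (orient B C z / D) * A + of_real (orient C A z / D) * B + of_real (orient A B z / D) * C"
    using barycentric[of A B C z] D by (simp add: D_def field_simps)
  moreover have "orient B C z / D + orient C A z / D + orient A B z / D = 1"
    using orient_sum[of A B z C] D by (simp add: D_def flip: add_divide_distrib)
  ultimately show "z \<in> convex hull {A, B, C}"
    unfolding convex_hull_3 scaleR_conv_of_real using * D
    by (intro CollectI exI[of _ "orient B C z / D"] exI[of _ "orient C A z / D"] exI[of _ "orient A B z / D"]) simp
qed

text \<open>The open triangle, given as an intersection of half-planes; \<open>A\<close>, \<open>B\<close>, \<open>C\<close> are in counterclockwise order.\<close>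
definition inside :: "complex \<Rightarrow> complex \<Rightarrow> complex \<Rightarrow> complex \<Rightarrow> bool" where
  "inside A B C z \<longleftrightarrow> orient A B z > 0 \<and> orient B C z > 0 \<and> orient C A z > 0"

lemma continuous_on_orient: "continuous_on UNIV (orient A B)"
  unfolding orient_def by (intro continuous_intros)

lemma inside_interior:
  assumes "orient A B C > 0" "inside A B C z"
  shows "z \<in> interior (convex hull {A, B, C})"
proof (rule interiorI)
  show "open {z. inside A B C z}"
  proof -
    have *: "open {z. orient x y z > 0}" for x y
      using open_Collect_less[OF continuous_on_const continuous_on_orient] .
    have "{z. inside A B C z} = {z. orient A B z > 0} \<inter> {z. orient B C z > 0} \<inter> {z. orient C A z > 0}"
      by (auto simp: inside_def)
    moreover have "open \<dots>" by (intro open_Int *)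
    ultimately show ?thesis by (rule ssubst)
  qed
  show "{z. inside A B C z} \<subseteq> convex hull {A, B, C}"
    unfolding inside_def by (rule subsetI) (simp only: triangle_iff[OF assms(1)] mem_Collect_eq less_imp_le)
  show "z \<in> {z. inside A B C z}" using assms(2) by simp
qed

text \<open>A curve that leaves \<open>X\<close> tangentially to the direction \<open>d\<close>, bending to the left of the ray if
  \<open>\<sigma> > 0\<close> and to its right if \<open>\<sigma> < 0\<close>.\<close>
definition approach :: "complex \<Rightarrow> complex \<Rightarrow> real \<Rightarrow> real \<Rightarrow> complex" where
  "approach X d \<sigma> s = X + of_real s * d + of_real (\<sigma> * s\<^sup>2) * (\<i> * d)"

text \<open>\<open>S\<close> contains an initial piece of that curve. For a polygon this says that \<open>S\<close> covers the left
  (\<open>\<sigma> > 0\<close>) or the right (\<open>\<sigma> < 0\<close>) side of the ray from \<open>X\<close> in the direction \<open>d\<close>, near \<open>X\<close>.\<close>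
definition germ :: "complex set \<Rightarrow> complex \<Rightarrow> complex \<Rightarrow> real \<Rightarrow> bool" where
  "germ S X d \<sigma> \<longleftrightarrow> (\<forall>\<^sub>F s in at_right 0. approach X d \<sigma> s \<in> S)"

text \<open>Lexicographic positivity, which is positivity of \<open>a + b s + c s\<^sup>2\<close> for all small \<open>s > 0\<close>.\<close>
definition lexpos :: "real \<Rightarrow> real \<Rightarrow> real \<Rightarrow> bool" where
  "lexpos a b c \<longleftrightarrow> a > 0 \<or> (a = 0 \<and> (b > 0 \<or> (b = 0 \<and> c > 0)))"

lemma eventually_lexpos:
  assumes "lexpos a b c"
  shows "\<forall>\<^sub>F s in at_right (0::real). a + s * b + s\<^sup>2 * c > 0"
proof -
  have pos: "\<forall>\<^sub>F s in at_right (0::real). s > 0" by (simp add: eventually_at_right_less)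
  consider "a > 0" | "a = 0" "b > 0" | "a = 0" "b = 0" "c > 0"
    using assms by (auto simp: lexpos_def)
  then show ?thesis
  proof cases
    case 1
    have "((\<lambda>s. a + s * b + s\<^sup>2 * c) \<longlongrightarrow> a + 0 * b + 0\<^sup>2 * c) (at_right 0)"
      by (intro tendsto_intros)
    then show ?thesis using 1 by (intro order_tendstoD(1)) auto
  next
    case 2
    have "((\<lambda>s. b + s * c) \<longlongrightarrow> b + 0 * c) (at_right 0)"
      by (intro tendsto_intros)
    then have "\<forall>\<^sub>F s in at_right 0. b + s * c > 0" using 2 by (intro order_tendstoD(1)) auto
    then show ?thesis using pos
    proof eventually_elim
      case (elim s)
      then have "s * (b + s * c) > 0" by simp
      then show ?case using 2 by (simp add: algebra_simps power2_eq_square)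
    qed
  next
    case 3
    from pos show ?thesis by eventually_elim (use 3 in auto)
  qed
qed

lemma orient_approach:
  "orient A B (approach X d \<sigma> s) =
     orient A B X + s * Im (cnj (B - A) * d) + s\<^sup>2 * (\<sigma> * Re (cnj (B - A) * d))"
  by (simp add: orient_def approach_def algebra_simps)

lemma lexpos_cases:
  assumes "A \<noteq> B" "d \<noteq> 0" "\<sigma> \<noteq> 0"
  shows "lexpos (orient A B X) (Im (cnj (B - A) * d)) (\<sigma> * Re (cnj (B - A) * d)) \<or>
         lexpos (- orient A B X) (- Im (cnj (B - A) * d)) (- (\<sigma> * Re (cnj (B - A) * d)))"
proof -
  have "cnj (B - A) * d \<noteq> 0" using assms by simp
  then have "Im (cnj (B - A) * d) \<noteq> 0 \<or> Re (cnj (B - A) * d) \<noteq> 0"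
    by (metis complex_eqI zero_complex.sel)
  then have "Im (cnj (B - A) * d) \<noteq> 0 \<or> \<sigma> * Re (cnj (B - A) * d) \<noteq> 0"
    using assms(3) by auto
  then show ?thesis unfolding lexpos_def by linarith
qed

text \<open>The curve from \<open>X\<close> starts on the left side of the line \<open>A B\<close>.\<close>
definition edge_germ :: "complex \<Rightarrow> complex \<Rightarrow> complex \<Rightarrow> complex \<Rightarrow> real \<Rightarrow> bool" where
  "edge_germ A B X d \<sigma> \<longleftrightarrow> lexpos (orient A B X) (Im (cnj (B - A) * d)) (\<sigma> * Re (cnj (B - A) * d))"

lemma neg_quadratic: "0 < - a + x * - b + y * - c \<Longrightarrow> a + x * b + y * c < (0::real)"
  by simp

lemma edge_germ_eventually:
  assumes "A \<noteq> B" "d \<noteq> 0" "\<sigma> \<noteq> 0"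
  shows "if edge_germ A B X d \<sigma> then \<forall>\<^sub>F s in at_right 0. orient A B (approach X d \<sigma> s) > 0
         else \<forall>\<^sub>F s in at_right 0. orient A B (approach X d \<sigma> s) < 0"
proof (cases "edge_germ A B X d \<sigma>")
  case True
  then show ?thesis unfolding orient_approach using eventually_lexpos by (auto simp: edge_germ_def)
next
  case False
  then have "lexpos (- orient A B X) (- Im (cnj (B - A) * d)) (- (\<sigma> * Re (cnj (B - A) * d)))"
    using lexpos_cases[OF assms] by (auto simp: edge_germ_def)
  from eventually_lexpos[OF this]
  have "\<forall>\<^sub>F s in at_right 0. orient A B (approach X d \<sigma> s) < 0"
    unfolding orient_approach by (rule eventually_mono) (rule neg_quadratic)
  with False show ?thesis by simp
qed

lemma ccw_distinct:
  assumes "orient A B C > 0"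
  shows "A \<noteq> B" "B \<noteq> C" "C \<noteq> A"
  using assms by (auto simp: orient_def algebra_simps)

lemma triangle_germ:
  assumes ccw: "orient A B C > 0" and d: "d \<noteq> 0" and s: "\<sigma> \<noteq> 0"
  shows "germ (convex hull {A, B, C}) X d \<sigma> \<longleftrightarrow>
      edge_germ A B X d \<sigma> \<and> edge_germ B C X d \<sigma> \<and> edge_germ C A X d \<sigma>" (is ?th1)
    and "germ (convex hull {A, B, C}) X d \<sigma> \<Longrightarrow> \<forall>\<^sub>F s in at_right 0. inside A B C (approach X d \<sigma> s)"
    and "\<not> germ (convex hull {A, B, C}) X d \<sigma> \<Longrightarrow> \<forall>\<^sub>F s in at_right 0. approach X d \<sigma> s \<notin> convex hull {A, B, C}"
proof -
  note ne = ccw_distinct[OF ccw]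
  let ?E = "edge_germ A B X d \<sigma> \<and> edge_germ B C X d \<sigma> \<and> edge_germ C A X d \<sigma>"
  note ev = edge_germ_eventually[OF ne(1) d s, of X] edge_germ_eventually[OF ne(2) d s, of X]
    edge_germ_eventually[OF ne(3) d s, of X]
  have 1: "\<forall>\<^sub>F s in at_right 0. inside A B C (approach X d \<sigma> s)" if ?E
    unfolding inside_def using ev that by (auto intro!: eventually_conj)
  have 2: "\<forall>\<^sub>F s in at_right 0. approach X d \<sigma> s \<notin> convex hull {A, B, C}" if nE: "\<not> ?E"
  proof -
    consider "\<not> edge_germ A B X d \<sigma>" | "\<not> edge_germ B C X d \<sigma>" | "\<not> edge_germ C A X d \<sigma>"
      using nE by blast
    then show ?thesis
    proof cases
      case 1
      with ev(1) have "\<forall>\<^sub>F s in at_right 0. orient A B (approach X d \<sigma> s) < 0" by simp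
      then show ?thesis by (rule eventually_mono) (simp add: triangle_iff[OF ccw])
    next
      case 2
      with ev(2) have "\<forall>\<^sub>F s in at_right 0. orient B C (approach X d \<sigma> s) < 0" by simp
      then show ?thesis by (rule eventually_mono) (simp add: triangle_iff[OF ccw])
    next
      case 3
      with ev(3) have "\<forall>\<^sub>F s in at_right 0. orient C A (approach X d \<sigma> s) < 0" by simp
      then show ?thesis by (rule eventually_mono) (simp add: triangle_iff[OF ccw])
    qed
  qed
  have 3: "germ (convex hull {A, B, C}) X d \<sigma>" if ?E
    unfolding germ_def using 1[OF that]
    by (rule eventually_mono) (use inside_interior[OF ccw] interior_subset in blast)
  have 4: "\<not> germ (convex hull {A, B, C}) X d \<sigma>" if n: "\<not> ?E"
  proof
    assume "germ (convex hull {A, B, C}) X d \<sigma>"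
    with 2[OF n] have "\<forall>\<^sub>F s in at_right (0::real). False"
      unfolding germ_def by eventually_elim auto
    then show False by simp
  qed
  show ?th1 using 3 4 by blast
  show "\<forall>\<^sub>F s in at_right 0. inside A B C (approach X d \<sigma> s)" if "germ (convex hull {A, B, C}) X d \<sigma>"
    using 1 4 that by blast
  show "\<forall>\<^sub>F s in at_right 0. approach X d \<sigma> s \<notin> convex hull {A, B, C}" if "\<not> germ (convex hull {A, B, C}) X d \<sigma>"
    using 2 3 that by blast
qed

text \<open>The triangles \<open>A i\<close>, \<open>B i\<close>, \<open>C i\<close> are positively oriented, do not overlap and fill \<open>P\<close>. They are
  given as an indexed family, and nonoverlapping is expressed by the open triangles.\<close>
definition triangulates :: "'i set \<Rightarrow> ('i \<Rightarrow> complex) \<Rightarrow> ('i \<Rightarrow> complex) \<Rightarrow> ('i \<Rightarrow> complex) \<Rightarrow> complex set \<Rightarrow> bool" where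
  "triangulates I A B C P \<longleftrightarrow> finite I \<and> (\<forall>i\<in>I. orient (A i) (B i) (C i) > 0) \<and>
     (\<Union>i\<in>I. convex hull {A i, B i, C i}) = P \<and>
     (\<forall>i\<in>I. \<forall>j\<in>I. i \<noteq> j \<longrightarrow> (\<forall>z. \<not> (inside (A i) (B i) (C i) z \<and> inside (A j) (B j) (C j) z)))"

text \<open>Locally on one side of a ray at most one triangle is present, and one is present iff \<open>P\<close> is. So the
  local structure of \<open>P\<close> is the sum of the local structures of the pieces.\<close>
lemma sum_germ:
  assumes tri: "triangulates I A B C P" and d: "d \<noteq> 0" and s: "\<sigma> \<noteq> 0"
  shows "(\<Sum>i\<in>I. of_bool (germ (convex hull {A i, B i, C i}) X d \<sigma>)) = (of_bool (germ P X d \<sigma>) :: real)"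
proof -
  let ?T = "\<lambda>i. convex hull {A i, B i, C i}"
  have fin: "finite I" and ccw: "\<And>i. i \<in> I \<Longrightarrow> orient (A i) (B i) (C i) > 0"
    and un: "(\<Union>i\<in>I. ?T i) = P"
    and disj: "\<And>i j z. i \<in> I \<Longrightarrow> j \<in> I \<Longrightarrow> i \<noteq> j \<Longrightarrow> \<not> (inside (A i) (B i) (C i) z \<and> inside (A j) (B j) (C j) z)"
    using tri unfolding triangulates_def by blast+
  show ?thesis
  proof (cases "germ P X d \<sigma>")
    case True
    have "\<exists>i\<in>I. germ (?T i) X d \<sigma>"
    proof (rule ccontr)
      assume "\<not> ?thesis"
      then have "\<forall>i\<in>I. \<forall>\<^sub>F s in at_right 0. approach X d \<sigma> s \<notin> ?T i"
        using triangle_germ(3)[OF ccw d s] by blast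
      then have "\<forall>\<^sub>F s in at_right 0. \<forall>i\<in>I. approach X d \<sigma> s \<notin> ?T i"
        using fin by (simp add: eventually_ball_finite)
      with True[unfolded germ_def] have "\<forall>\<^sub>F s in at_right (0::real). False"
        by eventually_elim (use un in blast)
      then show False by simp
    qed
    then obtain i where i: "i \<in> I" "germ (?T i) X d \<sigma>" by blast
    have "\<not> germ (?T j) X d \<sigma>" if j: "j \<in> I" "j \<noteq> i" for j
    proof
      assume gj: "germ (?T j) X d \<sigma>"
      have "\<forall>\<^sub>F s in at_right (0::real). False"
        using triangle_germ(2)[OF ccw[OF i(1)] d s i(2)] triangle_germ(2)[OF ccw[OF j(1)] d s gj]
        by eventually_elim (use disj[OF i(1) j(1)] j in blast)
      then show False by simp
    qed
    then have "(\<Sum>j\<in>I. of_bool (germ (?T j) X d \<sigma>)) = (\<Sum>j\<in>I. of_bool (j = i) :: real)"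
      using i by (intro sum.cong) auto
    then show ?thesis using True i fin by (simp add: of_bool_def)
  next
    case False
    have "\<not> germ (?T i) X d \<sigma>" if "i \<in> I" for i
    proof
      assume "germ (?T i) X d \<sigma>"
      then have "germ P X d \<sigma>" unfolding germ_def
        by (rule eventually_mono) (use un that in blast)
      then show False using False by blast
    qed
    then show ?thesis using False by simp
  qed
qed

text \<open>The jump of the indicator function of \<open>S\<close> when the ray from \<open>X\<close> in the direction \<open>d\<close> is crossed
  counterclockwise.\<close>
definition jump :: "complex set \<Rightarrow> complex \<Rightarrow> complex \<Rightarrow> real" where
  "jump S X d = of_bool (germ S X d 1) - of_bool (germ S X d (-1))"

text \<open>The contribution of the side \<open>A B\<close> to the jump of a triangle lying on its left. The interior points of
  the side occur with both directions and opposite signs, the end points only once.\<close>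
definition edge_jump :: "complex \<Rightarrow> complex \<Rightarrow> complex \<Rightarrow> complex \<Rightarrow> real" where
  "edge_jump A B X d =
     of_bool (d = sgn (B - A) \<and> X \<in> closed_segment A B \<and> X \<noteq> B) -
     of_bool (d = - sgn (B - A) \<and> X \<in> closed_segment A B \<and> X \<noteq> A)"

lemma edge_param:
  assumes ccw: "orient A B C > 0"
  shows "X \<in> closed_segment A B \<longleftrightarrow> orient A B X = 0 \<and> orient B C X \<ge> 0 \<and> orient C A X \<ge> 0"
    and "orient A B X = 0 \<Longrightarrow> X = A \<longleftrightarrow> orient C A X = 0"
    and "orient A B X = 0 \<Longrightarrow> X = B \<longleftrightarrow> orient B C X = 0"
proof -
  have r: "orient B C A = orient A B C" "orient C A B = orient A B C" using orient_rotate by metis+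
  define D where "D = orient A B C"
  have D: "D > 0" using ccw by (simp add: D_def)
  have bc: "X = of_real (orient B C X / D) * A + of_real (orient C A X / D) * B" if "orient A B X = 0"
    using barycentric[of A B C X] D that by (simp add: D_def field_simps)
  have sm: "orient B C X / D + orient C A X / D = 1" if "orient A B X = 0"
    using orient_sum[of A B X C] D that by (simp add: D_def flip: add_divide_distrib)
  show "X = A \<longleftrightarrow> orient C A X = 0" if "orient A B X = 0"
    using bc[OF that] sm[OF that] D by auto
  show "X = B \<longleftrightarrow> orient B C X = 0" if "orient A B X = 0"
    using bc[OF that] sm[OF that] D by auto
  show "X \<in> closed_segment A B \<longleftrightarrow> orient A B X = 0 \<and> orient B C X \<ge> 0 \<and> orient C A X \<ge> 0"
  proof
    assume "X \<in> closed_segment A B"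
    then obtain u where u: "0 \<le> u" "u \<le> 1" and X: "X = (1 - u) *\<^sub>R A + u *\<^sub>R B"
      by (auto simp: closed_segment_def)
    have "X = of_real (1 - u) * A + of_real u * B + of_real 0 * C" by (simp add: X scaleR_conv_of_real)
    then show "orient A B X = 0 \<and> orient B C X \<ge> 0 \<and> orient C A X \<ge> 0"
      using orient_affine[of "1 - u" u 0 _ _ A B C] u r ccw by simp
  next
    assume *: "orient A B X = 0 \<and> orient B C X \<ge> 0 \<and> orient C A X \<ge> 0"
    then have "orient B C X / D = 1 - orient C A X / D" using sm by (simp add: algebra_simps)
    then show "X \<in> closed_segment A B"
      unfolding closed_segment_def using bc * D sm
      by (intro CollectI exI[of _ "orient C A X / D"])
         (auto simp: scaleR_conv_of_real field_simps)
  qed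
qed

lemma unit_parallel:
  assumes "norm d = 1" "u \<noteq> 0"
  shows "d = sgn u \<longleftrightarrow> Im (cnj u * d) = 0 \<and> Re (cnj u * d) > 0"
proof
  assume "d = sgn u"
  then have "cnj u * d = of_real ((norm u)\<^sup>2) / of_real (norm u)"
    by (simp only: sgn_eq complex_norm_square times_divide_eq_right mult.commute)
  then have "cnj u * d = of_real (norm u)"
    using assms by (simp add: power2_eq_square)
  then show "Im (cnj u * d) = 0 \<and> Re (cnj u * d) > 0" using assms by simp
next
  assume *: "Im (cnj u * d) = 0 \<and> Re (cnj u * d) > 0"
  then have 1: "cnj u * d = of_real (Re (cnj u * d))" by (simp add: complex_eq_iff)
  have "norm (cnj u * d) = norm u" using assms by (simp add: norm_mult)
  moreover have "norm (cnj u * d) = Re (cnj u * d)" using 1 * by (metis abs_of_pos norm_of_real)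
  ultimately have "cnj u * d = of_real (norm u)" using 1 by simp
  then have "u * cnj u * d = u * of_real (norm u)" by (simp add: mult_ac)
  then have "of_real (norm u) * (of_real (norm u) * d) = of_real (norm u) * u"
    by (simp add: complex_norm_square[symmetric] power2_eq_square mult_ac)
  then have "of_real (norm u) * d = u" using assms by simp
  then show "d = sgn u" using assms by (simp add: sgn_eq field_simps)
qed

lemma edge_jump_alt:
  assumes ccw: "orient A B C > 0" and d: "norm d = 1"
  shows "edge_jump A B X d =
     of_bool (orient A B X = 0 \<and> Im (cnj (B - A) * d) = 0 \<and> Re (cnj (B - A) * d) > 0 \<and> orient B C X > 0 \<and> orient C A X \<ge> 0) -
     of_bool (orient A B X = 0 \<and> Im (cnj (B - A) * d) = 0 \<and> Re (cnj (B - A) * d) < 0 \<and> orient B C X \<ge> 0 \<and> orient C A X > 0)"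
proof -
  have ne: "B - A \<noteq> 0" using ccw_distinct[OF ccw] by simp
  have 1: "d = - sgn (B - A) \<longleftrightarrow> Im (cnj (B - A) * d) = 0 \<and> Re (cnj (B - A) * d) < 0"
  proof -
    have "d = - sgn (B - A) \<longleftrightarrow> - d = sgn (B - A)" by (metis minus_minus)
    then show ?thesis using unit_parallel[of "- d" "B - A"] d ne
      by (simp only: mult_minus_right uminus_complex.sel norm_minus_cancel neg_equal_0_iff_equal
          neg_0_less_iff_less) simp
  qed
  show ?thesis
    unfolding edge_jump_def 1 unit_parallel[OF d ne] edge_param(1)[OF ccw]
    using edge_param(2,3)[OF ccw, of X] by (auto simp: of_bool_def)
qed

lemma jump_triangle_edge:
  assumes ccw: "orient A B C > 0" and d: "norm d = 1"
    and X: "orient A B X = 0" and p: "Im (cnj (B - A) * d) = 0"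
  shows "jump (convex hull {A, B, C}) X d = edge_jump A B X d"
    and "edge_jump B C X d = 0" "edge_jump C A X d = 0"
proof -
  have d0: "d \<noteq> 0" using d by auto
  have ne: "B - A \<noteq> 0" using ccw_distinct[OF ccw] by simp
  have r: "orient B C A > 0" "orient C A B > 0" using ccw orient_rotate by metis+
  define \<rho> where "\<rho> = Re (cnj (B - A) * d) / (norm (B - A))\<^sup>2"
  have nn: "(norm (B - A))\<^sup>2 > 0" using ne by simp
  have "cnj (B - A) * d = of_real (Re (cnj (B - A) * d))" using p by (simp add: complex_eq_iff)
  then have "(B - A) * cnj (B - A) * d = (B - A) * of_real (Re (cnj (B - A) * d))"
    by (simp add: mult.assoc)
  then have "of_real ((norm (B - A))\<^sup>2) * d = (B - A) * of_real (Re (cnj (B - A) * d))"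
    by (simp only: complex_norm_square)
  then have dr: "d = of_real \<rho> * (B - A)" unfolding \<rho>_def using ne
    by (simp add: field_simps)
  have rho0: "\<rho> \<noteq> 0" using dr d0 by auto
  have Re: "Re (cnj (B - A) * d) = \<rho> * (norm (B - A))\<^sup>2" using nn by (simp add: \<rho>_def)
  have bc: "Im (cnj (C - B) * d) = - \<rho> * orient A B C"
    unfolding dr orient_def by (simp add: algebra_simps)
  have ca: "Im (cnj (A - C) * d) = \<rho> * orient A B C"
    unfolding dr orient_def by (simp add: algebra_simps)
  have bc0: "Im (cnj (C - B) * d) \<noteq> 0" "Im (cnj (A - C) * d) \<noteq> 0" using bc ca rho0 ccw by auto
  show "edge_jump B C X d = 0" "edge_jump C A X d = 0"
    using edge_jump_alt[OF r(1) d] edge_jump_alt[OF r(2) d] bc0 by auto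
  have "0 < \<rho> * (norm (B - A))\<^sup>2 \<longleftrightarrow> 0 < \<rho>" "\<rho> * (norm (B - A))\<^sup>2 < 0 \<longleftrightarrow> \<rho> < 0"
       "0 < \<rho> * orient A B C \<longleftrightarrow> 0 < \<rho>" "\<rho> * orient A B C < 0 \<longleftrightarrow> \<rho> < 0"
       "\<rho> * orient A B C \<noteq> 0"
    using nn ccw rho0 by (simp_all add: zero_less_mult_iff mult_less_0_iff)
  then show "jump (convex hull {A, B, C}) X d = edge_jump A B X d"
    unfolding edge_jump_alt[OF ccw d] jump_def triangle_germ(1)[OF ccw d0, of 1, simplified]
      triangle_germ(1)[OF ccw d0, of "-1", simplified] edge_germ_def lexpos_def X p Re bc ca
    by (auto simp: of_bool_def)
qed

lemma jump_triangle:
  assumes ccw: "orient A B C > 0" and d: "norm d = 1"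
  shows "jump (convex hull {A, B, C}) X d = edge_jump A B X d + edge_jump B C X d + edge_jump C A X d"
proof -
  have d0: "d \<noteq> 0" using d by auto
  have r: "orient B C A > 0" "orient C A B > 0" using ccw orient_rotate by metis+
  have sets: "{B, C, A} = {A, B, C}" "{C, A, B} = {A, B, C}" by auto
  consider "orient A B X = 0 \<and> Im (cnj (B - A) * d) = 0" | "orient B C X = 0 \<and> Im (cnj (C - B) * d) = 0"
    | "orient C A X = 0 \<and> Im (cnj (A - C) * d) = 0"
    | "\<not> (orient A B X = 0 \<and> Im (cnj (B - A) * d) = 0)" "\<not> (orient B C X = 0 \<and> Im (cnj (C - B) * d) = 0)"
      "\<not> (orient C A X = 0 \<and> Im (cnj (A - C) * d) = 0)" by blast
  then show ?thesis
  proof cases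
    case 1
    then show ?thesis using jump_triangle_edge[OF ccw d] by simp
  next
    case 2
    then show ?thesis using jump_triangle_edge[OF r(1) d] by (simp add: sets)
  next
    case 3
    then show ?thesis using jump_triangle_edge[OF r(2) d] by (simp add: sets)
  next
    case 4
    have "edge_germ A B X d 1 = edge_germ A B X d (-1)" "edge_germ B C X d 1 = edge_germ B C X d (-1)"
      "edge_germ C A X d 1 = edge_germ C A X d (-1)"
      using 4 by (auto simp: edge_germ_def lexpos_def)
    then have "jump (convex hull {A, B, C}) X d = 0"
      unfolding jump_def triangle_germ(1)[OF ccw d0, of 1, simplified]
      triangle_germ(1)[OF ccw d0, of "-1", simplified] by simp
    moreover have "edge_jump A B X d = 0" "edge_jump B C X d = 0" "edge_jump C A X d = 0"
      unfolding edge_jump_alt[OF ccw d] edge_jump_alt[OF r(1) d] edge_jump_alt[OF r(2) d] using 4 by auto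
    ultimately show ?thesis by simp
  qed
qed

text \<open>For a function \<open>H\<close> of a direction and a point, the increment along the segment from \<open>A\<close> to \<open>B\<close> of the
  function of the point that belongs to the direction of the segment. If \<open>H\<close> does not distinguish
  opposite directions, then the increments are additive along every line.\<close>
definition edge_increment :: "(complex \<Rightarrow> complex \<Rightarrow> real) \<Rightarrow> complex \<Rightarrow> complex \<Rightarrow> real" where
  "edge_increment H A B = H (sgn (B - A)) B - H (sgn (B - A)) A"

lemma edge_increment_swap:
  assumes "\<And>d X. H (- d) X = H d X"
  shows "edge_increment H B A = - edge_increment H A B"
proof -
  have "sgn (A - B) = - sgn (B - A)" by (metis minus_diff_eq sgn_minus)
  then show ?thesis by (simp add: edge_increment_def assms)
qed

lemma sum_edge_jump:
  assumes H: "\<And>d X. H (- d) X = H d X" and AB: "A \<noteq> B"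
    and fin: "finite Q" "finite D" and A: "A \<in> Q" "B \<in> Q" and D: "sgn (B - A) \<in> D" "- sgn (B - A) \<in> D"
  shows "(\<Sum>X\<in>Q. \<Sum>d\<in>D. edge_jump A B X d * H d X) = - edge_increment H A B"
proof -
  define u where "u = sgn (B - A)"
  have inner: "(\<Sum>d\<in>D. edge_jump A B X d * H d X) = of_bool (X = A) * H u X - of_bool (X = B) * H u X" for X
  proof -
    have "(\<Sum>d\<in>D. edge_jump A B X d * H d X) =
      (\<Sum>d\<in>D. if d = u then of_bool (X \<in> closed_segment A B \<and> X \<noteq> B) * H d X else 0) -
      (\<Sum>d\<in>D. if d = - u then of_bool (X \<in> closed_segment A B \<and> X \<noteq> A) * H d X else 0)"
      unfolding sum_subtractf[symmetric]
      by (rule sum.cong) (auto simp: edge_jump_def u_def)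
    also have "\<dots> = of_bool (X \<in> closed_segment A B \<and> X \<noteq> B) * H u X - of_bool (X \<in> closed_segment A B \<and> X \<noteq> A) * H u X"
      using fin D by (simp add: u_def H)
    also have "\<dots> = of_bool (X = A) * H u X - of_bool (X = B) * H u X"
      using AB by auto
    finally show ?thesis .
  qed
  have "(\<Sum>X\<in>Q. of_bool (X = A) * H u X) = (\<Sum>X\<in>Q. if X = A then H u X else 0)"
       "(\<Sum>X\<in>Q. of_bool (X = B) * H u X) = (\<Sum>X\<in>Q. if X = B then H u X else 0)"
    by (rule sum.cong; auto)+
  then show ?thesis
    using fin A by (simp add: inner sum_subtractf edge_increment_def u_def)
qed

text \<open>The sum of \<open>jump \<cdot> H\<close> over all points and directions of a large finite set sees of a triangle only the
  end points of its sides, with the values that form the increments; and it depends on \<open>P\<close> alone by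
  \<open>sum_germ\<close>. No assumption on \<open>H\<close> such as continuity enters.\<close>
lemma triangulation_boundary_sum:
  assumes H: "\<And>d X. H (- d) X = H d X"
    and T: "triangulates I A B C P"
    and Q: "finite Q" "\<And>i. i \<in> I \<Longrightarrow> A i \<in> Q \<and> B i \<in> Q \<and> C i \<in> Q"
    and D: "finite D" "\<And>d. d \<in> D \<Longrightarrow> norm d = 1"
      "\<And>x y. x \<in> Q \<Longrightarrow> y \<in> Q \<Longrightarrow> x \<noteq> y \<Longrightarrow> sgn (x - y) \<in> D"
  shows "(\<Sum>i\<in>I. edge_increment H (A i) (B i) + edge_increment H (B i) (C i) + edge_increment H (C i) (A i)) =
     - (\<Sum>X\<in>Q. \<Sum>d\<in>D. jump P X d * H d X)"
proof -
  have fin: "finite I" and ccw: "\<And>i. i \<in> I \<Longrightarrow> orient (A i) (B i) (C i) > 0"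
    using T unfolding triangulates_def by blast+
  have jP: "jump P X d = (\<Sum>i\<in>I. jump (convex hull {A i, B i, C i}) X d)" if "d \<in> D" for X d
  proof -
    have "d \<noteq> 0" using D(2)[OF that] by auto
    then show ?thesis
      unfolding jump_def sum_subtractf using sum_germ[OF T, of d 1 X] sum_germ[OF T, of d "-1" X] by simp
  qed
  have edge: "(\<Sum>X\<in>Q. \<Sum>d\<in>D. edge_jump x y X d * H d X) = - edge_increment H x y"
    if "x \<in> Q" "y \<in> Q" "x \<noteq> y" for x y
  proof (rule sum_edge_jump[where H = H, OF H that(3) Q(1) D(1) that(1,2)])
    show "sgn (y - x) \<in> D" using D(3) that by metis
    show "- sgn (y - x) \<in> D" using D(3)[OF that] by (metis minus_diff_eq sgn_minus)
  qed
  have "(\<Sum>X\<in>Q. \<Sum>d\<in>D. jump P X d * H d X) =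
      (\<Sum>X\<in>Q. \<Sum>d\<in>D. \<Sum>i\<in>I. jump (convex hull {A i, B i, C i}) X d * H d X)"
    by (intro sum.cong refl) (simp add: jP sum_distrib_right)
  also have "\<dots> = (\<Sum>X\<in>Q. \<Sum>i\<in>I. \<Sum>d\<in>D. jump (convex hull {A i, B i, C i}) X d * H d X)"
    by (intro sum.cong refl) (rule sum.swap)
  also have "\<dots> = (\<Sum>i\<in>I. \<Sum>X\<in>Q. \<Sum>d\<in>D. jump (convex hull {A i, B i, C i}) X d * H d X)"
    by (rule sum.swap)
  also have "\<dots> = (\<Sum>i\<in>I. - (edge_increment H (A i) (B i) + edge_increment H (B i) (C i) + edge_increment H (C i) (A i)))"
  proof (rule sum.cong)
    fix i assume i: "i \<in> I"
    note ne = ccw_distinct[OF ccw[OF i]]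
    have "(\<Sum>X\<in>Q. \<Sum>d\<in>D. jump (convex hull {A i, B i, C i}) X d * H d X) =
      (\<Sum>X\<in>Q. \<Sum>d\<in>D. edge_jump (A i) (B i) X d * H d X) +
      (\<Sum>X\<in>Q. \<Sum>d\<in>D. edge_jump (B i) (C i) X d * H d X) +
      (\<Sum>X\<in>Q. \<Sum>d\<in>D. edge_jump (C i) (A i) X d * H d X)"
      unfolding sum.distrib[symmetric]
      by (intro sum.cong refl) (simp add: jump_triangle[OF ccw[OF i] D(2)] algebra_simps)
    then show "(\<Sum>X\<in>Q. \<Sum>d\<in>D. jump (convex hull {A i, B i, C i}) X d * H d X) =
      - (edge_increment H (A i) (B i) + edge_increment H (B i) (C i) + edge_increment H (C i) (A i))"
      using edge Q(2)[OF i] ne by simp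
  qed auto
  finally show ?thesis by (simp only: sum_negf minus_minus)
qed

lemma triangulation_invariant:
  assumes H: "\<And>d X. H (- d) X = H d X"
    and T: "triangulates I A B C P" "triangulates I' A' B' C' P"
  shows "(\<Sum>i\<in>I. edge_increment H (A i) (B i) + edge_increment H (B i) (C i) + edge_increment H (C i) (A i)) =
     (\<Sum>i\<in>I'. edge_increment H (A' i) (B' i) + edge_increment H (B' i) (C' i) + edge_increment H (C' i) (A' i))"
proof -
  define Q where "Q = A ` I \<union> B ` I \<union> C ` I \<union> A' ` I' \<union> B' ` I' \<union> C' ` I'"
  define D where "D = (\<lambda>(x, y). sgn (x - y)) ` (Q \<times> Q - Id)"
  have "finite I" "finite I'" using T by (auto simp: triangulates_def)
  then have Q: "finite Q" by (simp add: Q_def)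
  then have D: "finite D" "\<And>d. d \<in> D \<Longrightarrow> norm d = 1"
      "\<And>x y. x \<in> Q \<Longrightarrow> y \<in> Q \<Longrightarrow> x \<noteq> y \<Longrightarrow> sgn (x - y) \<in> D"
    by (auto simp: D_def norm_sgn split: if_splits)
  show ?thesis
    using triangulation_boundary_sum[where H = H, OF H T(1) Q _ D] triangulation_boundary_sum[where H = H, OF H T(2) Q _ D]
    by (simp add: Q_def)
qed


lemma orient_polar:
  "orient (c + w * a) (c + w * b) (c + w * z) = (norm w)\<^sup>2 * orient a b z"
proof -
  have "cnj ((c + w * b) - (c + w * a)) * ((c + w * z) - (c + w * a)) = (w * cnj w) * (cnj (b - a) * (z - a))"
    by (simp add: algebra_simps)
  also have "w * cnj w = of_real ((norm w)\<^sup>2)" by (simp only: complex_norm_square)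
  finally show ?thesis unfolding orient_def by (simp only: scaleR_conv_of_real[symmetric] scaleR_complex.sel)
qed

lemma cos_le_cos_outside:
  assumes "0 \<le> a" "a \<le> \<bar>t\<bar>" "\<bar>t\<bar> \<le> 2 * pi - a"
  shows "cos t \<le> cos a"
proof (cases "\<bar>t\<bar> \<le> pi")
  case True
  then have "cos \<bar>t\<bar> \<le> cos a" using assms by (intro cos_monotone_0_pi_le) auto
  then show ?thesis by simp
next
  case False
  then have "cos (2 * pi - \<bar>t\<bar>) \<le> cos a" using assms by (intro cos_monotone_0_pi_le) auto
  then show ?thesis by simp
qed

lemma orient_unit_chord:
  "orient (cis \<phi>) (cis (\<phi> + \<eta>)) (cis \<psi>) = 2 * sin (\<eta> / 2) * (cos (\<eta> / 2) - cos (\<psi> - \<phi> - \<eta> / 2))"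
proof -
  define x where "x = \<psi> - \<phi>"
  have psi: "\<psi> = \<phi> + x" by (simp add: x_def)
  have "cnj (cis (\<phi> + \<eta>) - cis \<phi>) * (cis \<psi> - cis \<phi>) =
      (cis \<phi> * cnj (cis \<phi>)) * (cnj (cis \<eta> - 1) * (cis x - 1))"
    unfolding psi cis_mult[symmetric] by (simp add: algebra_simps)
  also have "cis \<phi> * cnj (cis \<phi>) = 1" by (simp add: cis_cnj cis_mult)
  finally have "orient (cis \<phi>) (cis (\<phi> + \<eta>)) (cis \<psi>) = Im (cnj (cis \<eta> - 1) * (cis x - 1))"
    by (simp add: orient_def)
  also have "\<dots> = sin \<eta> - sin x + sin (x - \<eta>)"
    by (simp add: sin_diff algebra_simps)
  also have "\<dots> = 2 * sin (\<eta> / 2) * (cos (\<eta> / 2) - cos (x - \<eta> / 2))"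
  proof -
    have "sin \<eta> = 2 * sin (\<eta> / 2) * cos (\<eta> / 2)" using sin_double[of "\<eta> / 2"] by simp
    moreover have "sin x - sin (x - \<eta>) = 2 * sin (\<eta> / 2) * cos (x - \<eta> / 2)"
      by (simp add: sin_diff_sin) (simp add: field_simps)
    ultimately show ?thesis by (simp add: algebra_simps)
  qed
  finally show ?thesis by (simp add: x_def)
qed

lemma regular_vertex_polar: "regular_vertex N c w j = c + w * cis (2 * pi * real j / real N)"
  by (simp add: regular_vertex_def)

lemma regular_vertex_N [simp]: "N > 0 \<Longrightarrow> regular_vertex N c w N = regular_vertex N c w 0"
  by (simp add: regular_vertex_def)

lemma polygon_left_of_edge:
  assumes N: "N > 2" and j: "j < N" and z: "z \<in> regular_polygon N c w"
  shows "orient (regular_vertex N c w j) (regular_vertex N c w (Suc j)) z \<ge> 0"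
proof -
  let ?V = "regular_vertex N c w"
  define \<eta> where "\<eta> = 2 * pi / real N"
  have e0: "0 < \<eta>" "\<eta> \<le> pi" using N by (auto simp: \<eta>_def field_simps)
  have V: "?V i = c + w * cis (\<eta> * real i)" for i by (simp add: regular_vertex_polar \<eta>_def)
  have "orient (?V j) (?V (Suc j)) (?V i) \<ge> 0" if i: "i < N" for i
  proof -
    define m where "m = int i - int j"
    have m: "- int N < m" "m < int N" using i j by (auto simp: m_def)
    define t where "t = \<eta> * (of_int m - 1 / 2)"
    have "orient (?V j) (?V (Suc j)) (?V i) = (norm w)\<^sup>2 * (2 * sin (\<eta> / 2) * (cos (\<eta> / 2) - cos t))"
    proof -
      have 1: "cis (\<eta> * real (Suc j)) = cis (\<eta> * real j + \<eta>)" by (simp add: algebra_simps)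
      have 2: "\<eta> * real i - \<eta> * real j - \<eta> / 2 = t" by (simp add: t_def m_def algebra_simps)
      show ?thesis unfolding V orient_polar 1 orient_unit_chord 2 ..
    qed
    moreover have "cos t \<le> cos (\<eta> / 2)"
    proof (rule cos_le_cos_outside)
      have at: "\<bar>t\<bar> = \<eta> * \<bar>of_int m - 1 / 2\<bar>" using e0 by (simp add: t_def abs_mult)
      have "1 / 2 \<le> \<bar>of_int m - 1 / 2 :: real\<bar>"
      proof (cases "m \<ge> 1")
        case True
        then have "real_of_int m \<ge> 1" by simp
        then show ?thesis by simp
      next
        case False
        then have "real_of_int m \<le> 0" by simp
        then show ?thesis by simp
      qed
      from mult_left_mono[OF this, of \<eta>] show "\<eta> / 2 \<le> \<bar>t\<bar>" using e0 by (simp add: at)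
      have "real_of_int m \<le> real N - 1" "real_of_int m \<ge> 1 - real N" using m by linarith+
      then have "\<bar>of_int m - 1 / 2 :: real\<bar> \<le> real N - 1 / 2" by (simp add: abs_le_iff)
      from mult_left_mono[OF this, of \<eta>] have "\<bar>t\<bar> \<le> \<eta> * (real N - 1 / 2)" using e0 by (simp add: at)
      also have "\<dots> = 2 * pi - \<eta> / 2" using N by (simp add: \<eta>_def field_simps)
      finally show "\<bar>t\<bar> \<le> 2 * pi - \<eta> / 2" .
    qed (use e0 in auto)
    moreover have "sin (\<eta> / 2) \<ge> 0" using e0 by (intro sin_ge_zero) auto
    ultimately show ?thesis by simp
  qed
  then have "?V ` {..<N} \<subseteq> {z. orient (?V j) (?V (Suc j)) z \<ge> 0}" by auto
  moreover have "convex {z. orient (?V j) (?V (Suc j)) z \<ge> 0}"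
  proof (rule convexI)
    fix x y :: complex and u v :: real
    assume *: "x \<in> {z. orient (?V j) (?V (Suc j)) z \<ge> 0}" "y \<in> {z. orient (?V j) (?V (Suc j)) z \<ge> 0}" "0 \<le> u" "0 \<le> v" "u + v = 1"
    then show "u *\<^sub>R x + v *\<^sub>R y \<in> {z. orient (?V j) (?V (Suc j)) z \<ge> 0}"
      using orient_affine[of u v 0 "?V j" "?V (Suc j)" x y 0] by (simp add: scaleR_conv_of_real)
  qed
  ultimately have "regular_polygon N c w \<subseteq> {z. orient (?V j) (?V (Suc j)) z \<ge> 0}"
    unfolding regular_polygon_def by (rule hull_minimal)
  then show ?thesis using z by blast
qed

lemma centre_in_polygon:
  assumes N: "N > 1"
  shows "c \<in> regular_polygon N c w"
proof -
  let ?V = "regular_vertex N c w"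
  define r where "r = cis (2 * pi / real N)"
  have rj: "cis (2 * pi * real j / real N) = r ^ j" for j
    unfolding r_def Complex.DeMoivre by (simp add: mult_ac)
  have "r \<noteq> 1"
  proof
    assume "r = 1"
    then have "cos (2 * pi / real N) = 1" by (metis r_def cis.sel(1) one_complex.sel(1))
    then obtain m :: int where "2 * pi / real N = of_int m * 2 * pi" using cos_one_2pi_int by blast
    then have "1 = real N * of_int m" using N by (simp add: field_simps)
    then have "1 = int N * m" by (metis of_int_1 of_int_eq_iff of_int_mult of_int_of_nat_eq)
    then have "int N dvd 1" by (rule dvdI)
    then show False using N by simp
  qed
  moreover have "r ^ N = 1" using N by (simp flip: rj)
  ultimately have "(\<Sum>j<N. r ^ j) = 0" by (simp add: geometric_sum)
  then have "(\<Sum>j<N. (1 / real N) *\<^sub>R ?V j) = c"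
    unfolding regular_vertex_polar rj using N
    by (simp add: scaleR_conv_of_real add_divide_distrib sum.distrib flip: sum_divide_distrib sum_distrib_left)
  moreover have "(\<Sum>j<N. (1 / real N) *\<^sub>R ?V j) \<in> regular_polygon N c w"
    unfolding regular_polygon_def using N
    by (intro convex_sum) (auto intro: hull_inc)
  ultimately show ?thesis by simp
qed

text \<open>The triangles joining the centre with the sides serve as a second triangulation, which makes the
  boundary sum of the polygon computable.\<close>
lemma central_triangulation:
  assumes N: "N > 2" and w: "w \<noteq> 0"
  shows "triangulates {..<N} (\<lambda>_. c) (regular_vertex N c w) (\<lambda>j. regular_vertex N c w (Suc j)) (regular_polygon N c w)"
proof -
  let ?V = "regular_vertex N c w"
  define \<eta> where "\<eta> = 2 * pi / real N"
  have e0: "0 < \<eta>" "\<eta> < pi" using N by (auto simp: \<eta>_def field_simps)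
  have V: "?V i = c + w * cis (\<eta> * real i)" for i by (simp add: regular_vertex_polar \<eta>_def)
  have nw: "(norm w)\<^sup>2 > 0" using w by simp
  have polar: "\<exists>r \<theta>. 0 \<le> r \<and> 0 \<le> \<theta> \<and> \<theta> < 2 * pi \<and> z = c + w * (of_real r * cis \<theta>)" for z
  proof -
    define y where "y = (z - c) / w"
    have "y = of_real (norm y) * cis (Arg2pi y)" using Arg2pi_eq[of y] by (simp add: cis_conv_exp)
    moreover have "z = c + w * y" using w by (simp add: y_def)
    ultimately show ?thesis using Arg2pi_ge_0 Arg2pi_lt_2pi norm_ge_zero by metis
  qed
  have o1: "orient c (?V j) (c + w * (of_real r * cis \<theta>)) = (norm w)\<^sup>2 * (r * sin (\<theta> - \<eta> * real j))" for j r \<theta>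
  proof -
    have "orient c (?V j) (c + w * (of_real r * cis \<theta>)) = (norm w)\<^sup>2 * orient 0 (cis (\<eta> * real j)) (of_real r * cis \<theta>)"
      using orient_polar[of c w 0] by (simp add: V)
    then show ?thesis by (simp add: orient_def sin_diff algebra_simps)
  qed
  have o2: "orient (?V j) c (c + w * (of_real r * cis \<theta>)) = (norm w)\<^sup>2 * (r * sin (\<eta> * real j - \<theta>))" for j r \<theta>
  proof -
    have "orient (?V j) c (c + w * (of_real r * cis \<theta>)) = (norm w)\<^sup>2 * orient (cis (\<eta> * real j)) 0 (of_real r * cis \<theta>)"
      using orient_polar[of c w _ 0] by (simp add: V)
    then show ?thesis by (simp add: orient_def sin_diff algebra_simps)
  qed
  have ccw: "orient c (?V j) (?V (Suc j)) > 0" for j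
  proof -
    have "orient c (?V j) (?V (Suc j)) = (norm w)\<^sup>2 * sin \<eta>"
      using o1[of j 1 "\<eta> * real (Suc j)"] unfolding V[of "Suc j"] by (simp add: algebra_simps)
    then show ?thesis using nw e0 sin_gt_zero by simp
  qed
  have un: "(\<Union>j<N. convex hull {c, ?V j, ?V (Suc j)}) = regular_polygon N c w"
  proof (intro equalityI subsetI)
    fix z assume "z \<in> (\<Union>j<N. convex hull {c, ?V j, ?V (Suc j)})"
    then obtain j where j: "j < N" "z \<in> convex hull {c, ?V j, ?V (Suc j)}" by auto
    have VP: "?V i \<in> regular_polygon N c w" if "i \<le> N" for i
    proof -
      have "\<exists>i'<N. ?V i = ?V i'"
      proof (cases "i = N")
        case True
        then show ?thesis using N by (intro exI[of _ 0]) simp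
      next
        case False
        then show ?thesis using that by (intro exI[of _ i]) simp
      qed
      then show ?thesis unfolding regular_polygon_def by (auto intro!: hull_inc)
    qed
    have "{c, ?V j, ?V (Suc j)} \<subseteq> regular_polygon N c w"
      using centre_in_polygon[of N c w] VP j N by auto
    then have "convex hull {c, ?V j, ?V (Suc j)} \<subseteq> regular_polygon N c w"
      by (rule hull_minimal) (simp add: regular_polygon_def)
    then show "z \<in> regular_polygon N c w" using j by blast
  next
    fix z assume z: "z \<in> regular_polygon N c w"
    obtain r \<theta> where r: "0 \<le> r" and t: "0 \<le> \<theta>" "\<theta> < 2 * pi" and zz: "z = c + w * (of_real r * cis \<theta>)"
      using polar by blast
    define j where "j = nat \<lfloor>\<theta> / \<eta>\<rfloor>"
    have tj: "\<eta> * real j \<le> \<theta>" "\<theta> < \<eta> * (real j + 1)"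
    proof -
      have "\<theta> / \<eta> \<ge> 0" using t e0 by simp
      then have "real j \<le> \<theta> / \<eta>" "\<theta> / \<eta> < real j + 1" unfolding j_def by linarith+
      then show "\<eta> * real j \<le> \<theta>" "\<theta> < \<eta> * (real j + 1)" using e0 by (simp_all add: field_simps)
    qed
    have "j < N"
    proof -
      have "\<eta> * real j < \<eta> * real N" using tj(1) t(2) N by (simp add: \<eta>_def)
      then show ?thesis using e0 by simp
    qed
    have "orient c (?V j) z \<ge> 0" unfolding zz o1
      using tj r e0 by (intro mult_nonneg_nonneg sin_ge_zero) (auto simp: algebra_simps)
    moreover have "orient (?V (Suc j)) c z \<ge> 0" unfolding zz o2
      using tj r e0 by (intro mult_nonneg_nonneg sin_ge_zero) (auto simp: algebra_simps)
    moreover have "orient (?V j) (?V (Suc j)) z \<ge> 0" using polygon_left_of_edge[OF N \<open>j < N\<close> z] .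
    ultimately have "z \<in> convex hull {c, ?V j, ?V (Suc j)}" using triangle_iff[OF ccw] by blast
    then show "z \<in> (\<Union>j<N. convex hull {c, ?V j, ?V (Suc j)})" using \<open>j < N\<close> by blast
  qed
  have sector: "\<eta> * real j < \<theta> \<and> \<theta> < \<eta> * real (Suc j)"
    if j: "j < N" and t: "0 \<le> \<theta>" "\<theta> < 2 * pi" and r: "0 \<le> r"
      and ins: "inside c (?V j) (?V (Suc j)) (c + w * (of_real r * cis \<theta>))" for j r \<theta>
  proof -
    define a where "a = \<theta> - \<eta> * real j"
    define b where "b = \<eta> * real (Suc j) - \<theta>"
    have "r * sin a > 0" "r * sin b > 0"
      using ins nw unfolding inside_def o1 o2 a_def b_def by (auto simp: zero_less_mult_iff)
    then have s: "sin a > 0" "sin b > 0" using r by (auto simp: zero_less_mult_iff)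
    have ab: "a + b = \<eta>" by (simp add: a_def b_def algebra_simps)
    have "\<eta> * real (Suc j) \<le> \<eta> * real N" using j e0 by (intro mult_left_mono) auto
    also have "\<dots> = 2 * pi" using N by (simp add: \<eta>_def)
    finally have b2: "b \<le> 2 * pi" using t by (simp add: b_def)
    have a2: "a < 2 * pi" using t e0 by (simp add: a_def) (smt (verit) mult_nonneg_nonneg of_nat_0_le_iff)
    have low: "x > 0" if x: "sin x > 0" and y: "sin y > 0" "y \<le> 2 * pi" "x + y = \<eta>" for x y
    proof (rule ccontr)
      assume "\<not> x > 0"
      then have "x < 0" using x by (cases "x = 0") auto
      show False
      proof (cases "x \<ge> - pi")
        case True
        then have "sin (- x) \<ge> 0" using \<open>x < 0\<close> by (intro sin_ge_zero) auto
        then show False using x by simp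
      next
        case False
        then have "y > pi" using y e0 by linarith
        then have "sin (2 * pi - y) \<ge> 0" using y by (intro sin_ge_zero) auto
        then show False using y by simp
      qed
    qed
    have "a > 0" using low[OF s b2 ab] .
    moreover have "b > 0" using low[OF s(2,1)] a2 ab by linarith
    ultimately show ?thesis by (simp add: a_def b_def)
  qed
  have disj: "\<not> (inside c (?V i) (?V (Suc i)) z \<and> inside c (?V j) (?V (Suc j)) z)"
    if ij: "i < N" "j < N" "i \<noteq> j" for i j z
  proof
    assume *: "inside c (?V i) (?V (Suc i)) z \<and> inside c (?V j) (?V (Suc j)) z"
    obtain r \<theta> where r: "0 \<le> r" and t: "0 \<le> \<theta>" "\<theta> < 2 * pi" and zz: "z = c + w * (of_real r * cis \<theta>)"
      using polar by blast
    have "\<eta> * real i < \<eta> * real (Suc j)" "\<eta> * real j < \<eta> * real (Suc i)"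
      using sector[OF ij(1) t r] sector[OF ij(2) t r] * unfolding zz by fastforce+
    then have "i < Suc j" "j < Suc i" using e0 by (simp_all del: of_nat_Suc)
    then show False using ij by simp
  qed
  show ?thesis unfolding triangulates_def using ccw un disj by auto
qed

text \<open>The sides of the central triangulation that end at the centre cancel in pairs.\<close>
lemma polygon_boundary_sum:
  assumes N: "N > 2" and w: "w \<noteq> 0"
    and H: "\<And>d X. H (- d) X = H d X"
    and T: "triangulates I A B C (regular_polygon N c w)"
  shows "(\<Sum>i\<in>I. edge_increment H (A i) (B i) + edge_increment H (B i) (C i) + edge_increment H (C i) (A i)) =
     (\<Sum>j<N. edge_increment H (regular_vertex N c w j) (regular_vertex N c w (Suc j)))"
proof -
  let ?V = "regular_vertex N c w"
  let ?g = "\<lambda>j. edge_increment H c (?V j)"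
  have "(\<Sum>i\<in>I. edge_increment H (A i) (B i) + edge_increment H (B i) (C i) + edge_increment H (C i) (A i)) =
    (\<Sum>j<N. edge_increment H c (?V j) + edge_increment H (?V j) (?V (Suc j)) + edge_increment H (?V (Suc j)) c)"
    by (rule triangulation_invariant[where H = H, OF H T central_triangulation[OF N w]])
  also have "\<dots> = (\<Sum>j<N. edge_increment H (?V j) (?V (Suc j))) - (\<Sum>j<N. ?g (Suc j) - ?g j)"
    unfolding sum_subtractf[symmetric]
    by (intro sum.cong refl) (simp add: edge_increment_swap[where H = H, OF H, of _ c])
  also have "(\<Sum>j<N. ?g (Suc j) - ?g j) = 0"
    using sum_lessThan_telescope[of ?g N] N by simp
  finally show ?thesis by simp
qed

section \<open>Angles subtended at a point\<close>

text \<open>The directed angle under which the segment from \<open>x\<close> to \<open>y\<close> is seen from the origin, set to \<open>0\<close> if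
  the origin lies on the line of the segment, and in particular if it lies between \<open>x\<close> and \<open>y\<close>. With
  this convention the angle is additive along every line. The values \<open>x = 0\<close> and \<open>y = 0\<close> are covered by
  division by zero.\<close>
definition subtended :: "complex \<Rightarrow> complex \<Rightarrow> real" where
  "subtended x y = (if Im (y / x) = 0 then 0 else Arg (y / x))"

lemma subtended_0 [simp]: "subtended 0 y = 0" "subtended x 0 = 0"
  by (simp_all add: subtended_def)

lemma subtended_scale: "f \<noteq> 0 \<Longrightarrow> subtended (f * x) (f * y) = subtended x y"
  by (simp add: subtended_def)

lemma subtended_polar:
  assumes "r > 0" "\<bar>t\<bar> < pi" "y / x = of_real r * cis t"
  shows "subtended x y = t"
proof -
  have "Im (y / x) = r * sin t" using assms(3) by simp
  moreover have "sin t = 0 \<longleftrightarrow> t = 0"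
    using assms(2) by (metis abs_less_iff sin_zero sin_gt_zero sin_minus neg_equal_0_iff_equal
        linorder_neqE_linordered_idom neg_0_less_iff_less order_less_irrefl)
  moreover have "Arg (y / x) = t"
    using assms by (intro Arg_unique[of r]) (auto simp: cis_conv_exp)
  ultimately show ?thesis using assms(1) by (auto simp: subtended_def)
qed

lemma Im_divide_sign: "sgn (Im (y / x)) = sgn (Im (cnj x * y))"
proof (cases "x = 0")
  case False
  then have "(norm x)\<^sup>2 > 0" by simp
  moreover have "y / x = of_real (inverse ((norm x)\<^sup>2)) * (cnj x * y)"
    using False unfolding of_real_inverse complex_norm_square by (simp add: field_simps)
  then have "Im (y / x) = inverse ((norm x)\<^sup>2) * Im (cnj x * y)"
    by (simp only: scaleR_conv_of_real[symmetric] scaleR_complex.sel)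
  ultimately show ?thesis by (simp add: sgn_mult)
qed auto

lemma subtended_sign: "sgn (subtended x y) = sgn (Im (cnj x * y))"
proof -
  have "sgn (subtended x y) = sgn (Im (y / x))"
  proof (cases "Im (y / x)" "0 :: real" rule: linorder_cases)
    case less
    then have "Arg (y / x) < 0" using Arg_neg_iff by blast
    then show ?thesis using less by (simp add: subtended_def)
  next
    case greater
    then have "0 < Arg (y / x)" using Arg_lt_pi by blast
    then show ?thesis using greater by (simp add: subtended_def)
  qed (simp add: subtended_def)
  then show ?thesis by (simp only: Im_divide_sign)
qed

lemma subtended_bounds: "\<bar>subtended x y\<bar> < pi"
proof (cases "Im (y / x) = 0")
  case False
  then have "Arg (y / x) \<noteq> pi" using Arg_eq_pi by blast
  then show ?thesis using False mpi_less_Arg[of "y / x"] Arg_le_pi[of "y / x"] by (auto simp: subtended_def)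
qed (simp add: subtended_def)

lemma subtended_swap: "subtended y x = - subtended x y"
proof (cases "Im (y / x) = 0")
  case True
  then have "sgn (Im (cnj y * x)) = 0"
    using Im_divide_sign[of y x] by (simp add: sgn_zero_iff algebra_simps)
  then show ?thesis using True subtended_sign[of y x] by (simp add: subtended_def sgn_zero_iff)
next
  case False
  then have "y / x \<notin> \<real>" by (auto simp: complex_is_Real_iff)
  moreover have "x / y = inverse (y / x)" by simp
  ultimately have "Arg (x / y) = - Arg (y / x)" using Arg_inverse by metis
  moreover have "Im (x / y) \<noteq> 0"
  proof -
    have "sgn (Im (cnj x * y)) \<noteq> 0" using False Im_divide_sign[of y x] by (metis sgn_zero_iff)
    then have "Im (cnj y * x) \<noteq> 0" by (simp add: sgn_zero_iff algebra_simps)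
    then show ?thesis using Im_divide_sign[of x y] by (metis sgn_zero_iff)
  qed
  ultimately show ?thesis using False by (simp add: subtended_def)
qed

lemma subtended_cis:
  assumes "Im (cnj x * y) \<noteq> 0"
  shows "y / x = of_real (norm (y / x)) * cis (subtended x y)"
proof -
  have "Im (y / x) \<noteq> 0" using assms Im_divide_sign[of y x] by (metis sgn_zero_iff)
  moreover from this have "y / x \<noteq> 0" by auto
  ultimately show ?thesis using Arg_eq[of "y / x"] by (simp add: subtended_def cis_conv_exp)
qed

text \<open>The angle under which the boundary of a triangle is seen from the origin: for a positive orientation,
  \<open>2 \<pi>\<close> from an inner point, \<open>\<pi>\<close> from an inner point of a side, the angle of the triangle from a
  vertex, and \<open>0\<close> from outside.\<close>
definition angle_sum :: "complex \<Rightarrow> complex \<Rightarrow> complex \<Rightarrow> real" where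
  "angle_sum x y z = subtended x y + subtended y z + subtended z x"

lemma angle_sum_rotate: "angle_sum y z x = angle_sum x y z"
  by (simp add: angle_sum_def)

lemma angle_sum_swap: "angle_sum x z y = - angle_sum x y z"
  by (simp add: angle_sum_def subtended_swap[of x z] subtended_swap[of z y] subtended_swap[of y x])

lemma orient_0: "orient x y 0 = Im (cnj x * y)"
  by (simp add: orient_def algebra_simps)

text \<open>The sum is a multiple of \<open>2 \<pi>\<close>, and each summand is smaller than \<open>\<pi>\<close> in absolute value and has the
  sign of the corresponding \<open>orient\<close>, not all of which are negative.\<close>
lemma angle_sum_generic:
  assumes ccw: "orient x y z > 0"
    and nz: "orient x y 0 \<noteq> 0" "orient y z 0 \<noteq> 0" "orient z x 0 \<noteq> 0"
  shows "angle_sum x y z \<ge> 0"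
    and "orient x y 0 < 0 \<or> orient y z 0 < 0 \<or> orient z x 0 < 0 \<Longrightarrow> angle_sum x y z = 0"
proof -
  have n0: "x \<noteq> 0" "y \<noteq> 0" "z \<noteq> 0" using nz by (auto simp: orient_0)
  note s = nz[unfolded orient_0]
  have "1 = (y / x) * (z / y) * (x / z)" using n0 by simp
  also have "\<dots> = of_real (norm (y / x) * norm (z / y) * norm (x / z)) * cis (angle_sum x y z)"
    by (subst subtended_cis[OF s(1)], subst subtended_cis[OF s(2)], subst subtended_cis[OF s(3)])
       (simp add: angle_sum_def cis_mult[symmetric])
  also have "norm (y / x) * norm (z / y) * norm (x / z) = 1" using n0 by (simp add: norm_divide)
  finally obtain m :: int where m: "angle_sum x y z = 2 * pi * of_int m"
    using cis_eq_1_iff_int by auto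
  have pos: "orient x y 0 > 0 \<or> orient y z 0 > 0 \<or> orient z x 0 > 0"
    using orient_sum[of x y 0 z] ccw by linarith
  have sp: "subtended a b > 0 \<longleftrightarrow> orient a b 0 > 0" "subtended a b < 0 \<longleftrightarrow> orient a b 0 < 0" for a b
    using subtended_sign[of a b] unfolding orient_0 by (metis sgn_1_pos, metis sgn_1_neg)
  have b: "\<bar>subtended x y\<bar> < pi" "\<bar>subtended y z\<bar> < pi" "\<bar>subtended z x\<bar> < pi"
    using subtended_bounds by blast+
  have "angle_sum x y z > - 2 * pi"
    using pos b unfolding sp(1)[symmetric] angle_sum_def by linarith
  then have "pi * (of_int m + 1) > 0" using m by (simp add: algebra_simps)
  then have "real_of_int m + 1 > 0" by (simp add: zero_less_mult_iff)
  then have m0: "m \<ge> 0" by linarith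
  then show "angle_sum x y z \<ge> 0" by (simp add: m)
  assume "orient x y 0 < 0 \<or> orient y z 0 < 0 \<or> orient z x 0 < 0"
  then have "angle_sum x y z < 2 * pi"
    using b unfolding sp(2)[symmetric] angle_sum_def by linarith
  then have "pi * (1 - of_int m) > 0" using m by (simp add: algebra_simps)
  then have "1 - real_of_int m > 0" by (simp add: zero_less_mult_iff)
  then have "m = 0" using m0 by linarith
  then show "angle_sum x y z = 0" by (simp add: m)
qed

text \<open>The same argument modulo \<open>\<pi>\<close> when the origin lies on the line of one of the sides.\<close>
lemma angle_sum_on_line:
  assumes ccw: "orient x y z > 0"
    and nz: "orient x y 0 = 0"
  shows "angle_sum x y z \<ge> 0"
    and "orient y z 0 < 0 \<or> orient z x 0 < 0 \<Longrightarrow> angle_sum x y z = 0"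
proof -
  have sm: "orient y z 0 + orient z x 0 > 0" using orient_sum[of x y 0 z] ccw nz by linarith
  have sp: "subtended a b > 0 \<longleftrightarrow> orient a b 0 > 0" "subtended a b < 0 \<longleftrightarrow> orient a b 0 < 0"
    "subtended a b = 0 \<longleftrightarrow> orient a b 0 = 0" for a b
    using subtended_sign[of a b] unfolding orient_0 by (metis sgn_1_pos, metis sgn_1_neg, metis sgn_zero_iff)
  have b: "\<bar>subtended y z\<bar> < pi" "\<bar>subtended z x\<bar> < pi"
    using subtended_bounds by blast+
  have F: "angle_sum x y z = subtended y z + subtended z x"
    using nz sp(3)[of x y] by (simp add: angle_sum_def)
  have "angle_sum x y z \<ge> 0 \<and> (orient y z 0 < 0 \<or> orient z x 0 < 0 \<longrightarrow> angle_sum x y z = 0)"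
  proof (cases "orient y z 0 = 0 \<or> orient z x 0 = 0")
    case True
    then show ?thesis
      using sm F sp(1)[of y z] sp(1)[of z x] sp(3)[of y z] sp(3)[of z x] by auto
  next
    case False
    then have n0: "x \<noteq> 0" "y \<noteq> 0" "z \<noteq> 0" by (auto simp: orient_0)
    have s: "Im (cnj y * z) \<noteq> 0" "Im (cnj z * x) \<noteq> 0" using False by (auto simp: orient_0)
    have r: "Im (x / y) = 0" using nz Im_divide_sign[of x y] by (simp add: orient_0 sgn_zero_iff algebra_simps)
    have "x / y = (z / y) * (x / z)" using n0 by simp
    also have "\<dots> = of_real (norm (z / y) * norm (x / z)) * cis (angle_sum x y z)"
      unfolding F by (subst subtended_cis[OF s(1)], subst subtended_cis[OF s(2)]) (simp add: cis_mult[symmetric])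
    finally have "Im (x / y) = (norm (z / y) * norm (x / z)) * sin (angle_sum x y z)" by simp
    then have "sin (angle_sum x y z) = 0" using r n0 by simp
    then obtain m :: int where m: "angle_sum x y z = of_int m * pi" using sin_zero_iff_int2 by blast
    have "angle_sum x y z > - pi"
    proof -
      have "subtended y z > 0 \<or> subtended z x > 0" unfolding sp(1) using sm by linarith
      then show ?thesis using b unfolding F by linarith
    qed
    then have "pi * (of_int m + 1) > 0" using m by (simp add: algebra_simps)
    then have "real_of_int m + 1 > 0" by (simp add: zero_less_mult_iff)
    then have m0: "m \<ge> 0" by linarith
    have "angle_sum x y z = 0" if "orient y z 0 < 0 \<or> orient z x 0 < 0"
    proof -
      have "subtended y z < 0 \<or> subtended z x < 0" unfolding sp(2) using that .
      then have "angle_sum x y z < pi" using b unfolding F by linarith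
      then have "pi * (1 - of_int m) > 0" using m by (simp add: algebra_simps)
      then have "1 - real_of_int m > 0" by (simp add: zero_less_mult_iff)
      then have "m = 0" using m0 by linarith
      then show ?thesis by (simp add: m)
    qed
    then show ?thesis using m m0 by simp
  qed
  then show "angle_sum x y z \<ge> 0"
    and "orient y z 0 < 0 \<or> orient z x 0 < 0 \<Longrightarrow> angle_sum x y z = 0" by blast+
qed

lemma angle_sum_ccw:
  assumes ccw: "orient x y z > 0"
  shows "angle_sum x y z \<ge> 0"
    and "orient x y 0 < 0 \<or> orient y z 0 < 0 \<or> orient z x 0 < 0 \<Longrightarrow> angle_sum x y z = 0"
proof -
  have r: "orient y z x > 0" "orient z x y > 0" using ccw orient_rotate by metis+
  have a: "angle_sum y z x = angle_sum x y z" "angle_sum z x y = angle_sum x y z"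
    using angle_sum_rotate by metis+
  have "angle_sum x y z \<ge> 0 \<and> (orient x y 0 < 0 \<or> orient y z 0 < 0 \<or> orient z x 0 < 0 \<longrightarrow> angle_sum x y z = 0)"
  proof -
    consider "orient x y 0 = 0" | "orient y z 0 = 0" | "orient z x 0 = 0"
      | "orient x y 0 \<noteq> 0" "orient y z 0 \<noteq> 0" "orient z x 0 \<noteq> 0" by blast
    then show ?thesis
    proof cases
      case 1
      then show ?thesis using angle_sum_on_line[OF ccw] by auto
    next
      case 2
      then show ?thesis using angle_sum_on_line[OF r(1)] unfolding a by auto
    next
      case 3
      then show ?thesis using angle_sum_on_line[OF r(2)] unfolding a by auto
    next
      case 4
      then show ?thesis using angle_sum_generic[OF ccw] by auto
    qed
  qed
  then show "angle_sum x y z \<ge> 0"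
    and "orient x y 0 < 0 \<or> orient y z 0 < 0 \<or> orient z x 0 < 0 \<Longrightarrow> angle_sum x y z = 0" by blast+
qed

lemma angle_sum_cw:
  assumes "orient x y z < 0"
  shows "angle_sum x y z \<le> 0"
proof -
  have "orient x z y = - orient x y z" by (simp add: orient_def algebra_simps)
  then have "angle_sum x z y \<ge> 0" using assms by (intro angle_sum_ccw) simp
  then show ?thesis using angle_sum_swap[of x z y] by simp
qed

text \<open>For \<open>z\<close> moving on a line of direction \<open>u\<close>, the angle of \<open>z\<close> as seen from the origin, measured from the
  foot of the perpendicular. For a line through the origin the quotient is \<open>0\<close> by division by zero, as
  required by \<open>subtended\<close>.\<close>
definition angle_potential :: "complex \<Rightarrow> complex \<Rightarrow> real" where
  "angle_potential u z = - arctan (Re (cnj u * z) / Im (cnj u * z))"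

lemma cis_arctan: "1 + \<i> * of_real s = of_real (sqrt (1 + s\<^sup>2)) * cis (arctan s)"
proof -
  have "1 + s\<^sup>2 > 0" by (simp add: add_pos_nonneg)
  then have "sqrt (1 + s\<^sup>2) > 0" by simp
  then show ?thesis by (simp add: complex_eq_iff cos_arctan sin_arctan)
qed

lemma angle_potential_diff:
  assumes u: "u \<noteq> 0" and y: "y = x + of_real t * u"
  shows "angle_potential u y - angle_potential u x = subtended x y"
proof -
  define X where "X = cnj u * x"
  define Y where "Y = cnj u * y"
  have "cnj u * (of_real t * u) = of_real (t * (norm u)\<^sup>2)"
    using complex_norm_square[of u] by (simp add: algebra_simps)
  then have YX: "Y = X + of_real (t * (norm u)\<^sup>2)" by (simp add: X_def Y_def y ring_distribs)
  have sub: "subtended x y = subtended X Y"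
    unfolding X_def Y_def using u by (simp add: subtended_scale)
  show ?thesis
  proof (cases "Im X = 0")
    case True
    then have "Im Y = 0" by (simp add: YX)
    then have "X = of_real (Re X)" "Y = of_real (Re Y)" using True by (simp_all add: complex_eq_iff)
    then have "Y / X = of_real (Re Y / Re X)" by (metis of_real_divide)
    then have "subtended X Y = 0" by (simp add: subtended_def)
    then show ?thesis
      unfolding angle_potential_def X_def[symmetric] Y_def[symmetric] sub using True \<open>Im Y = 0\<close> by simp
  next
    case False
    define \<eta> where "\<eta> = Im X"
    have imY: "Im Y = \<eta>" by (simp add: YX \<eta>_def)
    have polar: "z = \<i> * of_real \<eta> * (1 - \<i> * of_real (Re z / \<eta>))" if "Im z = \<eta>" for z
      using that False by (simp add: complex_eq_iff \<eta>_def)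
    have cs: "1 - \<i> * of_real s = of_real (sqrt (1 + s\<^sup>2)) * cis (- arctan s)" for s
      using cis_arctan[of "- s"] by (simp add: arctan_minus)
    define a where "a = Re X / \<eta>"
    define b where "b = Re Y / \<eta>"
    have pa: "sqrt (1 + a\<^sup>2) > 0" "sqrt (1 + b\<^sup>2) > 0"
      by (simp_all add: add_pos_nonneg)
    have Xa: "X = \<i> * of_real \<eta> * (of_real (sqrt (1 + a\<^sup>2)) * cis (- arctan a))"
      using polar[of X] unfolding a_def[symmetric] cs by (simp add: \<eta>_def)
    have Yb: "Y = \<i> * of_real \<eta> * (of_real (sqrt (1 + b\<^sup>2)) * cis (- arctan b))"
      using polar[OF imY] unfolding b_def[symmetric] cs .
    have "cis (- arctan b) = cis (arctan a - arctan b) * cis (- arctan a)" by (simp add: cis_mult)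
    then have "Y / X = of_real (sqrt (1 + b\<^sup>2) / sqrt (1 + a\<^sup>2)) * cis (arctan a - arctan b)"
      unfolding Xa Yb using False pa by (simp add: \<eta>_def field_simps)
    moreover have "sqrt (1 + b\<^sup>2) / sqrt (1 + a\<^sup>2) > 0" using pa by simp
    moreover have "\<bar>arctan a - arctan b\<bar> < pi"
      using arctan_bounded[of a] arctan_bounded[of b] by linarith
    ultimately have "subtended X Y = arctan a - arctan b" by (intro subtended_polar)
    then show ?thesis
      unfolding angle_potential_def X_def[symmetric] Y_def[symmetric] sub imY
      by (simp add: a_def b_def \<eta>_def)
  qed
qed

lemma angle_potential_minus: "angle_potential (- u) z = angle_potential u z"
  by (simp only: angle_potential_def complex_cnj_minus mult_minus_left uminus_complex.sel minus_divide_divide)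

lemma cis_minus_1_frac:
  "cis (2 * pi * x) - 1 = 2 * \<i> * of_real (sin (pi * frac x)) * cis (pi * frac x)"
proof -
  have "x = frac x + of_int \<lfloor>x\<rfloor>" by (simp add: frac_def)
  then have "2 * pi * x = 2 * pi * frac x + 2 * pi * of_int \<lfloor>x\<rfloor>" by (metis distrib_left)
  then have "cis (2 * pi * x) = cis (2 * pi * frac x) * cis (2 * pi * of_int \<lfloor>x\<rfloor>)"
    by (simp only: cis_mult)
  then have "cis (2 * pi * x) = cis (2 * (pi * frac x))"
    by (simp only: cis_multiple_2pi[OF Ints_of_int] mult_1_right) (simp only: mult.assoc)
  also have "\<dots> - 1 = 2 * \<i> * of_real (sin (pi * frac x)) * cis (pi * frac x)"
    unfolding complex_eq_iff by (simp add: cos_double sin_double power2_eq_square cos_squared_eq)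
      (simp add: sin_squared_eq flip: power2_eq_square)
  finally show ?thesis .
qed

lemma frac_add_of_int [simp]: "frac (x + of_int m) = frac (x :: real)"
  by (simp add: frac_def)

text \<open>The inscribed angle theorem, for the segment joining two points of a circle seen from the point \<open>1\<close> of it.\<close>
lemma subtended_star_edge:
  assumes "x \<notin> \<int>" "y \<notin> \<int>"
  shows "subtended (cis (2 * pi * x) - 1) (cis (2 * pi * y) - 1) = pi * (frac y - frac x)"
proof -
  have f: "0 < frac x" "frac x < 1" "0 < frac y" "frac y < 1"
    using assms by (auto simp: frac_gt_0_iff frac_lt_1)
  have s: "sin (pi * frac x) > 0" "sin (pi * frac y) > 0"
    using f by (auto intro!: sin_gt_zero)
  have "cis (pi * frac y) = cis (pi * (frac y - frac x)) * cis (pi * frac x)"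
    by (simp add: cis_mult algebra_simps)
  then have "(cis (2 * pi * y) - 1) / (cis (2 * pi * x) - 1) =
      of_real (sin (pi * frac y) / sin (pi * frac x)) * cis (pi * (frac y - frac x))"
    unfolding cis_minus_1_frac using s by (simp add: field_simps)
  moreover have "\<bar>pi * (frac y - frac x)\<bar> < pi"
  proof -
    have "\<bar>frac y - frac x\<bar> < 1" using f by linarith
    then show ?thesis by (simp add: abs_mult)
  qed
  moreover have "sin (pi * frac y) / sin (pi * frac x) > 0" using s by simp
  ultimately show ?thesis by (intro subtended_polar)
qed

text \<open>The \<open>i\<close>-th vertex of the regular star polygon with vertices on the unit circle and step \<open>k / N\<close>.\<close>
definition star_vertex :: "nat \<Rightarrow> nat \<Rightarrow> nat \<Rightarrow> complex" where
  "star_vertex N k i = cis (2 * pi * (real k * real i / real N))"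

text \<open>The inscribed angles telescope; the two sides that end at the vertex \<open>j\<close> itself are exceptional, as
  they are seen under the angle \<open>0\<close>.\<close>
lemma star_polygon_angle:
  assumes N: "N > 2" and k: "coprime k N" and j: "j < N"
  shows "(\<Sum>i<N. subtended (star_vertex N k i - star_vertex N k j)
      (star_vertex N k (Suc i) - star_vertex N k j)) =
    pi * (1 - 2 * frac (real k / real N))"
proof -
  define e where "e i = real k * (real i - real j) / real N" for i :: nat
  define f where "f = frac (real k / real N)"
  \<comment> \<open>the index of the side that ends at the vertex \<open>j\<close>\<close>
  define j' where "j' = (if j = 0 then N - 1 else j - 1)"
  have e_int: "e i \<in> \<int> \<longleftrightarrow> int N dvd int i - int j" for i
  proof
    assume "e i \<in> \<int>"
    then obtain m where "e i = of_int m" by (auto elim: Ints_cases)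
    then have "real_of_int (int k * (int i - int j)) = real_of_int (int N * m)"
      using N by (simp add: e_def field_simps)
    then have "int k * (int i - int j) = int N * m" by (simp only: of_int_eq_iff)
    then have "int N dvd int k * (int i - int j)" by simp
    moreover have "coprime (int N) (int k)" using k by (simp add: coprime_commute)
    ultimately show "int N dvd int i - int j" using coprime_dvd_mult_right_iff by blast
  next
    assume "int N dvd int i - int j"
    then obtain m where "int i - int j = int N * m" by blast
    then have "real i - real j = real N * of_int m" by (metis of_int_diff of_int_mult of_int_of_nat_eq)
    then have "e i = of_int (int k * m)" using N by (simp add: e_def)
    then show "e i \<in> \<int>" by (metis Ints_of_int)
  qed
  define s where "s i = subtended (star_vertex N k i - star_vertex N k j)
      (star_vertex N k (Suc i) - star_vertex N k j)" for i
  have shift: "star_vertex N k i - star_vertex N k j =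
     star_vertex N k j * (cis (2 * pi * e i) - 1)" for i
  proof -
    have "2 * pi * (real k * real i / real N) = 2 * pi * (real k * real j / real N) + 2 * pi * e i"
      using N by (simp add: e_def field_simps)
    then show ?thesis by (simp add: star_vertex_def cis_mult[symmetric] algebra_simps)
  qed
  have s: "s i = subtended (cis (2 * pi * e i) - 1) (cis (2 * pi * e (Suc i)) - 1)" for i
    unfolding s_def shift by (rule subtended_scale) (simp add: star_vertex_def)
  have frac1: "frac (real k / real N) = f" by (simp add: f_def)
  have f01: "frac (- (real k / real N)) = 1 - f"
  proof -
    have "real k / real N \<notin> \<int>"
    proof
      assume "real k / real N \<in> \<int>"
      then obtain m where "real k / real N = of_int m" by (auto elim: Ints_cases)
      then have "real_of_int (int k) = real_of_int (int N * m)" using N by (simp add: field_simps)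
      then have "int k = int N * m" by (simp only: of_int_eq_iff)
      then have "int N dvd int k" by (rule dvdI)
      then have "N dvd k" by simp
      then have "N dvd 1" using k by (metis coprime_common_divisor dvd_refl)
      then show False using N by simp
    qed
    then show ?thesis by (simp add: frac_neg f_def)
  qed
  have summand: "s i = pi * (frac (e (Suc i)) - frac (e i)) + (if i = j then - pi * f else 0) + (if i = j' then pi * (1 - f) else 0)"
    if i: "i < N" for i
  proof -
    consider "i = j" | "i = j'" "i \<noteq> j" | "i \<noteq> j" "i \<noteq> j'" by blast
    then show ?thesis
    proof cases
      case 1
      have "j \<noteq> j'" using N j by (auto simp: j'_def)
      moreover have "e i = 0" "e (Suc i) = real k / real N" by (simp_all add: e_def 1)
      ultimately show ?thesis using 1 by (simp add: s f_def)
    next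
      case 2
      have "\<exists>m::int. int (Suc i) - int j = int N * m"
      proof (cases "j = 0")
        case True
        then show ?thesis using 2 N by (intro exI[of _ 1]) (simp add: j'_def)
      next
        case False
        then show ?thesis using 2 by (intro exI[of _ 0]) (simp add: j'_def)
      qed
      then obtain m :: int where m: "int (Suc i) - int j = int N * m" by blast
      then have m': "real (Suc i) - real j = real N * of_int m" by (metis of_int_diff of_int_mult of_int_of_nat_eq)
      then have eS: "e (Suc i) = of_int (int k * m)" using N by (simp add: e_def)
      have "e i = e (Suc i) - real k / real N" using N by (simp add: e_def field_simps)
      then have "e i = - (real k / real N) + of_int (int k * m)" unfolding eS by simp
      then have f1: "frac (e i) = 1 - f" using f01 by (metis frac_add_of_int)
      have f2: "frac (e (Suc i)) = 0" unfolding eS by (simp only: frac_of_int)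
      have "cis (2 * pi * e (Suc i)) = 1" unfolding eS by (simp only: cis_multiple_2pi Ints_of_int)
      then have "s i = 0" by (simp add: s)
      then show ?thesis unfolding f1 f2 using 2 by (simp add: algebra_simps)
    next
      case 3
      have "\<not> int N dvd int i - int j"
        using i j 3 by (metis mod_eq_dvd_iff of_nat_eq_iff mod_less of_nat_mod)
      moreover have "\<not> int N dvd int (Suc i) - int j"
      proof
        assume "int N dvd int (Suc i) - int j"
        then obtain m where m: "int (Suc i) - int j = int N * m" by blast
        have "- int N < int N * m" "int N * m \<le> int N" using i j m by linarith+
        then have "int N * (-1) < int N * m" "int N * m \<le> int N * 1" by simp_all
        then have "m > -1" "m \<le> 1" using N by (simp_all only: mult_less_cancel_left_pos mult_le_cancel_left_pos of_nat_0_less_iff)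
        then have "m = 0 \<or> m = 1" by linarith
        then show False using m 3 i j by (auto simp: j'_def split: if_splits)
      qed
      ultimately show ?thesis using 3 unfolding s by (subst subtended_star_edge) (auto simp: e_int)
    qed
  qed
  have "(\<Sum>i<N. s i) = (\<Sum>i<N. pi * (frac (e (Suc i)) - frac (e i))) - pi * f + pi * (1 - f)"
  proof -
    have "j' < N" using N j by (auto simp: j'_def)
    then show ?thesis using j by (simp add: summand sum.distrib)
  qed
  also have "(\<Sum>i<N. pi * (frac (e (Suc i)) - frac (e i))) = pi * (frac (e N) - frac (e 0))"
    using sum_lessThan_telescope[of "\<lambda>i. frac (e i)" N] by (simp only: sum_distrib_left[symmetric])
  also have "frac (e N) = frac (e 0)"
  proof -
    have "e N = e 0 + of_int (int k)" using N by (simp add: e_def field_simps)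
    then show ?thesis by (simp only: frac_add_of_int)
  qed
  finally show ?thesis by (simp add: s_def f_def algebra_simps)
qed

text \<open>A positively oriented triangle with angles \<open>\<alpha>\<close>, \<open>\<beta>\<close>, \<open>\<gamma>\<close>, described by the law of sines in the form of
  an equation to which semilinear maps can be applied.\<close>
definition triangle_shape :: "complex \<Rightarrow> complex \<Rightarrow> complex \<Rightarrow> real \<Rightarrow> real \<Rightarrow> real \<Rightarrow> bool" where
  "triangle_shape A B C \<alpha> \<beta> \<gamma> \<longleftrightarrow> orient A B C > 0 \<and> 0 < \<alpha> \<and> 0 < \<beta> \<and> 0 < \<gamma> \<and> \<alpha> + \<beta> + \<gamma> = pi \<and>
     of_real (sin \<gamma>) * (C - A) = of_real (sin \<beta>) * cis \<alpha> * (B - A)"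

lemma triangle_shape_rotate:
  assumes "triangle_shape A B C \<alpha> \<beta> \<gamma>"
  shows "triangle_shape B C A \<beta> \<gamma> \<alpha>"
proof -
  have p: "0 < \<alpha>" "0 < \<beta>" "0 < \<gamma>" "\<alpha> + \<beta> + \<gamma> = pi"
    and e: "of_real (sin \<gamma>) * (C - A) = of_real (sin \<beta>) * cis \<alpha> * (B - A)"
    and o: "orient A B C > 0"
    using assms by (auto simp: triangle_shape_def)
  have "sin \<gamma> > 0" using p by (intro sin_gt_zero) auto
  have g: "sin \<gamma> = sin (\<alpha> + \<beta>)"
  proof -
    have "\<gamma> = pi - (\<alpha> + \<beta>)" using p by simp
    then show ?thesis by (simp only: sin_pi_minus)
  qed
  have "of_real (sin \<beta>) * cis (\<alpha> + \<beta>) - of_real (sin \<gamma>) * cis \<beta> = - of_real (sin \<alpha>)"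
  proof -
    have "sin \<beta> * cos (\<alpha> + \<beta>) - sin (\<alpha> + \<beta>) * cos \<beta> = sin (\<beta> - (\<alpha> + \<beta>))"
      by (simp only: sin_diff) (simp add: mult.commute)
    then show ?thesis unfolding g complex_eq_iff by (simp add: mult.commute)
  qed
  then have id: "cis \<beta> * (of_real (sin \<beta>) * cis \<alpha> - of_real (sin \<gamma>)) = - of_real (sin \<alpha>)"
    by (simp add: cis_mult[symmetric] algebra_simps)
  have "of_real (sin \<gamma>) * cis \<beta> * (C - B) = cis \<beta> * (of_real (sin \<gamma>) * (C - A) - of_real (sin \<gamma>) * (B - A))"
    by (simp add: algebra_simps)
  also have "\<dots> = (cis \<beta> * (of_real (sin \<beta>) * cis \<alpha> - of_real (sin \<gamma>))) * (B - A)"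
    unfolding e by (simp add: algebra_simps)
  also have "\<dots> = of_real (sin \<alpha>) * (A - B)" unfolding id by (simp add: algebra_simps)
  finally show ?thesis
    using p o orient_rotate[of B C A] by (simp add: triangle_shape_def add_ac)
qed

lemma angle_at_ccw:
  assumes ccw: "orient A B C > 0"
  shows "0 < angle_at B A C" "angle_at B A C < pi"
    and "\<exists>r>0. C - A = of_real r * cis (angle_at B A C) * (B - A)"
proof -
  define x where "x = B - A"
  define y where "y = C - A"
  have im: "Im (cnj x * y) > 0" using ccw by (simp add: orient_def x_def y_def)
  then have n0: "x \<noteq> 0" "y \<noteq> 0" by auto
  have imd: "Im (y / x) > 0" using Im_divide_sign[of y x] im by (simp add: sgn_1_pos)
  then have arg: "0 < Arg (y / x)" "Arg (y / x) < pi" using Arg_lt_pi by blast+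
  have yx: "y / x = of_real (norm (y / x)) * cis (Arg (y / x))"
    using Arg_eq[of "y / x"] n0 by (simp add: cis_conv_exp)
  have "x \<bullet> y = Re (cnj x * y)" by (simp add: inner_complex_def)
  also have "cnj x * y = of_real ((norm x)\<^sup>2) * (y / x)"
    using n0 unfolding complex_norm_square by simp
  also have "\<dots> = of_real ((norm x)\<^sup>2 * norm (y / x)) * cis (Arg (y / x))" by (subst yx) simp
  also have "(norm x)\<^sup>2 * norm (y / x) = norm x * norm y"
    using n0 by (simp add: norm_divide power2_eq_square)
  also have "Re (of_real (norm x * norm y) * cis (Arg (y / x))) = norm x * norm y * cos (Arg (y / x))" by simp
  finally have "x \<bullet> y / (norm x * norm y) = cos (Arg (y / x))" using n0 by simp
  then have a: "angle_at B A C = Arg (y / x)"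
    unfolding angle_at_def x_def[symmetric] y_def[symmetric] using arg by (simp add: arccos_cos)
  show "0 < angle_at B A C" "angle_at B A C < pi" using arg a by simp_all
  have "y = of_real (norm (y / x)) * cis (angle_at B A C) * x"
    unfolding a using yx n0 by (simp add: field_simps)
  moreover have "norm (y / x) > 0" using n0 by simp
  ultimately show "\<exists>r>0. C - A = of_real r * cis (angle_at B A C) * (B - A)"
    unfolding x_def y_def by blast
qed

lemma triangle_shape_angles:
  assumes ccw: "orient A B C > 0"
  shows "triangle_shape A B C (angle_at B A C) (angle_at C B A) (angle_at A C B)"
proof -
  have r: "orient B C A > 0" "orient C A B > 0" using ccw orient_rotate by metis+
  define \<alpha> \<beta> \<gamma> where "\<alpha> = angle_at B A C" and "\<beta> = angle_at C B A" and "\<gamma> = angle_at A C B"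
  obtain r1 where r1: "r1 > 0" "C - A = of_real r1 * cis \<alpha> * (B - A)"
    using angle_at_ccw(3)[OF ccw] by (auto simp: \<alpha>_def)
  obtain r2 where r2: "r2 > 0" "A - B = of_real r2 * cis \<beta> * (C - B)"
    using angle_at_ccw(3)[OF r(1)] by (auto simp: \<beta>_def)
  obtain r3 where r3: "r3 > 0" "B - C = of_real r3 * cis \<gamma> * (A - C)"
    using angle_at_ccw(3)[OF r(2)] by (auto simp: \<gamma>_def)
  have b: "0 < \<alpha>" "\<alpha> < pi" "0 < \<beta>" "\<beta> < pi" "0 < \<gamma>" "\<gamma> < pi"
    using angle_at_ccw(1,2)[OF ccw] angle_at_ccw(1,2)[OF r(1)] angle_at_ccw(1,2)[OF r(2)]
    by (simp_all add: \<alpha>_def \<beta>_def \<gamma>_def)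
  note ne = ccw_distinct[OF ccw]
  define D where "D = (C - A) * (A - B) * (B - C)"
  have D0: "D \<noteq> 0" using ne by (auto simp: D_def)
  have "D = of_real (r1 * r2 * r3) * cis (\<alpha> + \<beta> + \<gamma>) * ((B - A) * (C - B) * (A - C))"
    unfolding D_def by (subst r1(2), subst r2(2), subst r3(2)) (simp add: cis_mult[symmetric] algebra_simps)
  also have "(B - A) * (C - B) * (A - C) = - D" by (simp add: D_def algebra_simps)
  finally have "D * (1 + of_real (r1 * r2 * r3) * cis (\<alpha> + \<beta> + \<gamma>)) = 0"
    by (simp add: algebra_simps eq_neg_iff_add_eq_0)
  then have e: "of_real (r1 * r2 * r3) * cis (\<alpha> + \<beta> + \<gamma>) = -1" using D0 by (simp add: add_eq_0_iff)
  have pos: "r1 * r2 * r3 > 0" using r1 r2 r3 by simp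
  have "r1 * r2 * r3 * sin (\<alpha> + \<beta> + \<gamma>) = 0" "r1 * r2 * r3 * cos (\<alpha> + \<beta> + \<gamma>) = -1"
    using arg_cong[OF e, of Im] arg_cong[OF e, of Re] by simp_all
  then have sc: "sin (\<alpha> + \<beta> + \<gamma>) = 0" "cos (\<alpha> + \<beta> + \<gamma>) < 0"
    using pos mult_nonneg_nonneg[of "r1 * r2 * r3" "cos (\<alpha> + \<beta> + \<gamma>)"] by (auto simp: not_le[symmetric])
  then obtain m :: int where m: "\<alpha> + \<beta> + \<gamma> = of_int m * pi" using sin_zero_iff_int2 by blast
  have "0 < of_int m * pi" "of_int m * pi < 3 * pi" using b m by linarith+
  then have "0 < real_of_int m" "real_of_int m < 3" by (auto simp: zero_less_mult_iff)
  then have "m = 1 \<or> m = 2" by linarith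
  moreover have "m \<noteq> 2" using sc m by auto
  ultimately have sum: "\<alpha> + \<beta> + \<gamma> = pi" using m by auto
  have "\<gamma> = pi - (\<alpha> + \<beta>)" using sum by simp
  then have g: "sin \<gamma> = sin (\<alpha> + \<beta>)" by (simp only: sin_pi_minus)
  have "C - B = (C - A) - (B - A)" by simp
  also have "\<dots> = (of_real r1 * cis \<alpha> - 1) * (B - A)" unfolding r1(2) by (simp add: algebra_simps)
  finally have "A - B = of_real r2 * cis \<beta> * ((of_real r1 * cis \<alpha> - 1) * (B - A))" using r2(2) by simp
  then have "(B - A) * (of_real r2 * (of_real r1 * cis (\<alpha> + \<beta>) - cis \<beta>) + 1) = 0"
    by (simp add: cis_mult[symmetric] algebra_simps)
  then have h: "of_real r2 * (of_real r1 * cis (\<alpha> + \<beta>) - cis \<beta>) = -1"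
    using ne by (simp add: add_eq_0_iff2)
  have "r2 * (r1 * sin (\<alpha> + \<beta>) - sin \<beta>) = 0"
    using arg_cong[OF h, of Im] by simp
  then have "r1 * sin \<gamma> = sin \<beta>" using r2 g by simp
  then have "of_real (sin \<gamma>) * (C - A) = of_real (sin \<beta>) * cis \<alpha> * (B - A)"
    unfolding r1(2) by (simp add: mult_ac flip: of_real_mult)
  then show ?thesis
    using ccw b sum unfolding triangle_shape_def \<alpha>_def \<beta>_def \<gamma>_def by simp
qed

lemma angle_at_commute: "angle_at B A C = angle_at C A B"
  by (simp add: angle_at_def inner_commute mult.commute)

lemma collinear_orient: "collinear {A, B, C} \<longleftrightarrow> orient A B C = 0"
proof
  assume "orient A B C = 0"
  then have im: "Im (cnj (B - A) * (C - A)) = 0" by (simp add: orient_def)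
  show "collinear {A, B, C}"
  proof (cases "B = A")
    case True
    then show ?thesis by (simp add: collinear_2 insert_commute)
  next
    case False
    define t where "t = Re (cnj (B - A) * (C - A)) / (norm (B - A))\<^sup>2"
    have "cnj (B - A) * (C - A) = of_real (Re (cnj (B - A) * (C - A)))" using im by (simp add: complex_eq_iff)
    then have "(B - A) * cnj (B - A) * (C - A) = (B - A) * of_real (Re (cnj (B - A) * (C - A)))"
      by (simp add: mult.assoc)
    then have "of_real ((norm (B - A))\<^sup>2) * (C - A) = (B - A) * of_real (Re (cnj (B - A) * (C - A)))"
      by (simp only: complex_norm_square)
    then have "C - A = t *\<^sub>R (B - A)" using False by (simp add: t_def scaleR_conv_of_real field_simps)
    then have "C = A + t *\<^sub>R (B - A)" by (simp add: algebra_simps)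
    then show ?thesis unfolding collinear_def
      by (intro exI[of _ "B - A"]) (auto intro: exI[of _ 0] exI[of _ 1] exI[of _ "-1"] exI[of _ t] exI[of _ "- t"] exI[of _ "t - 1"] exI[of _ "1 - t"] simp: algebra_simps)
  qed
next
  assume "collinear {A, B, C}"
  then obtain u where u: "\<forall>x\<in>{A, B, C}. \<forall>y\<in>{A, B, C}. \<exists>c. x - y = c *\<^sub>R u" unfolding collinear_def by blast
  then obtain b c where "B - A = b *\<^sub>R u" "C - A = c *\<^sub>R u" by blast
  then show "orient A B C = 0" by (simp add: orient_def algebra_simps)
qed

section \<open>The conjugate angle equations at a vertex\<close>

lemma not_coprime_prime_factor:
  fixes a b :: nat
  assumes "\<not> coprime a b"
  obtains p where "prime p" "p dvd a" "p dvd b"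
proof -
  have "gcd a b \<noteq> 1" using assms by (simp add: coprime_iff_gcd_eq_1)
  then obtain p where "prime p" "p dvd gcd a b" using prime_factor_nat by blast
  then show thesis using that by simp
qed

lemma coprime_lift:
  fixes k q n :: nat
  assumes n: "n > 0" and k: "coprime k q"
  shows "\<exists>k'. coprime k' n \<and> [k' = k] (mod q)"
proof -
  define S where "S = {p. prime p \<and> p dvd n \<and> \<not> p dvd k}"
  have "S \<subseteq> {..n}" using n by (auto simp: S_def dest: dvd_imp_le)
  then have fS: "finite S" by (rule finite_subset) auto
  \<comment> \<open>a prime divisor of \<open>n\<close> divides exactly one of the two summands\<close>
  define k' where "k' = k + q * \<Prod>S"
  have "coprime k' n"
  proof (rule ccontr)
    assume "\<not> coprime k' n"
    then obtain p where p: "prime p" "p dvd k'" "p dvd n"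
      by (rule not_coprime_prime_factor)
    show False
    proof (cases "p dvd k")
      case True
      then have "\<not> p dvd q" using k p by (metis coprime_common_divisor not_prime_unit)
      moreover have "\<not> p dvd \<Prod>S"
      proof
        assume "p dvd \<Prod>S"
        then obtain r where "r \<in> S" "p dvd r" using prime_dvd_prod_iff[OF fS p(1), of "\<lambda>x. x"] by auto
        then have "p = r" using p(1) by (simp add: S_def primes_dvd_imp_eq)
        then show False using \<open>r \<in> S\<close> True by (simp add: S_def)
      qed
      moreover have "p dvd q * \<Prod>S" using p(2) True by (simp add: k'_def dvd_add_right_iff)
      ultimately show False using p(1) prime_dvd_mult_iff by blast
    next
      case False
      then have "p \<in> S" using p by (simp add: S_def)
      then have "p dvd \<Prod>S" using fS by (metis dvd_prodI)
      then have "p dvd k" using p(2) by (simp add: k'_def dvd_add_left_iff)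
      then show False using False by simp
    qed
  qed
  then show ?thesis unfolding k'_def by (intro exI[of _ k']) (simp add: k'_def cong_def)
qed

lemma frac_divide_nat: "frac (real a / real q) = real (a mod q) / real q"
proof (cases "q = 0")
  case False
  have "real a = real q * real (a div q) + real (a mod q)"
    by (metis mult_div_mod_eq of_nat_add of_nat_mult)
  then have "real a / real q = real (a mod q) / real q + of_int (int (a div q))"
    using False by (simp add: field_simps)
  then have "frac (real a / real q) = frac (real (a mod q) / real q)" by (metis frac_add_of_int)
  also have "\<dots> = real (a mod q) / real q" using False by (simp add: frac_eq)
  finally show ?thesis .
qed simp

lemma frac_cong:
  assumes "[a = b] (mod q)"
  shows "frac (real a / real q) = frac (real b / real q)"
  using assms by (simp add: frac_divide_nat cong_def)

lemma frac_cong_mult: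
  assumes "[a = b] (mod q)" "x = real v / real q"
  shows "frac (real a * x) = frac (real b * x)"
  using frac_cong[of "a * v" "b * v" q] assms by (simp add: cong_mult)

lemma eq_if_frac_eq:
  assumes n: "n > 0" and k: "coprime k n" and x: "x = real u / real n" "y = real v / real n"
    and b: "0 \<le> x" "x < 1" "0 \<le> y" "y < 1" and e: "frac (real k * x) = frac (real k * y)"
  shows "x = y"
proof -
  have "u < n" "v < n" using b n x by auto
  have "frac (real (k * u) / real n) = frac (real (k * v) / real n)" using e x by simp
  then have "(k * u) mod n = (k * v) mod n" using n unfolding frac_divide_nat by simp
  then have "[k * u = k * v] (mod n)" by (simp add: cong_def)
  then have "[u = v] (mod n)" using k by (simp add: cong_mult_lcancel_nat)
  then have "u = v" using \<open>u < n\<close> \<open>v < n\<close> by (simp add: cong_def)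
  then show ?thesis by (simp add: x)
qed

text \<open>The numbers \<open>y + t s / l\<close> run modulo \<open>1\<close> through a full coset of the multiples of \<open>1 / l\<close>. Of its \<open>l\<close>
  elements, one has a fractional part of at least \<open>1 - 1 / l\<close>, and another one of at least \<open>1 - 2 / l\<close>.\<close>
lemma
  fixes y :: real and l :: nat and s :: int
  assumes l: "prime l" and s: "\<not> int l dvd s"
  shows coset_first_residue: "\<exists>t. frac (y + real t * of_int s / real l) \<ge> 1 - 1 / real l"
    and coset_second_residue: "\<exists>t'. frac (y + real t' * of_int s / real l) \<ge> 1 - 2 / real l \<and> \<not> [t = t'] (mod l)"
proof -
  have l0: "l > 1" using l prime_gt_1_nat by blast
  have hit: "\<exists>t. frac (y + real t * of_int s / real l) \<ge> of_int c / real l \<and> [int t * s = c - \<lfloor>real l * y\<rfloor>] (mod int l)"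
    if c: "0 \<le> c" "c < int l" for c
  proof -
    define f where "f = frac (real l * y)"
    have f: "0 \<le> f" "f < 1" by (auto simp: f_def frac_lt_1)
    have "coprime s (int l)" using l s by (metis coprime_commute prime_imp_coprime prime_int_nat_transfer prime_nat_int_transfer)
    then obtain b where b: "[s * b = 1] (mod int l)" using cong_solve_coprime_int by blast
    define t where "t = nat ((b * (c - \<lfloor>real l * y\<rfloor>)) mod int l)"
    have "int t = (b * (c - \<lfloor>real l * y\<rfloor>)) mod int l" using l0 by (simp add: t_def)
    then have "[int t = b * (c - \<lfloor>real l * y\<rfloor>)] (mod int l)" by (simp add: cong_def)
    then have "[int t * s = b * (c - \<lfloor>real l * y\<rfloor>) * s] (mod int l)" by (rule cong_scalar_right)
    also have "b * (c - \<lfloor>real l * y\<rfloor>) * s = s * b * (c - \<lfloor>real l * y\<rfloor>)" by (simp add: mult_ac)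
    also have "[s * b * (c - \<lfloor>real l * y\<rfloor>) = 1 * (c - \<lfloor>real l * y\<rfloor>)] (mod int l)"
      using b by (rule cong_scalar_right)
    finally have ct: "[int t * s = c - \<lfloor>real l * y\<rfloor>] (mod int l)" by simp
    then obtain q where q: "int t * s = c - \<lfloor>real l * y\<rfloor> + int l * q" by (metis cong_iff_lin cong_sym)
    have "real l * y = of_int \<lfloor>real l * y\<rfloor> + f" by (simp add: f_def frac_def)
    moreover have "real t * of_int s = of_int c - of_int \<lfloor>real l * y\<rfloor> + real l * of_int q"
      using arg_cong[OF q, of "of_int :: int \<Rightarrow> real"] by simp
    ultimately have "real l * y + real t * of_int s = of_int c + f + real l * of_int q" by simp
    then have "y + real t * of_int s / real l = (of_int c + f) / real l + of_int q"
      using l0 by (simp add: field_simps)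
    then have "frac (y + real t * of_int s / real l) = frac ((of_int c + f) / real l)" by simp
    also have "\<dots> = (of_int c + f) / real l"
    proof -
      have "of_int c + f < real l" using c f by linarith
      then show ?thesis using c f l0 by (simp add: frac_eq)
    qed
    also have "\<dots> \<ge> of_int c / real l" using f by (simp add: divide_right_mono)
    finally show ?thesis using ct by blast
  qed
  have e1: "of_int (int l - 1) / real l = 1 - 1 / real l" and e2: "of_int (int l - 2) / real l = 1 - 2 / real l"
    using l0 by (simp_all add: field_simps)
  obtain t1 where t1: "frac (y + real t1 * of_int s / real l) \<ge> 1 - 1 / real l" "[int t1 * s = (int l - 1) - \<lfloor>real l * y\<rfloor>] (mod int l)"
    using hit[of "int l - 1"] l0 unfolding e1 by auto
  obtain t2 where t2: "frac (y + real t2 * of_int s / real l) \<ge> 1 - 2 / real l" "[int t2 * s = (int l - 2) - \<lfloor>real l * y\<rfloor>] (mod int l)"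
    using hit[of "int l - 2"] l0 unfolding e2 by auto
  show "\<exists>t. frac (y + real t * of_int s / real l) \<ge> 1 - 1 / real l" using t1 by blast
  show "\<exists>t'. frac (y + real t' * of_int s / real l) \<ge> 1 - 2 / real l \<and> \<not> [t = t'] (mod l)"
  proof (cases "[t = t1] (mod l)")
    case False
    have "1 - 2 / real l \<le> 1 - 1 / real l" by (simp add: divide_right_mono)
    then show ?thesis using False t1 by (meson order_trans)
  next
    case True
    have "\<not> [t = t2] (mod l)"
    proof
      assume "[t = t2] (mod l)"
      then have "[t1 = t2] (mod l)" using True by (metis cong_sym cong_trans)
      then have "[int t1 = int t2] (mod int l)" by (simp add: cong_int_iff)
      then have "[int t1 * s = int t2 * s] (mod int l)" by (rule cong_scalar_right)
      then have "[(int l - 1) - \<lfloor>real l * y\<rfloor> = (int l - 2) - \<lfloor>real l * y\<rfloor>] (mod int l)"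
        using t1(2) t2(2) by (metis cong_sym cong_trans)
      then have "int l dvd 1" by (simp add: cong_iff_dvd_diff)
      then show False using l0 by simp
    qed
    then show ?thesis using t2 by blast
  qed
qed

text \<open>Let the prime \<open>l\<close> occur in the denominator \<open>m\<close> of \<open>x\<close> to a higher power than in \<open>N\<close>. Then \<open>k\<close> can be
  multiplied by numbers \<open>1 + t L\<close> with \<open>L = lcm N (m div l)\<close>, without changing its residue modulo \<open>N\<close>;
  this adds to \<open>k x\<close> multiples of \<open>1 / l\<close>. The factor has to be prime to \<open>l\<close>, which excludes one residue
  of \<open>t\<close> modulo \<open>l\<close>, and none if \<open>l\<close> divides \<open>L\<close>.\<close>
lemma large_conjugate:
  fixes n N k u m l :: nat
  assumes n: "n > 0" "N dvd n" and k: "coprime k n" and x: "x = real u / real m"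
    and um: "coprime u m" "m dvd n" and l: "prime l" "l dvd m" "\<not> m dvd lcm N (m div l)"
  shows "\<exists>k'. coprime k' n \<and> [k' = k] (mod N) \<and> frac (real k' * x) \<ge> 1 - 2 / real l \<and>
    (l dvd lcm N (m div l) \<longrightarrow> frac (real k' * x) \<ge> 1 - 1 / real l)"
proof -
  define m' where "m' = m div l"
  have m: "m = l * m'" using l by (simp add: m'_def)
  have m0: "m > 0" using um n by (auto intro: gr0I)
  have N0: "N > 0" using n by (auto intro: gr0I)
  have l0: "l > 1" using l prime_gt_1_nat by blast
  have m'0: "m' > 0" using m0 m by (auto intro: gr0I)
  define L where "L = lcm N m'"
  obtain L' where L': "L = m' * L'" unfolding L_def by (metis dvd_lcm2 dvdE)
  have lL': "\<not> l dvd L'"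
  proof
    assume "l dvd L'"
    then have "m dvd L" unfolding L' m by (metis dvd_refl mult.commute mult_dvd_mono)
    then show False using l(3) by (simp add: L_def m'_def)
  qed
  have lu: "\<not> l dvd u" using um l by (metis coprime_common_divisor not_prime_unit)
  have lk: "\<not> l dvd k" using k um(2) l by (metis coprime_common_divisor dvd_trans not_prime_unit)
  define s where "s = L' * u * k"
  have ls: "\<not> int l dvd int s"
    using lL' lu lk l(1) by (simp add: s_def prime_dvd_mult_iff)
  have val: "real (k * (1 + t * L)) * x = real k * x + real t * of_int (int s) / real l" for t
    using l0 m'0 by (simp add: x s_def L' m field_simps)
  have lift: "\<exists>k'. coprime k' n \<and> [k' = k] (mod N) \<and> frac (real k' * x) = frac (real k * x + real t * of_int (int s) / real l)"
    if good: "\<not> l dvd 1 + t * L" for t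
  proof -
    have "coprime (1 + t * L) (lcm N m)"
    proof (rule ccontr)
      assume "\<not> coprime (1 + t * L) (lcm N m)"
      then obtain p where p: "prime p" "p dvd 1 + t * L" "p dvd lcm N m"
        by (rule not_coprime_prime_factor)
      have "lcm N m dvd N * m" by (simp add: lcm_least)
      then have "p dvd N * (l * m')" using p(3) m by (metis dvd_trans)
      then have "p dvd N \<or> p dvd l \<or> p dvd m'" using p(1) by (simp add: prime_dvd_mult_iff)
      moreover have "\<not> p dvd l" using good p l(1) by (metis primes_dvd_imp_eq)
      ultimately have "p dvd L" unfolding L_def by (metis dvd_lcm1 dvd_lcm2 dvd_trans)
      then have "p dvd 1" using p(2) by (metis dvd_add_left_iff dvd_mult)
      then show False using p(1) by simp
    qed
    then obtain h where h: "coprime h n" "[h = 1 + t * L] (mod (lcm N m))"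
      using coprime_lift[OF n(1)] by blast
    have hN: "[h = 1 + t * L] (mod N)" and hm: "[h = 1 + t * L] (mod m)"
      using h(2) cong_dvd_modulus_nat by (meson dvd_lcm1 dvd_lcm2)+
    have "[1 + t * L = 1] (mod N)"
      by (metis L_def add.right_neutral cong_add_lcancel_0_nat cong_0_iff dvd_lcm1 dvd_mult)
    then have "[h = 1] (mod N)" using hN cong_trans by blast
    then have 1: "[k * h = k] (mod N)" using cong_scalar_left by fastforce
    have "frac (real (k * h) * x) = frac (real (k * (1 + t * L)) * x)"
      using hm x by (intro frac_cong_mult[where q = m] cong_scalar_left) auto
    then show ?thesis using 1 h(1) k val by (intro exI[of _ "k * h"]) (simp del: of_nat_mult)
  qed
  show ?thesis
  proof (cases "l dvd L")
    case True
    obtain t where t: "frac (real k * x + real t * of_int (int s) / real l) \<ge> 1 - 1 / real l"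
      using coset_first_residue[OF l(1) ls] by blast
    have "\<not> l dvd 1 + t * L" using True l(1) by (metis dvd_add_left_iff dvd_mult not_prime_unit)
    moreover have "1 - 2 / real l \<le> 1 - 1 / real l" by (simp add: divide_right_mono)
    ultimately show ?thesis using lift[of t] t by (metis order_trans)
  next
    case False
    have "\<exists>t. \<not> l dvd 1 + t * L \<and> frac (real k * x + real t * of_int (int s) / real l) \<ge> 1 - 2 / real l"
    proof -
      obtain t0 where t0: "frac (real k * x + real t0 * of_int (int s) / real l) \<ge> 1 - 1 / real l"
        using coset_first_residue[OF l(1) ls] by blast
      have le: "1 - 2 / real l \<le> 1 - 1 / real l" by (simp add: divide_right_mono)
      show ?thesis
      proof (cases "l dvd 1 + t0 * L")
        case False
        then show ?thesis using t0 le by (meson order_trans)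
      next
        case True
        have goodt: "\<not> l dvd 1 + t * L" if "\<not> [t0 = t] (mod l)" for t
        proof
          assume "l dvd 1 + t * L"
          then have "[1 + t * L = 1 + t0 * L] (mod l)" using True by (simp add: cong_def dvd_eq_mod_eq_0)
          then have "[t * L = t0 * L] (mod l)" by (simp only: cong_add_lcancel_nat)
          moreover have "coprime L l" using False l(1) by (metis coprime_commute prime_imp_coprime)
          ultimately have "[t = t0] (mod l)" by (simp add: cong_mult_rcancel_nat)
          then show False using that cong_sym by blast
        qed
        obtain t2 where t2: "frac (real k * x + real t2 * of_int (int s) / real l) \<ge> 1 - 2 / real l" "\<not> [t0 = t2] (mod l)"
          using coset_second_residue[OF l(1) ls] by blast
        then show ?thesis using goodt by blast
      qed
    qed
    then show ?thesis using lift False unfolding L_def m'_def by metis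
  qed
qed


lemma denominator_dvd:
  fixes N Q m :: nat
  assumes m: "m > 0" and N: "N > 0" and Q: "Q > 0" "N dvd Q"
    and l: "\<And>l. \<lbrakk>prime l; l dvd m; \<not> m dvd lcm N (m div l)\<rbrakk> \<Longrightarrow> multiplicity l m \<le> multiplicity l Q"
  shows "m dvd Q"
proof (rule multiplicity_le_imp_dvd)
  fix p :: nat assume p: "prime p"
  show "multiplicity p m \<le> multiplicity p Q"
  proof (cases "multiplicity p m \<le> multiplicity p N")
    case True
    moreover have "multiplicity p N \<le> multiplicity p Q" using Q by (intro dvd_imp_multiplicity_le) auto
    ultimately show ?thesis by simp
  next
    case False
    then have pm: "p dvd m" using not_dvd_imp_multiplicity_0[of p m] by fastforce
    then obtain m' where m': "m = p * m'" by blast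
    have "m' > 0" using m m' by (auto intro: gr0I)
    have "multiplicity p m = Suc (multiplicity p m')"
      unfolding m' using p \<open>m' > 0\<close> by (intro multiplicity_times_same) auto
    moreover have "m div p = m'" using m' p by (simp add: prime_gt_0_nat)
    moreover have "multiplicity p (lcm N m') = max (multiplicity p N) (multiplicity p m')"
      using N \<open>m' > 0\<close> p by (intro multiplicity_lcm) auto
    ultimately have "multiplicity p (lcm N (m div p)) < multiplicity p m" using False by simp
    moreover have "lcm N (m div p) \<noteq> 0" using N \<open>m div p = m'\<close> \<open>m' > 0\<close> by simp
    ultimately have "\<not> m dvd lcm N (m div p)" using dvd_imp_multiplicity_le[of m "lcm N (m div p)" p] by auto
    then show ?thesis using l[OF p pm] by blast
  qed
qed (use m in auto)

lemma multiplicity_eq_1: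
  fixes l m :: nat
  assumes "prime l" "l dvd m" "\<not> l dvd m div l" "m > 0"
  shows "multiplicity l m = 1"
proof -
  obtain m' where m': "m = l * m'" using assms by blast
  have "m' > 0" using m' assms by (auto intro: gr0I)
  moreover have "\<not> l dvd m'" using assms m' by (simp add: prime_gt_0_nat)
  ultimately have "multiplicity l m = Suc 0"
    unfolding m' using assms by (subst multiplicity_times_same) (auto simp: not_dvd_imp_multiplicity_0)
  then show ?thesis by simp
qed

lemma reduced_fraction:
  fixes n u :: nat
  assumes n: "n > 0"
  obtains u' m where "real u / real n = real u' / real m" "coprime u' m" "m dvd n" "m > 0"
proof -
  define g where "g = gcd u n"
  have g: "g > 0" using n by (simp add: g_def)
  have ug: "u = g * (u div g)" and ng: "n = g * (n div g)" by (simp_all add: g_def)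
  then have "real u = real g * real (u div g)" "real n = real g * real (n div g)" by (metis of_nat_mult)+
  then have "real u / real n = real (u div g) / real (n div g)" using g by simp
  moreover have "coprime (u div g) (n div g)" unfolding g_def using n by (intro div_gcd_coprime) auto
  moreover have "n div g dvd n" using ng by (metis dvd_triv_right)
  moreover have "n div g > 0" using n by (simp add: g_def div_greater_zero_iff)
  ultimately show thesis using that by blast
qed

text \<open>A number all of whose conjugates over a fixed residue modulo \<open>N\<close> are small has a denominator that divides \<open>Q\<close>.\<close>
lemma small_conjugates_denominator:
  fixes n N k Q u :: nat
  assumes n: "n > 0" "N dvd n" and k: "coprime k n" and x: "x = real u / real n"
    and Q: "Q > 0" "N dvd Q"
    and small: "\<And>k'. coprime k' n \<Longrightarrow> [k' = k] (mod N) \<Longrightarrow> frac (real k' * x) \<le> \<rho>"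
    and \<rho>: "\<rho> < 1 / 2" "\<rho> < 1 / 3 \<or> 3 dvd Q" and two: "2 dvd Q"
  shows "\<exists>v. x = real v / real Q"
proof -
  obtain u' m where m: "x = real u' / real m" "coprime u' m" "m dvd n" "m > 0"
    using reduced_fraction[OF n(1), of u] x by metis
  have N0: "N > 0" using n by (auto intro: gr0I)
  have "m dvd Q"
  proof (rule denominator_dvd[OF m(4) N0 Q])
    fix l assume l: "prime l" "l dvd m" "\<not> m dvd lcm N (m div l)"
    obtain k' where k': "coprime k' n" "[k' = k] (mod N)" "frac (real k' * x) \<ge> 1 - 2 / real l"
      "l dvd lcm N (m div l) \<longrightarrow> frac (real k' * x) \<ge> 1 - 1 / real l"
      using large_conjugate[OF n k m(1,2,3) l] by blast
    have fl: "1 - 2 / real l \<le> \<rho>" using small[OF k'(1,2)] k'(3) by simp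
    have l2: "l \<ge> 2" using l prime_ge_2_nat by blast
    have nd: "\<not> l dvd lcm N (m div l)"
    proof
      assume "l dvd lcm N (m div l)"
      then have "1 - 1 / real l \<le> \<rho>" using small[OF k'(1,2)] k'(4) by simp
      moreover have "1 / real l \<le> 1 / 2" using l2 by (intro divide_left_mono) auto
      ultimately show False using \<rho> by simp
    qed
    then have m1: "multiplicity l m = 1"
      using l m(4) by (intro multiplicity_eq_1) (auto dest: dvd_trans[OF _ dvd_lcm2])
    have "2 / real l > 1 / 2" using fl \<rho>(1) by linarith
    then have "real l < 4" using l2 by (simp add: field_simps)
    then have "l = 2 \<or> l = 3" using l2 by auto
    moreover have "3 dvd Q" if "l = 3"
    proof -
      have "1 - 2 / 3 \<le> \<rho>" using fl that by simp
      then show ?thesis using \<rho>(2) by auto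
    qed
    ultimately have "l dvd Q" using two by auto
    then have "multiplicity l Q \<ge> 1" using l(1) Q(1) multiplicity_geI[of Q l 1] by (metis neq0_conv not_prime_unit power_one_right)
    then show "multiplicity l m \<le> multiplicity l Q" using m1 by simp
  qed
  then obtain d where d: "Q = m * d" by blast
  have "x = real (u' * d) / real Q" using d Q m by simp
  then show ?thesis by blast
qed

lemma size_le_sum_mset:
  assumes "\<And>x. x \<in># M \<Longrightarrow> f x > (0 :: nat)"
  shows "size M \<le> (\<Sum>x\<in>#M. f x)"
  using assms by (induction M) force+

lemma mset_size_2:
  assumes "size M = 2"
  obtains x y where "M = {#x, y#}"
proof -
  obtain x M' where M: "M = add_mset x M'" using assms by (metis size_eq_Suc_imp_eq_union numeral_2_eq_2)
  then have "size M' = 1" using assms by simp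
  then obtain y where "M' = {#y#}" by (metis size_1_singleton_mset)
  then show thesis using that M by simp
qed

lemma sum_two_cases:
  assumes pos: "\<And>x. x \<in># M \<Longrightarrow> f x > (0 :: nat)" and sum: "(\<Sum>x\<in>#M. f x) = 2"
  obtains x where "M = {#x#}" | x y where "M = {#x, y#}" "f x = f y"
proof -
  have "size M \<le> 2" using size_le_sum_mset[of M f] pos sum by simp
  moreover have "M \<noteq> {#}" using sum by auto
  ultimately have "size M = 1 \<or> size M = 2" by (metis One_nat_def Suc_1 le_Suc_eq le_zero_eq size_eq_0_iff_empty)
  then show thesis
  proof
    assume "size M = 1"
    then show thesis using that(1) by (metis size_1_singleton_mset)
  next
    assume "size M = 2"
    then obtain x y where M: "M = {#x, y#}" by (rule mset_size_2)
    moreover have "f x > 0" "f y > 0" using pos M by auto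
    ultimately show thesis using that(2) sum by simp
  qed
qed


lemma frac_pos:
  assumes n: "n > 0" and k: "coprime k n" and x: "0 < x" "x < 1" "x = real u / real n"
  shows "frac (real k * x) > 0"
proof -
  have u: "0 < u" "u < n" using x n by (auto simp: field_simps)
  have "(k * u) mod n \<noteq> 0"
  proof
    assume "(k * u) mod n = 0"
    then have "n dvd k * u" by auto
    then have "n dvd u" using k by (simp add: coprime_commute coprime_dvd_mult_right_iff)
    then show False using u by (auto dest: dvd_imp_le)
  qed
  moreover have "frac (real k * x) = real ((k * u) mod n) / real n"
    using frac_divide_nat[of "k * u" n] x(3) by simp
  ultimately show ?thesis using n by simp
qed

lemma sum_mset_scaled:
  assumes "\<And>x. x \<in># M \<Longrightarrow> g x = real (f x) / real Q"
  shows "(\<Sum>x\<in>#M. g x) = real (\<Sum>x\<in>#M. f x) / real Q"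
  using assms by (induction M) (auto simp: add_divide_distrib)

lemma sum_mset_nonneg_real:
  assumes "\<And>y. y \<in># M \<Longrightarrow> g y \<ge> (0 :: real)"
  shows "(\<Sum>y\<in>#M. g y) \<ge> 0"
  using assms by (induction M) auto

lemma sum_mset_member_le:
  assumes "x \<in># M" "\<And>y. y \<in># M \<Longrightarrow> g y \<ge> (0 :: real)"
  shows "g x \<le> (\<Sum>y\<in>#M. g y)"
proof -
  obtain M' where M: "M = add_mset x M'" using assms(1) by (metis insert_DiffM)
  have "(\<Sum>y\<in>#M'. g y) \<ge> 0" using assms(2) unfolding M by (intro sum_mset_nonneg_real) auto
  then show ?thesis by (simp add: M)
qed

lemma sum_mset_member_le_nat:
  assumes "x \<in># M"
  shows "(g x :: nat) \<le> (\<Sum>y\<in>#M. g y)"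
proof -
  obtain M' where "M = add_mset x M'" using assms by (metis insert_DiffM)
  then show ?thesis by simp
qed

lemma sum_mset_count:
  assumes "set_mset V \<subseteq> S" "finite S"
  shows "(\<Sum>v\<in>#V. g v) = (\<Sum>v\<in>S. count V v * (g v :: nat))"
  using assms(1)
proof (induction V)
  case (add x V)
  have "(\<Sum>v\<in>S. count (add_mset x V) v * g v) = (\<Sum>v\<in>S. count V v * g v + (if v = x then g v else 0))"
    by (rule sum.cong) auto
  then show ?case using add assms(2) by (simp add: sum.distrib)
qed auto

text \<open>The conjugates of an equation at a vertex: \<open>M\<close> is the multiset of the angles of the tiles at that vertex,
  divided by \<open>\<pi>\<close>. They are rational with denominator \<open>n\<close>, and for every \<open>k\<close> prime to \<open>n\<close> for which the
  star polygon of step \<open>k / N\<close> is positively oriented, the conjugate angles add up to the angle of the star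
  polygon.\<close>
definition star_angle_system :: "nat \<Rightarrow> nat \<Rightarrow> real multiset \<Rightarrow> bool" where
  "star_angle_system N n M \<longleftrightarrow>
     (\<forall>x\<in>#M. 0 < x \<and> x < 1 \<and> (\<exists>u. x = real u / real n)) \<and>
     (\<forall>k. coprime k n \<and> frac (real k / real N) < 1 / 2 \<longrightarrow>
        (\<Sum>x\<in>#M. frac (real k * x)) = 1 - 2 * frac (real k / real N))"

lemma star_angle_system_residue:
  assumes sys: "star_angle_system N n M" and k: "coprime k n" "[k = k0] (mod N)" and k0: "2 * k0 < N"
  shows "(\<Sum>x\<in>#M. frac (real k * x)) = 1 - 2 * real k0 / real N"
proof -
  have "frac (real k / real N) = frac (real k0 / real N)" using k(2) by (rule frac_cong)
  also have "\<dots> = real k0 / real N" using k0 by (simp add: frac_divide_nat)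
  finally have f: "frac (real k / real N) = real k0 / real N" .
  moreover have "real k0 / real N < 1 / 2" using k0 by (simp add: field_simps)
  ultimately show ?thesis using sys k(1) unfolding star_angle_system_def by simp
qed

lemma star_angle_system_sum:
  assumes sys: "star_angle_system N n M" and N: "N > 6"
  shows "(\<Sum>x\<in>#M. x) = 1 - 2 / real N"
proof -
  have "(\<Sum>x\<in>#M. x) = (\<Sum>x\<in>#M. frac (real 1 * x))"
    using sys by (intro arg_cong[of _ _ sum_mset] image_mset_cong) (auto simp: star_angle_system_def frac_eq)
  also have "\<dots> = 1 - 2 * real 1 / real N"
    using N by (intro star_angle_system_residue[OF sys]) auto
  finally show ?thesis by simp
qed

lemma star_angle_system_scaled:
  assumes sys: "star_angle_system N n M" and k: "coprime k n" "[k = k0] (mod N)" and k0: "2 * k0 < N"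
    and Q: "Q > 0" and v: "\<And>x. x \<in># M \<Longrightarrow> x = real (v x) / real Q"
  shows "real (\<Sum>x\<in>#M. (k * v x) mod Q) = real Q * (1 - 2 * real k0 / real N)"
    and "n > 0 \<Longrightarrow> x \<in># M \<Longrightarrow> (k * v x) mod Q > 0"
    and "n > 0 \<Longrightarrow> x \<in># M \<Longrightarrow> y \<in># M \<Longrightarrow> (k * v x) mod Q = (k * v y) mod Q \<Longrightarrow> x = y"
proof -
  have fr: "frac (real k * x) = real ((k * v x) mod Q) / real Q" if "x \<in># M" for x
  proof -
    have "real k * x = real (k * v x) / real Q" using v[OF that] by (metis of_nat_mult times_divide_eq_right)
    then show ?thesis by (simp only: frac_divide_nat)
  qed
  then have "(\<Sum>x\<in>#M. frac (real k * x)) = real (\<Sum>x\<in>#M. (k * v x) mod Q) / real Q"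
    by (intro sum_mset_scaled)
  then show "real (\<Sum>x\<in>#M. (k * v x) mod Q) = real Q * (1 - 2 * real k0 / real N)"
    unfolding star_angle_system_residue[OF sys k k0] using Q by (simp add: nonzero_eq_divide_eq mult.commute)
  show "(k * v x) mod Q > 0" if n0: "n > 0" and xM: "x \<in># M"
  proof -
    obtain u where "0 < x" "x < 1" "x = real u / real n"
      using sys xM unfolding star_angle_system_def by blast
    from frac_pos[OF n0 k(1) this] have "real ((k * v x) mod Q) / real Q > 0"
      unfolding fr[OF xM] .
    then show ?thesis by (intro gr0I) (simp only: of_nat_0 div_0 less_irrefl)
  qed
  show "x = y" if n0: "n > 0" and xM: "x \<in># M" and yM: "y \<in># M" and e: "(k * v x) mod Q = (k * v y) mod Q"
  proof -
    have f: "frac (real k * x) = frac (real k * y)" unfolding fr[OF xM] fr[OF yM] e ..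
    obtain u where u: "0 < x" "x < 1" "x = real u / real n"
      using sys xM unfolding star_angle_system_def by blast
    obtain u' where u': "0 < y" "y < 1" "y = real u' / real n"
      using sys yM unfolding star_angle_system_def by blast
    show ?thesis using eq_if_frac_eq[OF n0 k(1) u(3) u'(3)] u u' f by simp
  qed
qed

lemma star_angle_system_denominator:
  assumes sys: "star_angle_system N n M" and n: "n > 0" "N dvd n" and k0: "coprime k0 N" "2 * k0 < N"
    and Q: "Q > 0" "N dvd Q" "2 dvd Q"
    and \<rho>: "1 - 2 * real k0 / real N < 1 / 2" "1 - 2 * real k0 / real N < 1 / 3 \<or> 3 dvd Q"
  shows "\<exists>v. \<forall>x\<in>#M. x = real (v x) / real Q"
proof -
  obtain k where k: "coprime k n" "[k = k0] (mod N)" using coprime_lift[OF n(1) k0(1)] by blast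
  have "\<exists>v. x = real v / real Q" if x: "x \<in># M" for x
  proof -
    obtain u where u: "x = real u / real n" using sys x unfolding star_angle_system_def by blast
    have "frac (real k' * x) \<le> 1 - 2 * real k0 / real N" if k': "coprime k' n" "[k' = k] (mod N)" for k'
    proof -
      have "[k' = k0] (mod N)" using k'(2) k(2) cong_trans by blast
      then show ?thesis
        using sum_mset_member_le[OF x, of "\<lambda>x. frac (real k' * x)"] star_angle_system_residue[OF sys k'(1) _ k0(2)]
        by simp
    qed
    then show ?thesis using small_conjugates_denominator[OF n k(1) u Q(1,2) _ \<rho> Q(3)] by blast
  qed
  then show ?thesis by (intro exI[of _ "\<lambda>x. SOME v. x = real v / real Q"]) (meson someI_ex)
qed

text \<open>The case that the right hand side of one of the conjugate equations is \<open>2\<close> in units of the common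
  denominator \<open>Q\<close>. Since the summands are positive integers in these units, there are at most two of them,
  and if there are two, then they are equal. This applies to odd \<open>N\<close> with \<open>Q = 2 N\<close> and \<open>k = (N - 1) / 2\<close>,
  and to \<open>N\<close> divisible by \<open>4\<close> with \<open>Q = N\<close> and \<open>k = N / 2 - 1\<close>.\<close>
lemma star_angle_system_two:
  assumes sys: "star_angle_system N n M" and N: "N > 6" and n: "n > 0" "N dvd n"
    and k0: "coprime k0 N" "2 * k0 < N" and Q: "Q > 6" "N dvd Q" "2 dvd Q"
    and e: "1 - 2 * real k0 / real N = 2 / real Q"
  shows "M = {#1 - 2 / real N#} \<or> M = {#(1 - 2 / real N) / 2, (1 - 2 / real N) / 2#}"
proof -
  have q: "2 / real Q < 1 / 3" using Q by (simp add: field_simps)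
  obtain v where v: "\<And>x. x \<in># M \<Longrightarrow> x = real (v x) / real Q"
    using star_angle_system_denominator[OF sys n k0, of Q] Q q e by auto
  obtain k where k: "coprime k n" "[k = k0] (mod N)" using coprime_lift[OF n(1) k0(1)] by blast
  have Q0: "Q > 0" using Q by simp
  note sc = star_angle_system_scaled[OF sys k k0(2) Q0 v]
  have "real (\<Sum>x\<in>#M. (k * v x) mod Q) = 2" using sc(1) e Q0 by simp
  then have sum: "(\<Sum>x\<in>#M. (k * v x) mod Q) = 2" by linarith
  note total = star_angle_system_sum[OF sys N]
  show ?thesis
  proof (rule sum_two_cases[OF _ sum])
    show "(k * v x) mod Q > 0" if "x \<in># M" for x using sc(2) n that by blast
    show ?thesis if "M = {#x#}" for x using total that by simp
    show ?thesis if "M = {#x, y#}" "(k * v x) mod Q = (k * v y) mod Q" for x y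
    proof -
      have "x = y" using sc(3)[of x y] n that by simp
      then have M: "M = {#y, y#}" using that by simp
      then have "y = (1 - 2 / real N) / 2" using total by simp
      then show ?thesis using M by metis
    qed
  qed
qed

lemma sum_four_cases:
  assumes pos: "\<And>x. x \<in># M \<Longrightarrow> f x > (0 :: nat) \<and> even (f x)" and sum: "(\<Sum>x\<in>#M. f x) = 4"
  obtains x where "M = {#x#}" | x y where "M = {#x, y#}" "f x = f y"
proof -
  have "f x = 2 * (f x div 2)" if "x \<in># M" for x using pos[OF that] by simp
  then have "(\<Sum>x\<in>#M. f x) = (\<Sum>x\<in>#M. 2 * (f x div 2))"
    by (intro arg_cong[of _ _ sum_mset] image_mset_cong) auto
  then have "2 * (\<Sum>x\<in>#M. f x div 2) = 4" using sum by (simp add: sum_mset_distrib_left)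
  then have sum2: "(\<Sum>x\<in>#M. f x div 2) = 2" by simp
  show thesis
  proof (rule sum_two_cases[OF _ sum2])
    show "f x div 2 > 0" if "x \<in># M" for x using pos[OF that] by (auto elim!: evenE)
    show thesis if "M = {#x#}" for x using that by fact
    show thesis if "M = {#x, y#}" "f x div 2 = f y div 2" for x y
    proof -
      have "f x = f y" using that pos[of x] pos[of y] by (auto elim!: evenE)
      then show thesis using \<open>M = {#x, y#}\<close> \<open>\<And>x y. M = {#x, y#} \<Longrightarrow> f x = f y \<Longrightarrow> thesis\<close> by blast
    qed
  qed
qed

lemma coprime_odd_double:
  fixes a h :: nat
  assumes "odd a" "coprime a h"
  shows "coprime a (2 * h)"
  using assms by (simp add: coprime_mult_right_iff coprime_commute[of a 2] prime_imp_coprime)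

text \<open>For \<open>N = 2 h\<close> with odd \<open>h\<close> the smallest right hand side is \<open>4 / N\<close>, for \<open>k = h - 2\<close>. The next
  one, \<open>8 / N\<close> for \<open>k = h - 4\<close>, excludes odd summands in the first equation: an odd summand \<open>X\<close> would
  become \<open>2 X + h > 8\<close>.\<close>
lemma star_angle_system_singly_even:
  assumes sys: "star_angle_system N n M" and N: "N = 2 * h" "odd h" "h \<ge> 7" and n: "n > 0" "N dvd n"
  shows "M = {#1 - 2 / real N#} \<or> M = {#(1 - 2 / real N) / 2, (1 - 2 / real N) / 2#}"
proof -
  have N6: "N > 6" "N > 0" using N by auto
  have cop: "coprime (h - 2) N" "coprime (h - 4) N"
  proof -
    have o: "odd (h - 2)" "odd (h - 4)" using N by auto
    have "coprime (h - 2) h"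
    proof (rule ccontr)
      assume "\<not> coprime (h - 2) h"
      then obtain p where p: "prime p" "p dvd h - 2" "p dvd h" by (rule not_coprime_prime_factor)
      have "p dvd h - (h - 2)" by (rule dvd_diff_nat[OF p(3,2)])
      moreover have "h - (h - 2) = 2" using N by simp
      ultimately have "p dvd 2" by metis
      then have "p = 2" using p(1) by (simp add: primes_dvd_imp_eq)
      then show False using p N by simp
    qed
    moreover have "coprime (h - 4) h"
    proof (rule ccontr)
      assume "\<not> coprime (h - 4) h"
      then obtain p where p: "prime p" "p dvd h - 4" "p dvd h" by (rule not_coprime_prime_factor)
      have "p dvd h - (h - 4)" by (rule dvd_diff_nat[OF p(3,2)])
      moreover have "h - (h - 4) = 2 ^ 2" using N by simp
      ultimately have "p dvd 2 ^ 2" by metis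
      then have "p dvd 2" using p(1) prime_dvd_power_nat by blast
      then have "p = 2" using p(1) by (simp add: primes_dvd_imp_eq)
      then show False using p N by simp
    qed
    ultimately show "coprime (h - 2) N" "coprime (h - 4) N"
      unfolding N(1) using o by (auto intro: coprime_odd_double)
  qed
  have e1: "1 - 2 * real (h - 2) / real N = 4 / real N" and e2: "1 - 2 * real (h - 4) / real N = 8 / real N"
    using N by (auto simp: field_simps)
  have lt: "2 * (h - 2) < N" "2 * (h - 4) < N" using N by auto
  have small: "1 - 2 * real (h - 2) / real N < 1 / 2" "1 - 2 * real (h - 2) / real N < 1 / 3"
    unfolding e1 using N by (simp_all add: field_simps)
  have "N dvd N" "2 dvd N" using N by simp_all
  then obtain v where v: "\<And>x. x \<in># M \<Longrightarrow> x = real (v x) / real N"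
    using star_angle_system_denominator[OF sys n cop(1) lt(1) N6(2) _ _ small(1) disjI1[OF small(2)]] by blast
  obtain k where k: "coprime k n" "[k = h - 2] (mod N)" using coprime_lift[OF n(1) cop(1)] by blast
  obtain l where l: "coprime l n" "[l = h - 4] (mod N)" using coprime_lift[OF n(1) cop(2)] by blast
  note sk = star_angle_system_scaled[OF sys k lt(1) N6(2) v]
  note sl = star_angle_system_scaled[OF sys l lt(2) N6(2) v]
  have "real (\<Sum>x\<in>#M. (k * v x) mod N) = 4"
    using sk(1) unfolding e1 using N6 by (simp del: of_nat_sum_mset)
  then have sum4: "(\<Sum>x\<in>#M. (k * v x) mod N) = 4" by linarith
  have "real (\<Sum>x\<in>#M. (l * v x) mod N) = 8"
    using sl(1) unfolding e2 using N6 by (simp del: of_nat_sum_mset)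
  then have sum8: "(\<Sum>x\<in>#M. (l * v x) mod N) = 8" by linarith
  have le: "(k * v x) mod N \<le> 4" "(l * v x) mod N \<le> 8" if "x \<in># M" for x
    using sum_mset_member_le_nat[OF that, of "\<lambda>x. (k * v x) mod N"]
      sum_mset_member_le_nat[OF that, of "\<lambda>x. (l * v x) mod N"] sum4 sum8 by simp_all
  have even: "even ((k * v x) mod N)" if x: "x \<in># M" for x
  proof (rule ccontr)
    assume odd: "odd ((k * v x) mod N)"
    define X where "X = (k * v x) mod N"
    have "X \<le> 4" "odd X" using le[OF x] odd by (auto simp: X_def)
    then have X3: "X \<le> 3" by (cases "X = 4") auto
    have "even X \<longleftrightarrow> even (k * v x)" unfolding X_def N(1) by (simp add: dvd_mod_iff)
    then have vo: "odd (v x)" using \<open>odd X\<close> by auto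
    then obtain r where r: "v x = 2 * r + 1" by (metis oddE)
    have "[int l * int (v x) = (int h - 4) * int (v x)] (mod int N)"
    proof (rule cong_scalar_right)
      have "[int l = int (h - 4)] (mod int N)" using l(2) by (simp add: cong_int_iff)
      then show "[int l = int h - 4] (mod int N)" using N by (simp add: of_nat_diff)
    qed
    moreover have "[2 * int X + int h = (int h - 4) * int (v x)] (mod int N)"
    proof -
      have "[int X = int k * int (v x)] (mod int N)"
        unfolding X_def by (metis cong_int_iff cong_mod_left cong_refl of_nat_mult)
      moreover have "[int k * int (v x) = (int h - 2) * int (v x)] (mod int N)"
      proof (rule cong_scalar_right)
        have "[int k = int (h - 2)] (mod int N)" using k(2) by (simp add: cong_int_iff)
        then show "[int k = int h - 2] (mod int N)" using N by (simp add: of_nat_diff)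
      qed
      ultimately have "[2 * int X + int h = 2 * ((int h - 2) * int (v x)) + int h] (mod int N)"
        by (metis cong_add cong_refl cong_scalar_left cong_trans)
      moreover have "2 * ((int h - 2) * int (v x)) + int h = (int h - 4) * int (v x) + int N * (int r + 1)"
        unfolding r N(1) by (simp add: algebra_simps)
      ultimately show ?thesis by (simp add: cong_def)
    qed
    ultimately have "[int (l * v x) = int (2 * X + h)] (mod int N)"
      by (simp add: cong_def)
    then have "[l * v x = 2 * X + h] (mod N)" by (simp only: cong_int_iff)
    then have "(l * v x) mod N = 2 * X + h" using X3 N by (simp add: cong_def)
    moreover have "X > 0" using \<open>odd X\<close> by (auto intro: gr0I)
    ultimately show False using le(2)[OF x] N by simp
  qed
  note total = star_angle_system_sum[OF sys N6(1)]
  show ?thesis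
  proof (rule sum_four_cases[OF _ sum4])
    show "(k * v x) mod N > 0 \<and> even ((k * v x) mod N)" if "x \<in># M" for x using sk(2) even n that by blast
    show ?thesis if "M = {#x#}" for x using total that by simp
    show ?thesis if "M = {#x, y#}" "(k * v x) mod N = (k * v y) mod N" for x y
    proof -
      have "x = y" using sk(3)[of x y] n that by simp
      then have M: "M = {#y, y#}" using that by simp
      then have "y = (1 - 2 / real N) / 2" using total by simp
      then show ?thesis using M by metis
    qed
  qed
qed


lemma thirtieths_candidates:
  "\<forall>v\<in>set [0..<30]. v \<noteq> 0 \<longrightarrow> v \<le> 24 \<longrightarrow> (13 * v) mod 30 \<le> 12 \<longrightarrow> (23 * v) mod 30 \<le> 12 \<longrightarrow>
     v \<in> {3, 7, 12, 17, 21, 24::nat}"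
  by code_simp

lemma mset_from_counts:
  assumes "set_mset V \<subseteq> set_mset W" "\<And>v. v \<in># W \<Longrightarrow> count V v = count W v"
  shows "V = W"
proof (rule multiset_eqI)
  fix v show "count V v = count W v"
  proof (cases "v \<in># W")
    case False
    then have "v \<notin># V" using assms(1) by blast
    then show ?thesis using False by (simp add: not_in_iff)
  qed (use assms(2) in blast)
qed

lemma thirtieths_solutions:
  fixes a b c d e f :: nat
  assumes "3 * a + 7 * b + 12 * c + 17 * d + 21 * e + 24 * f = 24"
    and "3 * a + 17 * b + 12 * c + 7 * d + 21 * e + 24 * f = 24"
    and "9 * a + b + 6 * c + 11 * d + 3 * e + 12 * f = 12"
    and "9 * a + 11 * b + 6 * c + d + 3 * e + 12 * f = 12"
  shows "(a, b, c, d, e, f) \<in> {(1, 0, 0, 0, 1, 0), (0, 1, 0, 1, 0, 0), (0, 0, 2, 0, 0, 0), (0, 0, 0, 0, 0, 1)}"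
proof -
  have bd: "b = d" using assms(1,2) by linarith
  have ae: "a = e" using assms(3,4) assms(1) unfolding bd by linarith
  have s: "2 * a + 2 * d + c + 2 * f = 2" using assms(1) unfolding bd ae by linarith
  have "a \<le> 1" "d \<le> 1" "f \<le> 1" using s by linarith+
  then have "a = 0 \<or> a = 1" "d = 0 \<or> d = 1" "f = 0 \<or> f = 1" by auto
  then show ?thesis using s bd ae by (elim disjE) simp_all
qed

lemma coprime_thirty: "coprime 3 (10 :: nat)" "coprime 1 (30 :: nat)" "coprime 11 (30 :: nat)" "coprime 13 (30 :: nat)" "coprime 23 (30 :: nat)"
  by (simp_all add: coprime_iff_gcd_eq_1 gcd_non_0_nat)

text \<open>For \<open>N = 10\<close> the smallest right hand side \<open>2 / 5\<close> is not below \<open>1 / 3\<close>, so that the denominator \<open>30\<close> has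
  to be allowed. The four equations for \<open>k = 1, 11, 13, 23\<close> leave only six candidates for the angles, and
  they determine the multiplicities.\<close>
lemma star_angle_system_decagon:
  assumes sys: "star_angle_system 10 n M" and n: "n > 0" "10 dvd n"
  shows "M = {#8 / 10#} \<or> M = {#4 / 10, 4 / 10#} \<or> M = {#1 / 10, 7 / 10#} \<or> M = {#7 / 30, 17 / 30#}"
proof -
  have c3: "coprime 3 (10 :: nat)" "2 * 3 < (10 :: nat)" by (simp_all add: coprime_thirty)
  have "\<exists>v. \<forall>x\<in>#M. x = real (v x) / real 30"
    by (rule star_angle_system_denominator[OF sys n c3]) auto
  then obtain v where v: "\<And>x. x \<in># M \<Longrightarrow> x = real (v x) / real 30" by blast
  have sums: "(\<Sum>x\<in>#M. (r * v x) mod 30) = s"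
    if r: "coprime r 30" "[r = k0] (mod 10)" "2 * k0 < 10" "s + 6 * k0 = 30" for r k0 s :: nat
  proof -
    obtain k where k: "coprime k n" "[k = r] (mod 30)" using coprime_lift[OF n(1) r(1)] by blast
    have "[k = r] (mod 10)" using k(2) by (rule cong_dvd_modulus_nat) simp
    then have k10: "[k = k0] (mod 10)" using r(2) cong_trans by blast
    have "real (\<Sum>x\<in>#M. (k * v x) mod 30) = real 30 * (1 - 2 * real k0 / real 10)"
      by (rule star_angle_system_scaled(1)[OF sys k(1) k10 r(3) _ v]) auto
    also have "\<dots> = real s" using r(4) by simp
    finally have "(\<Sum>x\<in>#M. (k * v x) mod 30) = s" by linarith
    moreover have "(k * v x) mod 30 = (r * v x) mod 30" for x
      using k(2) by (metis cong_def cong_scalar_right)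
    ultimately show ?thesis by simp
  qed
  have v30: "0 < v x" "v x < 30" if "x \<in># M" for x
  proof -
    have "0 < x" "x < 1" using sys that unfolding star_angle_system_def by blast+
    then have "0 < real (v x) / real 30" "real (v x) / real 30 < 1" using v[OF that] by metis+
    then show "0 < v x" "v x < 30" by simp_all
  qed
  define V where "V = image_mset v M"
  have s1: "(\<Sum>u\<in>#V. (1 * u) mod 30) = 24" and s11: "(\<Sum>u\<in>#V. (11 * u) mod 30) = 24"
    and s13: "(\<Sum>u\<in>#V. (13 * u) mod 30) = 12" and s23: "(\<Sum>u\<in>#V. (23 * u) mod 30) = 12"
    using sums[of 1 1 24] sums[of 11 1 24] sums[of 13 3 12] sums[of 23 3 12]
    by (simp_all add: V_def coprime_thirty cong_def multiset.map_comp comp_def)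
  have "u \<in> {3, 7, 12, 17, 21, 24}" if u: "u \<in># V" for u
  proof -
    have "0 < u" "u < 30" using u v30 by (auto simp: V_def)
    moreover have "(1 * u) mod 30 \<le> 24" "(13 * u) mod 30 \<le> 12" "(23 * u) mod 30 \<le> 12"
      using sum_mset_member_le_nat[OF u, of "\<lambda>u. (1 * u) mod 30"] sum_mset_member_le_nat[OF u, of "\<lambda>u. (13 * u) mod 30"]
        sum_mset_member_le_nat[OF u, of "\<lambda>u. (23 * u) mod 30"] s1 s13 s23 by metis+
    ultimately show ?thesis using thirtieths_candidates by simp
  qed
  then have sub: "set_mset V \<subseteq> {3, 7, 12, 17, 21, 24}" by blast
  note sc = sum_mset_count[OF sub, simplified]
  let ?n = "count V"
  have "(?n 3, ?n 7, ?n 12, ?n 17, ?n 21, ?n 24) \<in> {(1, 0, 0, 0, 1, 0), (0, 1, 0, 1, 0, 0), (0, 0, 2, 0, 0, 0), (0, 0, 0, 0, 0, 1)}"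
  proof (rule thirtieths_solutions)
    show "3 * ?n 3 + 7 * ?n 7 + 12 * ?n 12 + 17 * ?n 17 + 21 * ?n 21 + 24 * ?n 24 = 24"
      using s1 sc[of "\<lambda>u. (1 * u) mod 30"] by (simp add: mult.commute)
    show "3 * ?n 3 + 17 * ?n 7 + 12 * ?n 12 + 7 * ?n 17 + 21 * ?n 21 + 24 * ?n 24 = 24"
      using s11 sc[of "\<lambda>u. (11 * u) mod 30"] by (simp add: mult.commute)
    show "9 * ?n 3 + ?n 7 + 6 * ?n 12 + 11 * ?n 17 + 3 * ?n 21 + 12 * ?n 24 = 12"
      using s13 sc[of "\<lambda>u. (13 * u) mod 30"] by (simp add: mult.commute)
    show "9 * ?n 3 + 11 * ?n 7 + 6 * ?n 12 + ?n 17 + 3 * ?n 21 + 12 * ?n 24 = 12"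
      using s23 sc[of "\<lambda>u. (23 * u) mod 30"] by (simp add: mult.commute)
  qed
  then consider (a) "?n 3 = 1" "?n 7 = 0" "?n 12 = 0" "?n 17 = 0" "?n 21 = 1" "?n 24 = 0"
    | (b) "?n 3 = 0" "?n 7 = 1" "?n 12 = 0" "?n 17 = 1" "?n 21 = 0" "?n 24 = 0"
    | (c) "?n 3 = 0" "?n 7 = 0" "?n 12 = 2" "?n 17 = 0" "?n 21 = 0" "?n 24 = 0"
    | (d) "?n 3 = 0" "?n 7 = 0" "?n 12 = 0" "?n 17 = 0" "?n 21 = 0" "?n 24 = 1"
    by auto
  then have counts: "V = {#3, 21#} \<or> V = {#7, 17#} \<or> V = {#12, 12#} \<or> V = {#24#}"
  proof cases
    case a
    then have "set_mset V \<subseteq> {3, 21}" using sub by (auto simp: count_eq_zero_iff)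
    then have "V = {#3, 21#}" by (intro mset_from_counts) (use a in auto)
    then show ?thesis by blast
  next
    case b
    then have "set_mset V \<subseteq> {7, 17}" using sub by (auto simp: count_eq_zero_iff)
    then have "V = {#7, 17#}" by (intro mset_from_counts) (use b in auto)
    then show ?thesis by blast
  next
    case c
    then have "set_mset V \<subseteq> {12}" using sub by (auto simp: count_eq_zero_iff)
    then have "V = {#12, 12#}" by (intro mset_from_counts) (use c in auto)
    then show ?thesis by blast
  next
    case d
    then have "set_mset V \<subseteq> {24}" using sub by (auto simp: count_eq_zero_iff)
    then have "V = {#24#}" by (intro mset_from_counts) (use d in auto)
    then show ?thesis by blast
  qed
  have "image_mset (\<lambda>u. real u / real 30) V = image_mset (\<lambda>x. x) M"
    unfolding V_def multiset.map_comp comp_def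
    by (rule image_mset_cong) (use v in metis)
  then have "M = image_mset (\<lambda>u. real u / real 30) V" by simp
  then show ?thesis using counts by auto
qed

lemma coprime_half:
  fixes k :: nat
  shows "coprime k (2 * k + 1)" and "odd k \<Longrightarrow> coprime k (2 * k + 2)"
proof -
  show "coprime k (2 * k + 1)"
  proof (rule coprimeI)
    fix d assume "d dvd k" "d dvd 2 * k + 1"
    then show "is_unit d" by (metis dvd_add_right_iff dvd_mult)
  qed
  assume o: "odd k"
  show "coprime k (2 * k + 2)"
  proof (rule ccontr)
    assume "\<not> coprime k (2 * k + 2)"
    then obtain p where p: "prime p" "p dvd k" "p dvd 2 * k + 2" by (rule not_coprime_prime_factor)
    then have "p dvd 2" by (metis dvd_add_right_iff dvd_mult)
    then have "p = 2" using p(1) by (simp add: primes_dvd_imp_eq)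
    then show False using p o by simp
  qed
qed

lemma star_angle_system_solutions:
  assumes sys: "star_angle_system N n M" and N: "N > 6" and n: "n > 0" "N dvd n"
  shows "M = {#1 - 2 / real N#} \<or> M = {#(1 - 2 / real N) / 2, (1 - 2 / real N) / 2#} \<or>
    (N = 10 \<and> (M = {#1 / 10, 7 / 10#} \<or> M = {#7 / 30, 17 / 30#}))"
proof -
  consider "odd N" | "4 dvd N" | "even N" "\<not> 4 dvd N" "N \<noteq> 10" | "N = 10" by blast
  then show ?thesis
  proof cases
    case 1
    then obtain k where k: "N = 2 * k + 1" by (metis oddE)
    have "1 - 2 * real k / real N = 2 / real (2 * N)" using N by (simp add: k field_simps)
    moreover have "coprime k N" "2 * k < N" using coprime_half(1)[of k] k by simp_all
    moreover have "2 * N > 6" "N dvd 2 * N" "2 dvd 2 * N" using N by simp_all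
    ultimately show ?thesis
      using star_angle_system_two[OF sys N n, of k "2 * N"] by blast
  next
    case 2
    then obtain t where t: "N = 4 * t" by blast
    define k where "k = 2 * t - 1"
    have k: "N = 2 * k + 2" "odd k" using N t by (auto simp: k_def)
    have "1 - 2 * real k / real N = 2 / real N" using N by (simp add: k field_simps)
    moreover have "coprime k N" "2 * k < N" using coprime_half(2)[OF k(2)] k by simp_all
    moreover have "N dvd N" "2 dvd N" using k by simp_all
    ultimately show ?thesis
      using star_angle_system_two[OF sys N n, of k N] N by blast
  next
    case 3
    then obtain h where h: "N = 2 * h" by (metis evenE)
    have "odd h" using 3 h by auto
    moreover have "h \<ge> 7"
    proof -
      have "h \<noteq> 4" "h \<noteq> 5" "h \<noteq> 6" "h > 3" using 3 h N \<open>odd h\<close> by auto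
      then show ?thesis by linarith
    qed
    ultimately show ?thesis using star_angle_system_singly_even[OF sys h _ _ n] by blast
  next
    case 4
    then show ?thesis using star_angle_system_decagon[of n M] sys n by auto
  qed
qed

text \<open>Different solutions cannot occur together, since they would produce angles of a triangle with a sum
  different from \<open>\<pi>\<close>. For the two main solutions this is the point where \<open>N > 6\<close> is used:
  \<open>\<delta>\<^sub>N + \<delta>\<^sub>N / 2 > \<pi>\<close>.\<close>
lemma solutions_agree:
  fixes a b c :: real
  assumes abc: "a > 0" "b > 0" "c > 0" "a + b + c = 1" and N: "N > 6"
    and M: "set_mset M \<subseteq> {a, b, c}" "set_mset M' \<subseteq> {a, b, c}"
    and sol: "\<And>M. M \<in> S \<Longrightarrow> M = {#1 - 2 / real N#} \<or> M = {#(1 - 2 / real N) / 2, (1 - 2 / real N) / 2#} \<or>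
    (N = 10 \<and> (M = {#1 / 10, 7 / 10#} \<or> M = {#7 / 30, 17 / 30#}))" and S: "M \<in> S" "M' \<in> S"
  shows "M = M'"
proof -
  define \<delta> where "\<delta> = 1 - 2 / real N"
  have d: "\<delta> > 2 / 3" "\<delta> < 1" using N by (simp_all add: \<delta>_def field_simps)
  have two: "x + y < 1" if "x \<in> {a, b, c}" "y \<in> {a, b, c}" "x \<noteq> y" for x y
    using that abc by auto
  have three: "x + y + z = 1" if "x \<in> {a, b, c}" "y \<in> {a, b, c}" "z \<in> {a, b, c}" "x \<noteq> y" "x \<noteq> z" "y \<noteq> z" for x y z
    using that abc by auto
  have ten: "\<delta> = 8 / 10" if "N = 10" using that by (simp add: \<delta>_def)
  have mem: "\<And>x. x \<in># M \<Longrightarrow> x \<in> {a, b, c}" "\<And>x. x \<in># M' \<Longrightarrow> x \<in> {a, b, c}" using M by blast+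
  have no1: False if "\<delta> \<in> {a, b, c}" "\<delta> / 2 \<in> {a, b, c}" using two[OF that] d by simp
  have no2: False if "N = 10" "x \<in> {a, b, c}" "\<delta> \<in> {a, b, c}" "1 / 5 \<le> x" "x < 8 / 10" for x
    using two[OF that(2,3)] that ten by auto
  have no3: False if "N = 10" "7 / 10 \<in> {a, b, c}" "\<delta> / 2 \<in> {a, b, c}" using two[OF that(2,3)] that ten by auto
  have no4: False if "N = 10" "7 / 30 \<in> {a, b, c}" "17 / 30 \<in> {a, b, c}" "\<delta> / 2 \<in> {a, b, c}"
    using three[OF that(2-4)] that ten by auto
  have no5: False if "7 / 30 \<in> {a, b, c}" "1 / 10 \<in> {a, b, c}" "7 / 10 \<in> {a, b, c}"
    using three[OF that] by auto
  define P where "P x \<longleftrightarrow> x \<in> {a, b, c}" for x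
  define \<eta> where "\<eta> = \<delta> / 2"
  have mem': "\<And>x. x \<in># M \<Longrightarrow> P x" "\<And>x. x \<in># M' \<Longrightarrow> P x" using mem by (simp_all add: P_def)
  have no: "\<not> (P \<delta> \<and> P \<eta>)" "N = 10 \<Longrightarrow> \<not> (P (7 / 10) \<and> P \<delta>)" "N = 10 \<Longrightarrow> \<not> (P (17 / 30) \<and> P \<delta>)"
    "N = 10 \<Longrightarrow> \<not> (P (7 / 10) \<and> P \<eta>)" "N = 10 \<Longrightarrow> \<not> (P (7 / 30) \<and> P (17 / 30) \<and> P \<eta>)"
    "\<not> (P (7 / 30) \<and> P (1 / 10) \<and> P (7 / 10))"
    using no1 no2[of "7 / 10"] no2[of "17 / 30"] no3 no4 no5 unfolding P_def \<eta>_def by auto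
  show ?thesis
    using sol[OF S(1)] sol[OF S(2)] mem' no unfolding \<delta>_def[symmetric] \<eta>_def[symmetric]
    by (elim disjE conjE) simp_all
qed

section \<open>Conjugates of a tiling\<close>

lemma semilinear_diff:
  assumes "semilinear n k \<phi>"
  shows "\<phi> (x - y) = \<phi> x - \<phi> y" "\<phi> 0 = 0"
proof -
  have add: "\<phi> (x + y) = \<phi> x + \<phi> y" for x y using assms by (simp add: semilinear_def)
  show "\<phi> (x - y) = \<phi> x - \<phi> y" using add[of "x - y" y] by simp
  show "\<phi> 0 = 0" using add[of 0 0] by simp
qed

lemma semilinear_id: "semilinear n 1 (\<lambda>z. z)"
  by (simp add: semilinear_def)

text \<open>The angles that occur as arguments of \<open>n\<close>-th roots of unity.\<close>
definition on_grid :: "nat \<Rightarrow> real \<Rightarrow> bool" where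
  "on_grid n t \<longleftrightarrow> (\<exists>m::int. t = 2 * pi * of_int m / real n)"

lemma on_grid_minus: "on_grid n t \<Longrightarrow> on_grid n (- t)"
  unfolding on_grid_def by (elim exE) (rule_tac x = "- m" in exI, simp)

lemma on_grid_add: "on_grid n s \<Longrightarrow> on_grid n t \<Longrightarrow> on_grid n (s + t)"
  unfolding on_grid_def
  by (elim exE) (rule_tac x = "m + ma" in exI, simp add: add_divide_distrib ring_distribs)

lemma semilinear_cis:
  assumes "semilinear n k \<phi>" "on_grid n t"
  shows "\<phi> (cis t * z) = cis (real k * t) * \<phi> z"
  using assms unfolding semilinear_def on_grid_def by (elim conjE exE) simp

text \<open>A real multiple of an \<open>n\<close>-th root of unity.\<close>
definition grid_direction :: "nat \<Rightarrow> complex \<Rightarrow> bool" where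
  "grid_direction n z \<longleftrightarrow> (\<exists>r t. on_grid n t \<and> z = of_real r * cis t)"

lemma grid_direction_scale: "grid_direction n z \<Longrightarrow> grid_direction n (of_real r * z)"
  unfolding grid_direction_def
proof (elim exE conjE)
  fix s t assume "on_grid n t" "z = of_real s * cis t"
  then show "\<exists>r' t. on_grid n t \<and> of_real r * z = of_real r' * cis t"
    by (intro exI[of _ "r * s"] exI[of _ t]) simp
qed

lemma grid_direction_minus: "grid_direction n (- z) \<longleftrightarrow> grid_direction n z"
  using grid_direction_scale[of n z "-1"] grid_direction_scale[of n "- z" "-1"] by auto

lemma grid_direction_cis: "on_grid n t \<Longrightarrow> grid_direction n z \<Longrightarrow> grid_direction n (cis t * z)"
  unfolding grid_direction_def
proof (elim exE conjE)
  fix r s assume "on_grid n t" "on_grid n s" "z = of_real r * cis s"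
  then show "\<exists>r s. on_grid n s \<and> cis t * z = of_real r * cis s"
    using on_grid_add[of n t s] by (intro exI[of _ r] exI[of _ "t + s"]) (simp add: cis_mult[symmetric])
qed

lemma scaled_eqD: "of_real a * x = of_real b * y \<Longrightarrow> a \<noteq> 0 \<Longrightarrow> x = of_real (b / a) * (y :: complex)"
  by (simp add: field_simps)

lemma grid_direction_shape:
  assumes sh: "triangle_shape A B C \<alpha> \<beta> \<gamma>" and a: "on_grid n \<alpha>"
  shows "grid_direction n ((B - A) / w) \<longleftrightarrow> grid_direction n ((C - A) / w)"
proof -
  have pos: "sin \<beta> > 0" "sin \<gamma> > 0"
    using sh unfolding triangle_shape_def by (auto intro!: sin_gt_zero)
  have e: "of_real (sin \<gamma>) * (C - A) = of_real (sin \<beta>) * cis \<alpha> * (B - A)"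
    using sh by (simp add: triangle_shape_def)
  have e': "of_real (sin \<gamma>) * ((C - A) / w) = of_real (sin \<beta>) * (cis \<alpha> * ((B - A) / w))"
    unfolding times_divide_eq_right e by (simp add: mult.assoc)
  then have 1: "(C - A) / w = of_real (sin \<beta> / sin \<gamma>) * (cis \<alpha> * ((B - A) / w))"
    by (rule scaled_eqD) (use pos in simp)
  have "cis (- \<alpha>) * cis \<alpha> = 1" by (simp add: cis_mult)
  then have "of_real (sin \<beta>) * ((B - A) / w) = cis (- \<alpha>) * (of_real (sin \<beta>) * (cis \<alpha> * ((B - A) / w)))"
    by (simp add: mult.left_commute[of "cis (- \<alpha>)"] mult.assoc[symmetric])
  also have "\<dots> = of_real (sin \<gamma>) * (cis (- \<alpha>) * ((C - A) / w))"
    unfolding e'[symmetric] by (simp only: mult.left_commute)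
  finally have 2: "(B - A) / w = of_real (sin \<gamma> / sin \<beta>) * (cis (- \<alpha>) * ((C - A) / w))"
    by (rule scaled_eqD) (use pos in simp)
  show ?thesis
    using 1 2 grid_direction_scale grid_direction_cis a on_grid_minus by metis
qed

lemma grid_direction_edges:
  assumes sh: "triangle_shape A B C \<alpha> \<beta> \<gamma>" and a: "on_grid n \<alpha>" "on_grid n \<beta>" "on_grid n \<gamma>"
  shows "grid_direction n ((C - B) / w) \<longleftrightarrow> grid_direction n ((B - A) / w)"
    and "grid_direction n ((A - C) / w) \<longleftrightarrow> grid_direction n ((B - A) / w)"
proof -
  have sym: "grid_direction n ((x - y) / w) \<longleftrightarrow> grid_direction n ((y - x) / w)" for x y
    using grid_direction_minus[of n "(y - x) / w"] by (metis minus_diff_eq minus_divide_left)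
  note sh2 = triangle_shape_rotate[OF sh]
  show "grid_direction n ((C - B) / w) \<longleftrightarrow> grid_direction n ((B - A) / w)"
    using grid_direction_shape[OF sh2 a(2)] sym by blast
  show "grid_direction n ((A - C) / w) \<longleftrightarrow> grid_direction n ((B - A) / w)"
    using grid_direction_shape[OF sh a(1)] sym by blast
qed

text \<open>For a unit vector \<open>d\<close> the increments of this function along the sides of a triangle add up to twice its
  area.\<close>
definition area_potential :: "complex \<Rightarrow> complex \<Rightarrow> real" where
  "area_potential d X = Im (cnj X * d) * Re (cnj X * d)"

lemma area_potential_minus: "area_potential (- d) X = area_potential d X"
  by (simp only: area_potential_def mult_minus_right uminus_complex.sel minus_mult_minus)

lemma area_potential_diff:
  assumes "A \<noteq> B"
  shows "area_potential (sgn (B - A)) B - area_potential (sgn (B - A)) A = orient A B 0"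
proof -
  define u where "u = sgn (B - A)"
  define L where "L = norm (B - A)"
  have BA: "B - A = of_real L * u" using assms by (simp add: u_def L_def sgn_eq)
  then have B: "B = A + of_real L * u" by (simp add: algebra_simps)
  have "norm u = 1" using assms by (simp add: u_def norm_sgn)
  then have uu: "cnj u * u = 1" by (metis complex_norm_square mult.commute of_real_1 power_one)
  have cB: "cnj B * u = cnj A * u + of_real L"
    unfolding B using uu by (simp add: algebra_simps)
  have "orient A B 0 = Im (cnj A * B)" by (simp add: orient_0)
  also have "\<dots> = Im (cnj A * A + of_real L * (cnj A * u))" unfolding B by (simp add: algebra_simps)
  also have "\<dots> = L * Im (cnj A * u)" by simp
  finally have o: "orient A B 0 = L * Im (cnj A * u)" .
  have "Im (cnj B * u) = Im (cnj A * u)" "Re (cnj B * u) = Re (cnj A * u) + L" unfolding cB by simp_all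
  then show ?thesis unfolding o area_potential_def u_def[symmetric] by (simp only: algebra_simps)
qed

lemma half_chord: "cis (a + b) - cis a = of_real (2 * sin (b / 2)) * cis (pi / 2 + b / 2 + a)"
proof -
  have "cis b - 1 = of_real (2 * sin (b / 2)) * cis (pi / 2 + b / 2)"
  proof -
    have "cos b = 1 - 2 * (sin (b / 2))\<^sup>2" "sin b = 2 * sin (b / 2) * cos (b / 2)"
      using cos_double_sin[of "b / 2"] sin_double[of "b / 2"] by simp_all
    then show ?thesis
      unfolding complex_eq_iff by (simp add: cos_add sin_add power2_eq_square)
  qed
  moreover have "cis (a + b) - cis a = cis a * (cis b - 1)" by (simp add: cis_mult[symmetric] algebra_simps)
  ultimately show ?thesis by (simp add: cis_mult[symmetric] algebra_simps)
qed

lemma regular_edge_direction: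
  assumes N: "N > 0" and w: "w \<noteq> 0" and n: "n > 0" "4 * N dvd n"
  shows "grid_direction n ((regular_vertex N c w (Suc j) - regular_vertex N c w j) / w)"
proof -
  obtain q where q: "n = 4 * N * q" using n by blast
  have q0: "q > 0" using n q by (auto intro: gr0I)
  define b where "b = 2 * pi / real N"
  define a where "a = 2 * pi * real j / real N"
  have "(regular_vertex N c w (Suc j) - regular_vertex N c w j) / w = cis (a + b) - cis a"
    using w by (simp add: regular_vertex_def a_def b_def field_simps add_divide_distrib)
  also have "\<dots> = of_real (2 * sin (b / 2)) * cis (pi / 2 + b / 2 + a)" by (rule half_chord)
  finally have e: "(regular_vertex N c w (Suc j) - regular_vertex N c w j) / w = of_real (2 * sin (b / 2)) * cis (pi / 2 + b / 2 + a)" .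
  have "pi / 2 + b / 2 + a = 2 * pi * of_int (int (N * q + 2 * q + 4 * j * q)) / real n"
    using N q0 unfolding q a_def b_def by (simp add: field_simps)
  then have "on_grid n (pi / 2 + b / 2 + a)" unfolding on_grid_def by blast
  then show ?thesis unfolding grid_direction_def e by blast
qed

text \<open>The directions of all sides are, up to real factors, products of \<open>w\<close> and \<open>n\<close>-th roots of unity. Indeed,
  the sides of one tile are either all of this kind or all not. If the area is computed by boundary sums that
  take only the sides of the second kind into account, then the polygon contributes \<open>0\<close>, hence so does the
  total area of the tiles of the second kind.\<close>
lemma all_edges_on_grid:
  assumes N: "N > 2" and w: "w \<noteq> 0" and n: "n > 0" "4 * N dvd n"
    and T: "triangulates I A B C (regular_polygon N c w)"
    and sh: "\<And>i. i \<in> I \<Longrightarrow> triangle_shape (A i) (B i) (C i) (\<alpha> i) (\<beta> i) (\<gamma> i)"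
    and ab: "\<And>i. i \<in> I \<Longrightarrow> on_grid n (\<alpha> i) \<and> on_grid n (\<beta> i) \<and> on_grid n (\<gamma> i)"
    and i: "i \<in> I"
  shows "grid_direction n ((B i - A i) / w)"
proof (rule ccontr)
  assume bad: "\<not> grid_direction n ((B i - A i) / w)"
  define H where "H d X = (if grid_direction n (d / w) then 0 else area_potential d X)" for d X
  have H: "H (- d) X = H d X" for d X
    using grid_direction_minus[of n "d / w"] by (simp add: H_def area_potential_minus)
  have dir: "grid_direction n (sgn (y - x) / w) \<longleftrightarrow> grid_direction n ((y - x) / w)" if "x \<noteq> y" for x y
  proof -
    have "sgn (y - x) / w = of_real (1 / norm (y - x)) * ((y - x) / w)"
      by (simp add: sgn_eq)
    moreover have "(y - x) / w = of_real (norm (y - x)) * (sgn (y - x) / w)"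
      using that by (simp add: sgn_eq)
    ultimately show ?thesis using grid_direction_scale by metis
  qed
  have inc: "edge_increment H x y = (if grid_direction n ((y - x) / w) then 0 else orient x y 0)" if "x \<noteq> y" for x y
    using area_potential_diff[OF that] dir[OF that] by (simp add: edge_increment_def H_def)
  have tri: "edge_increment H (A i) (B i) + edge_increment H (B i) (C i) + edge_increment H (C i) (A i) =
      (if grid_direction n ((B i - A i) / w) then 0 else orient (A i) (B i) (C i))" if i: "i \<in> I" for i
  proof -
    note s = sh[OF i]
    have "orient (A i) (B i) (C i) > 0" using s by (simp add: triangle_shape_def)
    note ne = ccw_distinct[OF this]
    show ?thesis
      using inc[OF ne(1)] inc[OF ne(2)] inc[OF ne(3)] grid_direction_edges[OF s, of n w] ab[OF i]
        orient_sum[of "A i" "B i" 0 "C i"] by auto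
  qed
  have "(\<Sum>i\<in>I. if grid_direction n ((B i - A i) / w) then 0 else orient (A i) (B i) (C i)) =
     (\<Sum>j<N. edge_increment H (regular_vertex N c w j) (regular_vertex N c w (Suc j)))"
    using polygon_boundary_sum[where H = H, OF N w H T] tri by simp
  also have "\<dots> = 0"
  proof (rule sum.neutral, rule ballI)
    fix j assume "j \<in> {..<N}"
    show "edge_increment H (regular_vertex N c w j) (regular_vertex N c w (Suc j)) = 0"
    proof (cases "regular_vertex N c w j = regular_vertex N c w (Suc j)")
      case True
      then show ?thesis by (simp add: edge_increment_def)
    next
      case False
      then show ?thesis using inc[OF False] regular_edge_direction[of N w n c j] N w n by simp
    qed
  qed
  finally have s0: "(\<Sum>i\<in>I. if grid_direction n ((B i - A i) / w) then 0 else orient (A i) (B i) (C i)) = 0" .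
  have fin: "finite I" using T by (simp add: triangulates_def)
  have "(\<Sum>i\<in>I. if grid_direction n ((B i - A i) / w) then 0 else orient (A i) (B i) (C i)) > 0"
  proof (rule sum_pos2[OF fin i])
    show "0 < (if grid_direction n ((B i - A i) / w) then 0 else orient (A i) (B i) (C i))"
      using bad sh[OF i] by (simp add: triangle_shape_def)
    show "0 \<le> (if grid_direction n ((B i - A i) / w) then 0 else orient (A i) (B i) (C i))" if "i \<in> I" for i
      using sh[OF that] by (simp add: triangle_shape_def)
  qed
  then show False using s0 by simp
qed

text \<open>The \<open>k\<close>-th power turns the direction of a segment into the direction of its image; for odd \<open>k\<close> this does
  not depend on which of the two opposite directions is taken.\<close>
lemma semilinear_edge:
  assumes sl: "semilinear n k \<phi>" and k: "odd k" and g: "grid_direction n z" and z: "z \<noteq> 0"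
  shows "\<exists>t. \<phi> z = of_real t * sgn z ^ k"
proof -
  obtain r t where t: "on_grid n t" and zr: "z = of_real r * cis t" using g by (auto simp: grid_direction_def)
  have r0: "r \<noteq> 0" using z zr by auto
  have "sgn z = of_real (sgn r) * cis t"
    unfolding zr sgn_eq using r0 by (simp add: norm_mult sgn_if)
  then have "sgn z ^ k = of_real (sgn r) ^ k * cis (real k * t)"
    by (simp add: power_mult_distrib Complex.DeMoivre)
  also have "of_real (sgn r) ^ k = (of_real (sgn r) :: complex)" using k r0 by (simp add: sgn_if)
  finally have s: "sgn z ^ k = of_real (sgn r) * cis (real k * t)" .
  have "\<phi> z = cis (real k * t) * \<phi> (of_real r)"
    using semilinear_cis[OF sl t, of "of_real r"] by (simp add: zr mult.commute)
  also have "\<phi> (of_real r) = of_real (Re (\<phi> (of_real r)))"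
    using sl by (simp add: semilinear_def complex_eq_iff)
  finally have "\<phi> z = of_real (Re (\<phi> (of_real r)) * sgn r) * sgn z ^ k"
    unfolding s using r0 by (simp add: sgn_if)
  then show ?thesis by blast
qed

text \<open>The boundary sum for the angle subtended at the image of the vertex \<open>j\<close>, after a semilinear map has been
  applied. The image of the regular polygon is a star polygon.\<close>
lemma conjugate_angle_sum:
  fixes c w :: complex
  assumes N: "N > 2" and w: "w \<noteq> 0" and n: "n > 0" "4 * N dvd n"
    and T: "triangulates I A B C (regular_polygon N c w)"
    and grid: "\<And>i. i \<in> I \<Longrightarrow> grid_direction n ((B i - A i) / w) \<and> grid_direction n ((C i - B i) / w) \<and> grid_direction n ((A i - C i) / w)"
    and sl: "semilinear n k \<phi>" and k: "coprime k n" and phi1: "\<phi> 1 \<noteq> 0" and j: "j < N"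
  defines "f \<equiv> \<lambda>X. \<phi> ((X - c) / w) - \<phi> ((regular_vertex N c w j - c) / w)"
  shows "(\<Sum>i\<in>I. angle_sum (f (A i)) (f (B i)) (f (C i))) = pi * (1 - 2 * frac (real k / real N))"
proof -
  have ok: "odd k"
  proof
    assume "even k"
    moreover have "even n" using n by auto
    ultimately show False using k coprime_common_divisor by fastforce
  qed
  define H where "H d X = angle_potential (sgn (d / w) ^ k) (f X)" for d X
  have H: "H (- d) X = H d X" for d X
  proof -
    have "sgn (- d / w) = - sgn (d / w)" by (metis minus_divide_left sgn_minus)
    then show ?thesis using ok by (simp add: H_def angle_potential_minus)
  qed
  have inc: "edge_increment H x y = subtended (f x) (f y)" if xy: "x \<noteq> y" and g: "grid_direction n ((y - x) / w)" for x y
  proof -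
    define u where "u = sgn ((y - x) / w)"
    have su: "sgn (sgn (y - x) / w) = u"
    proof -
      have "sgn (y - x) / w = of_real (1 / norm (y - x)) * ((y - x) / w)" by (simp add: sgn_eq)
      then have "sgn (sgn (y - x) / w) = sgn (complex_of_real (1 / norm (y - x))) * u"
        unfolding u_def by (simp only: sgn_mult)
      also have "sgn (complex_of_real (1 / norm (y - x))) = 1" using xy by (simp add: sgn_eq norm_divide)
      finally show ?thesis by simp
    qed
    have "(y - x) / w \<noteq> 0" using xy w by simp
    then obtain t where t: "\<phi> ((y - x) / w) = of_real t * u ^ k"
      using semilinear_edge[OF sl ok g] unfolding u_def by blast
    have "(y - x) / w = (y - c) / w - (x - c) / w" by (simp add: diff_divide_distrib)
    then have "\<phi> ((y - c) / w) - \<phi> ((x - c) / w) = of_real t * u ^ k"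
      using t semilinear_diff(1)[OF sl] by metis
    then have "f y = f x + of_real t * u ^ k"
      by (simp add: f_def algebra_simps)
    moreover have "u ^ k \<noteq> 0" using xy w by (simp add: u_def sgn_zero_iff)
    ultimately show ?thesis
      using angle_potential_diff[of "u ^ k" "f y" "f x" t] unfolding edge_increment_def H_def su by simp
  qed
  have tri: "edge_increment H (A i) (B i) + edge_increment H (B i) (C i) + edge_increment H (C i) (A i) =
      angle_sum (f (A i)) (f (B i)) (f (C i))" if i: "i \<in> I" for i
  proof -
    have "orient (A i) (B i) (C i) > 0" using T i by (simp add: triangulates_def)
    note ne = ccw_distinct[OF this]
    show ?thesis using inc[OF ne(1)] inc[OF ne(2)] inc[OF ne(3)] grid[OF i] by (simp add: angle_sum_def)
  qed
  obtain q where q: "n = 4 * N * q" using n by blast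
  have q0: "q > 0" using n q by (auto intro: gr0I)
  have fV: "f (regular_vertex N c w i) = \<phi> 1 * (star_vertex N k i - star_vertex N k j)" for i
  proof -
    have *: "\<phi> ((regular_vertex N c w i - c) / w) = \<phi> 1 * star_vertex N k i" for i
    proof -
      have "2 * pi * real i / real N = 2 * pi * of_int (int (4 * i * q)) / real n"
        using N q0 unfolding q by simp
      then have "on_grid n (2 * pi * real i / real N)" unfolding on_grid_def by blast
      from semilinear_cis[OF sl this, of 1]
      have "\<phi> (cis (2 * pi * real i / real N)) = cis (real k * (2 * pi * real i / real N)) * \<phi> 1" by simp
      moreover have "(regular_vertex N c w i - c) / w = cis (2 * pi * real i / real N)"
        using w by (simp add: regular_vertex_def)
      moreover have "real k * (2 * pi * real i / real N) = 2 * pi * (real k * real i / real N)" by simp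
      ultimately show ?thesis unfolding star_vertex_def by (metis mult.commute)
    qed
    show ?thesis unfolding f_def * by (simp add: algebra_simps)
  qed
  have kN: "coprime k N" using k q by auto
  have "(\<Sum>i\<in>I. angle_sum (f (A i)) (f (B i)) (f (C i))) =
     (\<Sum>i<N. edge_increment H (regular_vertex N c w i) (regular_vertex N c w (Suc i)))"
    using polygon_boundary_sum[where H = H, OF N w H T] tri by simp
  also have "\<dots> = (\<Sum>i<N. subtended (star_vertex N k i - star_vertex N k j)
      (star_vertex N k (Suc i) - star_vertex N k j))"
  proof (rule sum.cong)
    fix i
    have "subtended (f (regular_vertex N c w i)) (f (regular_vertex N c w (Suc i))) =
      subtended (star_vertex N k i - star_vertex N k j)
      (star_vertex N k (Suc i) - star_vertex N k j)"
      unfolding fV by (rule subtended_scale[OF phi1])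
    moreover have "edge_increment H (regular_vertex N c w i) (regular_vertex N c w (Suc i)) =
      subtended (f (regular_vertex N c w i)) (f (regular_vertex N c w (Suc i)))"
    proof (rule inc)
      show "regular_vertex N c w i \<noteq> regular_vertex N c w (Suc i)"
      proof
        assume "regular_vertex N c w i = regular_vertex N c w (Suc i)"
        then have "cis (2 * pi * real i / real N) = cis (2 * pi * real i / real N + 2 * pi / real N)"
          using w by (simp add: regular_vertex_def add_divide_distrib ring_distribs add.commute)
        then have "cis (2 * pi / real N) = 1" by (simp add: cis_mult[symmetric])
        then obtain m :: int where "2 * pi / real N = 2 * pi * of_int m" using cis_eq_1_iff_int by blast
        then have "1 = real N * of_int m" using N by (simp add: field_simps)
        then have "1 = int N * m" by (metis of_int_1 of_int_eq_iff of_int_mult of_int_of_nat_eq)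
        then have "int N dvd 1" by (rule dvdI)
        then show False using N by simp
      qed
      show "grid_direction n ((regular_vertex N c w (Suc i) - regular_vertex N c w i) / w)"
        using regular_edge_direction[of N w n c i] N w n by simp
    qed
    ultimately show "edge_increment H (regular_vertex N c w i) (regular_vertex N c w (Suc i)) =
      subtended (star_vertex N k i - star_vertex N k j)
      (star_vertex N k (Suc i) - star_vertex N k j)" by simp
  qed simp
  also have "\<dots> = pi * (1 - 2 * frac (real k / real N))" by (rule star_polygon_angle[OF N kN j])
  finally show ?thesis .
qed

lemma cis_pi_frac:
  assumes "frac y > 0"
  shows "cis (pi * y) = of_real (sin (pi * y) / sin (pi * frac y)) * cis (pi * frac y)"
proof -
  have s: "sin (pi * frac y) > 0" using assms frac_lt_1[of y] by (intro sin_gt_zero) auto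
  have y: "pi * y = pi * frac y + pi * of_int \<lfloor>y\<rfloor>" by (simp add: frac_def algebra_simps)
  have "sin (pi * of_int \<lfloor>y\<rfloor>) = 0" by (simp add: sin_zero_iff_int2 mult.commute)
  then have e: "sin (pi * y) = sin (pi * frac y) * cos (pi * of_int \<lfloor>y\<rfloor>)"
    "cis (pi * y) = of_real (cos (pi * of_int \<lfloor>y\<rfloor>)) * cis (pi * frac y)"
    unfolding y complex_eq_iff by (simp_all add: sin_add cos_add mult.commute)
  show ?thesis unfolding e(2) e(1) using s by simp
qed

text \<open>A semilinear map takes a triangle to a triangle with the angles \<open>k \<alpha>\<close>, \<open>k \<beta>\<close>, \<open>k \<gamma>\<close> up to sign and
  multiples of \<open>\<pi>\<close>, the orientation of which depends only on these angles. If it is positive, then the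
  angles of the image are \<open>\<pi>\<close> times the fractional parts of \<open>k \<alpha> / \<pi>\<close>, \<open>k \<beta> / \<pi>\<close>, \<open>k \<gamma> / \<pi>\<close>.\<close>
lemma conjugate_triangle:
  fixes A B C c w z0 :: complex
  assumes sh: "triangle_shape A B C \<alpha> \<beta> \<gamma>" and g: "on_grid n \<alpha>" "on_grid n \<beta>" "on_grid n \<gamma>"
    and sl: "semilinear n k \<phi>" and nz: "sin (real k * \<alpha>) \<noteq> 0" "sin (real k * \<beta>) \<noteq> 0" "sin (real k * \<gamma>) \<noteq> 0"
    and p: "\<phi> ((B - A) / w) \<noteq> 0"
  defines "f \<equiv> \<lambda>X. \<phi> ((X - c) / w) - z0"
  shows "sgn (orient (f A) (f B) (f C)) = sgn (sin (real k * \<alpha>) * sin (real k * \<beta>) * sin (real k * \<gamma>))"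
    and "f A = 0 \<Longrightarrow> sin (real k * \<alpha>) * sin (real k * \<beta>) * sin (real k * \<gamma>) > 0 \<Longrightarrow> frac (real k * \<alpha> / pi) > 0 \<Longrightarrow>
       angle_sum (f A) (f B) (f C) = pi * frac (real k * \<alpha> / pi)"
proof -
  define P where "P = \<phi> ((B - A) / w)"
  define \<rho> where "\<rho> = sin (real k * \<beta>) / sin (real k * \<gamma>)"
  have diff: "f Y - f X = \<phi> ((Y - X) / w)" for X Y
  proof -
    have "(Y - X) / w = (Y - c) / w - (X - c) / w" by (simp add: diff_divide_distrib)
    then show ?thesis using semilinear_diff(1)[OF sl] by (simp add: f_def)
  qed
  have two_sin: "\<phi> (of_real (2 * sin t) * (\<i> * y)) = of_real (2 * sin (real k * t)) * (\<i> * \<phi> y)" if t: "on_grid n t" for t y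
  proof -
    have s2: "of_real (2 * sin t) * \<i> = cis t - cis (- t)" for t by (simp add: complex_eq_iff)
    have "\<phi> (of_real (2 * sin t) * (\<i> * y)) = \<phi> (cis t * y - cis (- t) * y)"
      using s2[of t] by (simp add: mult.assoc[symmetric] left_diff_distrib)
    also have "\<dots> = cis (real k * t) * \<phi> y - cis (real k * - t) * \<phi> y"
      unfolding semilinear_diff(1)[OF sl] semilinear_cis[OF sl t] semilinear_cis[OF sl on_grid_minus[OF t]] ..
    also have "\<dots> = (cis (real k * t) - cis (- (real k * t))) * \<phi> y" by (simp add: left_diff_distrib)
    also have "\<dots> = of_real (2 * sin (real k * t)) * (\<i> * \<phi> y)"
      unfolding s2[symmetric] by (simp add: mult.assoc)
    finally show ?thesis .
  qed
  have e: "of_real (sin \<gamma>) * (C - A) = of_real (sin \<beta>) * cis \<alpha> * (B - A)"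
    using sh by (simp add: triangle_shape_def)
  then have "of_real (2 * sin \<gamma>) * (\<i> * ((C - A) / w)) = of_real (2 * sin \<beta>) * (\<i> * (cis \<alpha> * ((B - A) / w)))"
    by (simp add: divide_inverse)
  then have "of_real (2 * sin (real k * \<gamma>)) * (\<i> * \<phi> ((C - A) / w)) = of_real (2 * sin (real k * \<beta>)) * (\<i> * (cis (real k * \<alpha>) * P))"
    using two_sin[OF g(3)] two_sin[OF g(2)] semilinear_cis[OF sl g(1)] unfolding P_def by metis
  then have "\<phi> ((C - A) / w) = of_real \<rho> * cis (real k * \<alpha>) * P"
    unfolding \<rho>_def using nz by (simp add: field_simps)
  then have fC: "f C - f A = of_real \<rho> * cis (real k * \<alpha>) * P" using diff by simp
  have fB: "f B - f A = P" using diff by (simp add: P_def)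
  have "cnj P * (of_real \<rho> * cis (real k * \<alpha>) * P) = of_real \<rho> * cis (real k * \<alpha>) * of_real ((norm P)\<^sup>2)"
    unfolding complex_norm_square by (simp add: mult_ac)
  then have "Im (cnj P * (of_real \<rho> * cis (real k * \<alpha>) * P)) = Im (of_real \<rho> * cis (real k * \<alpha>) * of_real ((norm P)\<^sup>2))"
    by (rule arg_cong)
  then have or: "orient (f A) (f B) (f C) = (norm P)\<^sup>2 * (\<rho> * sin (real k * \<alpha>))"
    unfolding orient_def fB fC by simp
  have nP: "(norm P)\<^sup>2 > 0" using p by (simp add: P_def)
  have sr: "sgn \<rho> = sgn (sin (real k * \<beta>)) * sgn (sin (real k * \<gamma>))"
    by (simp add: \<rho>_def sgn_divide)
  show sg: "sgn (orient (f A) (f B) (f C)) = sgn (sin (real k * \<alpha>) * sin (real k * \<beta>) * sin (real k * \<gamma>))"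
    unfolding or using nP by (simp add: sgn_mult sr mult_ac)
  assume fA: "f A = 0" and s: "sin (real k * \<alpha>) * sin (real k * \<beta>) * sin (real k * \<gamma>) > 0"
    and fr: "frac (real k * \<alpha> / pi) > 0"
  define y where "y = real k * \<alpha> / pi"
  have ky: "real k * \<alpha> = pi * y" by (simp add: y_def)
  have "f B = P" "f C = of_real \<rho> * cis (real k * \<alpha>) * P" using fA fB fC by simp_all
  then have "f C / f B = of_real \<rho> * cis (pi * y)" using p by (simp add: P_def ky)
  also have "\<dots> = of_real (\<rho> * sin (pi * y) / sin (pi * frac y)) * cis (pi * frac y)"
    by (subst cis_pi_frac) (use fr y_def in auto)
  finally have q: "f C / f B = of_real (\<rho> * sin (pi * y) / sin (pi * frac y)) * cis (pi * frac y)" .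
  have f01: "0 < frac y" "frac y < 1" using fr frac_lt_1 by (auto simp: y_def)
  have "sgn (orient (f A) (f B) (f C)) = 1" using sg s by simp
  then have "(norm P)\<^sup>2 * (\<rho> * sin (pi * y)) > 0" unfolding or ky by (simp add: sgn_1_pos)
  then have "\<rho> * sin (pi * y) > 0" using nP by (simp add: zero_less_mult_iff)
  moreover have "sin (pi * frac y) > 0" using f01 by (intro sin_gt_zero) auto
  ultimately have "\<rho> * sin (pi * y) / sin (pi * frac y) > 0" by simp
  moreover have "\<bar>pi * frac y\<bar> < pi" using f01 by simp
  ultimately have "subtended (f B) (f C) = pi * frac y" using q by (intro subtended_polar)
  then show "angle_sum (f A) (f B) (f C) = pi * frac (real k * \<alpha> / pi)"
    by (simp add: angle_sum_def fA y_def)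
qed


lemma conjugate_triangle_all:
  fixes A B C c w z0 :: complex
  assumes sh: "triangle_shape A B C \<alpha> \<beta> \<gamma>" and g: "on_grid n \<alpha>" "on_grid n \<beta>" "on_grid n \<gamma>"
    and sl: "semilinear n k \<phi>"
    and nz: "sin (real k * \<alpha>) * sin (real k * \<beta>) * sin (real k * \<gamma>) > 0"
    and fr: "frac (real k * \<alpha> / pi) > 0" "frac (real k * \<beta> / pi) > 0" "frac (real k * \<gamma> / pi) > 0"
    and p: "\<phi> ((B - A) / w) \<noteq> 0" "\<phi> ((C - B) / w) \<noteq> 0" "\<phi> ((A - C) / w) \<noteq> 0"
  defines "f \<equiv> \<lambda>X. \<phi> ((X - c) / w) - z0"
  shows "orient (f A) (f B) (f C) > 0"
    and "f A = 0 \<Longrightarrow> angle_sum (f A) (f B) (f C) = pi * frac (real k * \<alpha> / pi)"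
    and "f B = 0 \<Longrightarrow> angle_sum (f A) (f B) (f C) = pi * frac (real k * \<beta> / pi)"
    and "f C = 0 \<Longrightarrow> angle_sum (f A) (f B) (f C) = pi * frac (real k * \<gamma> / pi)"
proof -
  have n0: "sin (real k * \<alpha>) \<noteq> 0" "sin (real k * \<beta>) \<noteq> 0" "sin (real k * \<gamma>) \<noteq> 0" using nz by auto
  note sh2 = triangle_shape_rotate[OF sh]
  note sh3 = triangle_shape_rotate[OF sh2]
  have nz2: "sin (real k * \<beta>) * sin (real k * \<gamma>) * sin (real k * \<alpha>) > 0"
    and nz3: "sin (real k * \<gamma>) * sin (real k * \<alpha>) * sin (real k * \<beta>) > 0" using nz by (simp_all add: mult_ac)
  have fX: "f X = \<phi> ((X - c) / w) - z0" for X by (simp add: f_def)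
  note c1 = conjugate_triangle[OF sh g sl n0 p(1), of c z0, folded fX]
  note c2 = conjugate_triangle[OF sh2 g(2,3,1) sl n0(2,3,1) p(2), of c z0, folded fX]
  note c3 = conjugate_triangle[OF sh3 g(3,1,2) sl n0(3,1,2) p(3), of c z0, folded fX]
  have "sgn (orient (f A) (f B) (f C)) = 1" unfolding c1(1) using nz by (simp add: sgn_1_pos)
  then show "orient (f A) (f B) (f C) > 0" by (simp add: sgn_1_pos)
  show "f A = 0 \<Longrightarrow> angle_sum (f A) (f B) (f C) = pi * frac (real k * \<alpha> / pi)" using c1(2) nz fr by blast
  show "f B = 0 \<Longrightarrow> angle_sum (f A) (f B) (f C) = pi * frac (real k * \<beta> / pi)"
    using c2(2) nz2 fr angle_sum_rotate by metis
  show "f C = 0 \<Longrightarrow> angle_sum (f A) (f B) (f C) = pi * frac (real k * \<gamma> / pi)"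
    using c3(2) nz3 fr angle_sum_rotate by metis
qed

text \<open>The images of the tiles all have the same orientation. It is that of the star polygon, because otherwise all
  the summands of a positive sum would be nonpositive.\<close>
lemma conjugate_sign_positive:
  fixes A B C :: "'i \<Rightarrow> complex" and c w :: complex
  assumes N: "N > 2" and w: "w \<noteq> 0" and n: "n > 0" "4 * N dvd n"
    and T: "triangulates I A B C (regular_polygon N c w)"
    and grid: "\<And>i. i \<in> I \<Longrightarrow> grid_direction n ((B i - A i) / w) \<and> grid_direction n ((C i - B i) / w) \<and> grid_direction n ((A i - C i) / w)"
    and sh: "\<And>i. i \<in> I \<Longrightarrow> triangle_shape (A i) (B i) (C i) (\<alpha> i) (\<beta> i) (\<gamma> i)"
    and ab: "\<And>i. i \<in> I \<Longrightarrow> on_grid n (\<alpha> i) \<and> on_grid n (\<beta> i) \<and> on_grid n (\<gamma> i)"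
    and same: "\<And>i. i \<in> I \<Longrightarrow> sin (real k * \<alpha> i) * sin (real k * \<beta> i) * sin (real k * \<gamma> i) = s" and s: "s \<noteq> 0"
    and sl: "semilinear n k \<phi>" and k: "coprime k n" and phi1: "\<phi> 1 \<noteq> 0"
    and p: "\<And>i. i \<in> I \<Longrightarrow> \<phi> ((B i - A i) / w) \<noteq> 0"
    and half: "frac (real k / real N) < 1 / 2"
  shows "s > 0"
proof (rule ccontr)
  assume "\<not> s > 0"
  then have neg: "s < 0" using s by simp
  define f where "f X = \<phi> ((X - c) / w) - \<phi> ((regular_vertex N c w 0 - c) / w)" for X
  have "angle_sum (f (A i)) (f (B i)) (f (C i)) \<le> 0" if i: "i \<in> I" for i
  proof (rule angle_sum_cw)
    have n0: "sin (real k * \<alpha> i) \<noteq> 0" "sin (real k * \<beta> i) \<noteq> 0" "sin (real k * \<gamma> i) \<noteq> 0"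
      using same[OF i] s by auto
    have "sgn (orient (f (A i)) (f (B i)) (f (C i))) = sgn s"
      using conjugate_triangle(1)[OF sh[OF i] _ _ _ sl n0 p[OF i], of c] ab[OF i] same[OF i] unfolding f_def by simp
    then show "orient (f (A i)) (f (B i)) (f (C i)) < 0" using neg by (simp add: sgn_1_neg)
  qed
  then have "(\<Sum>i\<in>I. angle_sum (f (A i)) (f (B i)) (f (C i))) \<le> 0" by (rule sum_nonpos)
  moreover have "(\<Sum>i\<in>I. angle_sum (f (A i)) (f (B i)) (f (C i))) = pi * (1 - 2 * frac (real k / real N))"
    unfolding f_def using conjugate_angle_sum[OF N w n T grid sl k phi1, of 0] N by simp
  moreover have "pi * (1 - 2 * frac (real k / real N)) > 0" using half by simp
  ultimately show False by linarith
qed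

text \<open>The angle of the triangle at its vertex \<open>V\<close>; for other points \<open>V\<close> the value is irrelevant.\<close>
definition vertex_angle :: "complex \<Rightarrow> complex \<Rightarrow> complex \<Rightarrow> complex \<Rightarrow> real" where
  "vertex_angle A B C V = (if V = A then angle_at B A C else if V = B then angle_at C B A else angle_at A C B)"

lemma triangle_vertices_unique:
  fixes A B C A' B' C' :: complex
  assumes "\<not> collinear {A, B, C}" "\<not> collinear {A', B', C'}"
    and e: "convex hull {A, B, C} = convex hull {A', B', C'}"
  shows "{A, B, C} = {A', B', C'}"
proof -
  have ext: "{x. x extreme_point_of (convex hull {a, b, c})} = {a, b, c}" if "\<not> collinear {a, b, c :: complex}" for a b c
  proof -
    have "\<not> affine_dependent {a, b, c}" using that collinear_3_eq_affine_dependent by blast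
    then show ?thesis using extreme_point_of_convex_hull_affine_independent by blast
  qed
  show ?thesis using ext[OF assms(1)] ext[OF assms(2)] unfolding e by simp
qed

lemma has_vertex_angle_iff:
  assumes ccw: "orient A B C > 0"
  shows "has_vertex_angle (convex hull {A, B, C}) V \<theta> \<longleftrightarrow> V \<in> {A, B, C} \<and> vertex_angle A B C V = \<theta>"
proof
  note ne = ccw_distinct[OF ccw]
  have nc: "\<not> collinear {A, B, C}" using ccw by (simp add: collinear_orient)
  {
    assume "has_vertex_angle (convex hull {A, B, C}) V \<theta>"
    then obtain B' C' where nc': "\<not> collinear {V, B', C'}" and e: "convex hull {A, B, C} = convex hull {V, B', C'}"
      and a: "angle_at B' V C' = \<theta>" unfolding has_vertex_angle_def by blast
    have s: "{A, B, C} = {V, B', C'}" using triangle_vertices_unique[OF nc nc' e] .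
    have d: "V \<noteq> B'" "V \<noteq> C'" "B' \<noteq> C'" using nc' collinear_3_eq_affine_dependent by blast+
    have "V = A \<and> {B', C'} = {B, C} \<or> V = B \<and> {B', C'} = {A, C} \<or> V = C \<and> {B', C'} = {A, B}"
    proof -
      have "V \<in> {A, B, C}" unfolding s by simp
      moreover have "{B', C'} = {A, B, C} - {V}" unfolding s using d by auto
      moreover have "{A, B, C} - {A} = {B, C}" "{A, B, C} - {B} = {A, C}" "{A, B, C} - {C} = {A, B}"
        using ne by auto
      ultimately show ?thesis by auto
    qed
    then show "V \<in> {A, B, C} \<and> vertex_angle A B C V = \<theta>"
      using a ne angle_at_commute by (auto simp: vertex_angle_def doubleton_eq_iff)
  }
  assume *: "V \<in> {A, B, C} \<and> vertex_angle A B C V = \<theta>"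
  have sets: "{B, C, A} = {A, B, C}" "{C, A, B} = {A, B, C}" by auto
  consider "V = A" | "V = B" | "V = C" using * by blast
  then show "has_vertex_angle (convex hull {A, B, C}) V \<theta>"
  proof cases
    case 1
    then show ?thesis unfolding has_vertex_angle_def
      using * nc ne by (intro exI[of _ B] exI[of _ C]) (auto simp: vertex_angle_def)
  next
    case 2
    then show ?thesis unfolding has_vertex_angle_def
      using * nc ne by (intro exI[of _ C] exI[of _ A]) (auto simp: vertex_angle_def sets)
  next
    case 3
    then show ?thesis unfolding has_vertex_angle_def
      using * nc ne by (intro exI[of _ A] exI[of _ B]) (auto simp: vertex_angle_def sets)
  qed
qed

lemma ccw_representation:
  assumes "triangle_with_angles \<alpha> \<beta> \<gamma> t"
  shows "\<exists>A B C. t = convex hull {A, B, C} \<and> orient A B C > 0 \<and>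
     {#angle_at B A C, angle_at C B A, angle_at A C B#} = {#\<alpha>, \<beta>, \<gamma>#}"
proof -
  obtain A B C where nc: "\<not> collinear {A, B, C}" and t: "t = convex hull {A, B, C}"
    and a: "angle_at B A C = \<alpha>" "angle_at C B A = \<beta>" "angle_at A C B = \<gamma>"
    using assms unfolding triangle_with_angles_def by blast
  show ?thesis
  proof (cases "orient A B C > 0")
    case True
    then show ?thesis using t a by blast
  next
    case False
    moreover have "orient A B C \<noteq> 0" using nc by (simp add: collinear_orient)
    moreover have "orient A C B = - orient A B C" by (simp add: orient_def algebra_simps)
    ultimately have "orient A C B > 0" by simp
    moreover have "{#angle_at C A B, angle_at B C A, angle_at A B C#} = {#\<alpha>, \<beta>, \<gamma>#}"
      using a angle_at_commute by (metis add_mset_commute)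
    moreover have "t = convex hull {A, C, B}" using t by (simp add: insert_commute)
    ultimately show ?thesis by blast
  qed
qed

text \<open>The vertices of the polygon are extreme points, as they lie on the circumscribed circle.\<close>
lemma regular_vertex_of_tile:
  assumes V: "V = regular_vertex N c w j" and t: "convex hull {A, B, C} \<subseteq> regular_polygon N c w"
    and Vt: "V \<in> convex hull {A, B, C}"
  shows "V \<in> {A, B, C}"
proof -
  have P: "regular_polygon N c w \<subseteq> cball c (norm w)"
    unfolding regular_polygon_def
    by (rule hull_minimal) (auto simp: regular_vertex_def dist_norm norm_mult)
  have Vd: "dist c V = norm w" by (simp add: V regular_vertex_def dist_norm norm_mult)
  have "V extreme_point_of (convex hull {A, B, C})"
    unfolding extreme_point_of_def
  proof (intro conjI ballI Vt notI)
    fix a b assume "a \<in> convex hull {A, B, C}" "b \<in> convex hull {A, B, C}" and o: "V \<in> open_segment a b"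
    then have "dist c a \<le> norm w" "dist c b \<le> norm w" using t P by auto
    then show False using dist_decreases_open_segment[OF o, of c] Vd by auto
  qed
  then show ?thesis by (rule extreme_point_of_convex_hull)
qed

lemma mset_three_contains_one:
  assumes "x \<in># {#a, b, c#}"
  shows "\<exists>y z. {#x, y, z#} = {#a, b, c#}"
proof -
  obtain M where M: "{#a, b, c#} = add_mset x M" using assms by (metis insert_DiffM)
  then have "size M = 2" by (metis add_2_eq_Suc' add_mset_eq_single diff_Suc_1 size_add_mset size_single One_nat_def Suc_1 add.commute plus_1_eq_Suc size_empty)
  then obtain y z where "M = {#y, z#}" by (rule mset_size_2)
  then show ?thesis using M by metis
qed

lemma mset_three_contains_two:
  assumes "x \<in># {#a, b, c#}" "y \<in># {#a, b, c#}" "x \<noteq> y"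
  shows "\<exists>z. {#x, y, z#} = {#a, b, c#}"
proof -
  obtain u v where uv: "{#x, u, v#} = {#a, b, c#}" using mset_three_contains_one[OF assms(1)] by blast
  then have "y = u \<or> y = v" using assms by (metis add_mset_eq_singleton_iff insert_iff set_mset_add_mset_insert set_mset_empty singletonD)
  then show ?thesis using uv by (metis add_mset_commute)
qed


lemma grid_angle:
  assumes g: "on_grid n t" and t: "0 < t" "t < pi" and n: "n > 0" and k: "coprime k n"
  shows "\<exists>u. t / pi = real u / real n" "frac (real k * t / pi) > 0" "sin (real k * t) \<noteq> 0"
proof -
  obtain m :: int where m: "t = 2 * pi * of_int m / real n" using g unfolding on_grid_def by blast
  have "m > 0" using t n m by (simp add: zero_less_mult_iff zero_less_divide_iff)
  then have u: "t / pi = real (nat (2 * m)) / real n" using m by simp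
  then show "\<exists>u. t / pi = real u / real n" by blast
  have "0 < t / pi" "t / pi < 1" using t by simp_all
  from frac_pos[OF n k this u] show fr: "frac (real k * t / pi) > 0" by simp
  show "sin (real k * t) \<noteq> 0"
  proof
    assume "sin (real k * t) = 0"
    then obtain m :: int where "real k * t = of_int m * pi" using sin_zero_iff_int2 by blast
    then have "real k * t / pi = of_int m" by simp
    then show False using fr by simp
  qed
qed

text \<open>The conjugate equations at a vertex. The images of the tiles contribute nonnegatively to the angle sum at
  the image of the vertex, so that those tiles with a vertex there give at most the angle of the star polygon.
  For \<open>k = 1\<close> the other tiles contribute nothing, which gives the equation at the vertex. Hence for general
  \<open>k\<close> the two sides of the conjugate inequality are congruent modulo integers, and they are equal.\<close>
lemma vertex_angle_sum_conjugate:
  fixes A B C :: "'i \<Rightarrow> complex" and c w :: complex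
  assumes N: "N > 2" and w: "w \<noteq> 0" and n: "n > 2" "4 * N dvd n"
    and T: "triangulates I A B C (regular_polygon N c w)"
    and ang: "\<And>i. i \<in> I \<Longrightarrow> {#angle_at (B i) (A i) (C i), angle_at (C i) (B i) (A i), angle_at (A i) (C i) (B i)#} = {#\<alpha>, \<beta>, \<gamma>#}"
    and grid: "on_grid n \<alpha>" "on_grid n \<beta>" "on_grid n \<gamma>" and j: "j < N"
  defines "V \<equiv> regular_vertex N c w j"
  defines "S \<equiv> {i \<in> I. V \<in> {A i, B i, C i}}"
  defines "\<theta> \<equiv> \<lambda>i. vertex_angle (A i) (B i) (C i) V"
  shows "(\<Sum>i\<in>S. \<theta> i) = pi * (1 - 2 / real N)"
    and "coprime k n \<Longrightarrow> frac (real k / real N) < 1 / 2 \<Longrightarrow>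
      (\<Sum>i\<in>S. frac (real k * (\<theta> i / pi))) = 1 - 2 * frac (real k / real N)"
proof -
  have n0: "n > 0" using n by simp
  have fin: "finite I" and ccw: "\<And>i. i \<in> I \<Longrightarrow> orient (A i) (B i) (C i) > 0"
    and un: "(\<Union>i\<in>I. convex hull {A i, B i, C i}) = regular_polygon N c w"
    using T by (simp_all add: triangulates_def)
  have SI: "S \<subseteq> I" by (auto simp: S_def)
  have "c \<in> regular_polygon N c w" using centre_in_polygon[of N c w] N by simp
  then have "I \<noteq> {}" using un by auto
  then obtain i0 where i0: "i0 \<in> I" by blast
  define a b d where "a i = angle_at (B i) (A i) (C i)" and "b i = angle_at (C i) (B i) (A i)"
    and "d i = angle_at (A i) (C i) (B i)" for i
  have abd: "{#a i, b i, d i#} = {#\<alpha>, \<beta>, \<gamma>#}" if "i \<in> I" for i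
    using ang[OF that] by (simp add: a_def b_def d_def)
  have sh: "triangle_shape (A i) (B i) (C i) (a i) (b i) (d i)" if "i \<in> I" for i
    using triangle_shape_angles[OF ccw[OF that]] by (simp add: a_def b_def d_def)
  have mem: "a i \<in> {\<alpha>, \<beta>, \<gamma>}" "b i \<in> {\<alpha>, \<beta>, \<gamma>}" "d i \<in> {\<alpha>, \<beta>, \<gamma>}" if "i \<in> I" for i
  proof -
    have "set_mset {#a i, b i, d i#} = {\<alpha>, \<beta>, \<gamma>}" unfolding abd[OF that] by simp
    then show "a i \<in> {\<alpha>, \<beta>, \<gamma>}" "b i \<in> {\<alpha>, \<beta>, \<gamma>}" "d i \<in> {\<alpha>, \<beta>, \<gamma>}" by auto
  qed
  have gr: "on_grid n (a i) \<and> on_grid n (b i) \<and> on_grid n (d i)" if "i \<in> I" for i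
    using mem[OF that] grid by auto
  have rng: "0 < a i" "a i < pi" "0 < b i" "b i < pi" "0 < d i" "d i < pi" if "i \<in> I" for i
    using sh[OF that] unfolding triangle_shape_def by auto
  have dirs: "grid_direction n ((B i - A i) / w) \<and> grid_direction n ((C i - B i) / w) \<and> grid_direction n ((A i - C i) / w)"
    if i: "i \<in> I" for i
    using all_edges_on_grid[OF N w n0 n(2) T sh gr i] grid_direction_edges[OF sh[OF i], of n w] gr[OF i] by blast
  have th: "\<theta> i \<in> {a i, b i, d i}" for i by (simp add: \<theta>_def vertex_angle_def a_def b_def d_def)
  have th_rng: "0 < \<theta> i" "\<theta> i < pi" "on_grid n (\<theta> i)" if "i \<in> S" for i
    using th[of i] rng[of i] gr[of i] SI that by auto
  have at: "\<theta> i = a i" if "V = A i" for i using that by (simp add: \<theta>_def vertex_angle_def a_def)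
  have bt: "\<theta> i = b i" if "V = B i" "i \<in> I" for i
    using that ccw_distinct[OF ccw[OF that(2)]] by (simp add: \<theta>_def vertex_angle_def b_def)
  have dt: "\<theta> i = d i" if "V = C i" "i \<in> I" for i
    using that ccw_distinct[OF ccw[OF that(2)]] by (auto simp: \<theta>_def vertex_angle_def d_def)

  define f where "f \<phi> X = \<phi> ((X - c) / w) - \<phi> ((V - c) / w)" for \<phi> :: "complex \<Rightarrow> complex" and X
  define F where "F \<phi> i = angle_sum (f \<phi> (A i)) (f \<phi> (B i)) (f \<phi> (C i))" for \<phi> i
  have conj: "(\<forall>i\<in>I. F \<phi> i \<ge> 0) \<and> (\<forall>i\<in>I. orient (f \<phi> (A i)) (f \<phi> (B i)) (f \<phi> (C i)) > 0)
     \<and> (\<forall>i\<in>S. F \<phi> i = pi * frac (real k * \<theta> i / pi))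
     \<and> (\<Sum>i\<in>I. F \<phi> i) = pi * (1 - 2 * frac (real k / real N))"
    if k: "coprime k n" and half: "frac (real k / real N) < 1 / 2" and sl: "semilinear n k \<phi>"
      and nz: "\<phi> 1 \<noteq> 0" "\<And>i. i \<in> I \<Longrightarrow> \<phi> ((B i - A i) / w) \<noteq> 0 \<and> \<phi> ((C i - B i) / w) \<noteq> 0 \<and> \<phi> ((A i - C i) / w) \<noteq> 0"
    for k \<phi>
  proof -
    define s where "s = sin (real k * \<alpha>) * sin (real k * \<beta>) * sin (real k * \<gamma>)"
    have same: "sin (real k * a i) * sin (real k * b i) * sin (real k * d i) = s" if "i \<in> I" for i
      using arg_cong[OF abd[OF that], of "\<lambda>M. prod_mset (image_mset (\<lambda>x. sin (real k * x)) M)"]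
      by (simp add: s_def mult.assoc)
    have sn: "sin (real k * a i0) \<noteq> 0" "sin (real k * b i0) \<noteq> 0" "sin (real k * d i0) \<noteq> 0"
      using grid_angle(3)[OF _ _ _ n0 k] gr[OF i0] rng[OF i0] by blast+
    have s0: "s \<noteq> 0" unfolding same[OF i0, symmetric] using sn by simp
    have s: "s > 0"
      by (rule conjugate_sign_positive[OF N w n0 n(2) T dirs sh gr same s0 sl k nz(1) _ half]) (use nz(2) in auto)
    have fX: "f \<phi> X = \<phi> ((X - c) / w) - \<phi> ((V - c) / w)" for X by (simp add: f_def)
    have tri: "orient (f \<phi> (A i)) (f \<phi> (B i)) (f \<phi> (C i)) > 0"
      "i \<in> S \<Longrightarrow> F \<phi> i = pi * frac (real k * \<theta> i / pi)"
      if i: "i \<in> I" for i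
    proof -
      have fr: "frac (real k * a i / pi) > 0" "frac (real k * b i / pi) > 0" "frac (real k * d i / pi) > 0"
        using grid_angle(2)[OF _ _ _ n0 k] gr[OF i] rng[OF i] by blast+
      have g: "on_grid n (a i)" "on_grid n (b i)" "on_grid n (d i)" using gr[OF i] by blast+
      have pz: "\<phi> ((B i - A i) / w) \<noteq> 0" "\<phi> ((C i - B i) / w) \<noteq> 0" "\<phi> ((A i - C i) / w) \<noteq> 0" using nz(2)[OF i] by blast+
      have ss: "sin (real k * a i) * sin (real k * b i) * sin (real k * d i) > 0" using same[OF i] s by simp
      note ct = conjugate_triangle_all[OF sh[OF i] g sl ss fr pz, of c "\<phi> ((V - c) / w)", folded fX]
      show "orient (f \<phi> (A i)) (f \<phi> (B i)) (f \<phi> (C i)) > 0" by (rule ct(1))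
      have fV: "f \<phi> V = 0" by (simp add: f_def)
      assume "i \<in> S"
      then consider "V = A i" | "V = B i" | "V = C i" by (auto simp: S_def)
      then show "F \<phi> i = pi * frac (real k * \<theta> i / pi)"
      proof cases
        case 1
        show ?thesis unfolding F_def at[OF 1] by (rule ct(2)) (use 1 fV in metis)
      next
        case 2
        show ?thesis unfolding F_def bt[OF 2 i] by (rule ct(3)) (use 2 fV in metis)
      next
        case 3
        show ?thesis unfolding F_def dt[OF 3 i] by (rule ct(4)) (use 3 fV in metis)
      qed
    qed
    have "(\<Sum>i\<in>I. F \<phi> i) = pi * (1 - 2 * frac (real k / real N))"
      using conjugate_angle_sum[OF N w n0 n(2) T dirs sl k nz(1) j] unfolding F_def f_def V_def .
    then show ?thesis
      using tri angle_sum_ccw(1) SI unfolding F_def by blast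
  qed

  show one: "(\<Sum>i\<in>S. \<theta> i) = pi * (1 - 2 / real N)"
  proof -
    have f1: "frac (1 / real N) = 1 / real N" using N by (simp add: frac_eq)
    have half: "frac (real 1 / real N) < 1 / 2" using N by (simp add: f1)
    have nz: "(B i - A i) / w \<noteq> 0 \<and> (C i - B i) / w \<noteq> 0 \<and> (A i - C i) / w \<noteq> 0" if "i \<in> I" for i
      using ccw_distinct[OF ccw[OF that]] w by auto
    \<comment> \<open>for the identity, which is semilinear for \<open>k = 1\<close>, the tiles without a vertex at \<open>V\<close> contribute nothing\<close>
    define e where "e = f (\<lambda>z. z)"
    define G where "G = F (\<lambda>z. z)"
    have c1: "\<And>i. i \<in> I \<Longrightarrow> orient (e (A i)) (e (B i)) (e (C i)) > 0"
      "\<And>i. i \<in> S \<Longrightarrow> G i = pi * frac (real 1 * \<theta> i / pi)" "(\<Sum>i\<in>I. G i) = pi * (1 - 2 * frac (real 1 / real N))"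
      using conj[OF coprime_1_left half semilinear_id _ nz] unfolding e_def G_def by auto
    have "G i = \<theta> i" if "i \<in> S" for i
    proof -
      have "0 < \<theta> i / pi" "\<theta> i / pi < 1" using th_rng[OF that] by simp_all
      then have "frac (\<theta> i / pi) = \<theta> i / pi" by (simp add: frac_eq)
      then show ?thesis using c1(2)[OF that] by simp
    qed
    moreover have "G i = 0" if "i \<in> I - S" for i
    proof -
      have i: "i \<in> I" and nv: "V \<notin> {A i, B i, C i}" using that by (auto simp: S_def)
      have "V \<notin> convex hull {A i, B i, C i}"
      proof
        assume "V \<in> convex hull {A i, B i, C i}"
        moreover have "convex hull {A i, B i, C i} \<subseteq> regular_polygon N c w" using un i by blast
        ultimately have "V \<in> {A i, B i, C i}" using regular_vertex_of_tile V_def by metis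
        then show False using nv by blast
      qed
      then have out: "orient (A i) (B i) V < 0 \<or> orient (B i) (C i) V < 0 \<or> orient (C i) (A i) V < 0"
        using triangle_iff[OF ccw[OF i]] by (meson not_le)
      have tr: "orient X Y V < 0 \<longleftrightarrow> orient (e X) (e Y) 0 < 0" for X Y
      proof -
        have p: "X = V + w * e X" for X using w by (simp add: e_def f_def field_simps)
        have "orient X Y V = (norm w)\<^sup>2 * orient (e X) (e Y) 0"
          using orient_polar[of V w _ _ 0] p[of X] p[of Y] by (metis add.right_neutral mult_zero_right)
        then show ?thesis using w by (simp add: mult_less_0_iff)
      qed
      show ?thesis unfolding G_def F_def e_def[symmetric]
        by (rule angle_sum_ccw(2)[OF c1(1)[OF i]]) (use out tr in metis)
    qed
    ultimately have "(\<Sum>i\<in>S. \<theta> i) = (\<Sum>i\<in>I. G i)"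
      using SI fin by (intro sum.mono_neutral_cong_left) auto
    then show ?thesis using c1(3) f1 by simp
  qed

  assume k: "coprime k n" and half: "frac (real k / real N) < 1 / 2"
  \<comment> \<open>the vectors whose images have to be nonzero: then no tile and no side of the polygon degenerates\<close>
  define Z where "Z = {1} \<union> (\<lambda>i. (B i - A i) / w) ` I \<union> (\<lambda>i. (C i - B i) / w) ` I \<union> (\<lambda>i. (A i - C i) / w) ` I"
  have "finite Z" using fin by (simp add: Z_def)
  moreover have "0 \<notin> Z"
  proof
    assume "0 \<in> Z"
    then obtain i where "i \<in> I" "(B i - A i) / w = 0 \<or> (C i - B i) / w = 0 \<or> (A i - C i) / w = 0"
      unfolding Z_def by auto
    then show False using ccw_distinct[OF ccw[of i]] w by auto
  qed
  ultimately obtain \<phi> where \<phi>: "semilinear n k \<phi>" "\<forall>z\<in>Z. \<phi> z \<noteq> 0"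
    using semilinear_exists[OF n(1) k] by blast
  have nz: "\<phi> 1 \<noteq> 0" "\<And>i. i \<in> I \<Longrightarrow> \<phi> ((B i - A i) / w) \<noteq> 0 \<and> \<phi> ((C i - B i) / w) \<noteq> 0 \<and> \<phi> ((A i - C i) / w) \<noteq> 0"
    using \<phi>(2) by (auto simp: Z_def)
  note F = conj[OF k half \<phi>(1) nz]
  define X where "X = (\<Sum>i\<in>S. frac (real k * (\<theta> i / pi)))"
  have "pi * X = (\<Sum>i\<in>S. F \<phi> i)" unfolding X_def sum_distrib_left using F by (intro sum.cong) auto
  also have "\<dots> \<le> (\<Sum>i\<in>I. F \<phi> i)" using SI fin F by (intro sum_mono2) auto
  also have "\<dots> = pi * (1 - 2 * frac (real k / real N))" using F by blast
  finally have "X \<le> 1 - 2 * frac (real k / real N)" by simp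
  moreover have "X \<ge> 0" unfolding X_def by (intro sum_nonneg) simp
  \<comment> \<open>modulo integers, this is \<open>k\<close> times the equation for \<open>k = 1\<close>\<close>
  moreover have "\<exists>m::int. X - (1 - 2 * frac (real k / real N)) = of_int m"
  proof -
    have "X = (\<Sum>i\<in>S. real k * (\<theta> i / pi)) - of_int (\<Sum>i\<in>S. \<lfloor>real k * (\<theta> i / pi)\<rfloor>)"
      by (simp add: X_def frac_def sum_subtractf)
    also have "(\<Sum>i\<in>S. real k * (\<theta> i / pi)) = real k * ((\<Sum>i\<in>S. \<theta> i) / pi)"
      by (simp add: sum_distrib_left sum_divide_distrib)
    also have "\<dots> = real k - 2 * (real k / real N)" 
    proof -
      have *: "pi * (1 - 2 / real N) / pi = 1 - 2 / real N" by simp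
      show ?thesis unfolding one * by (simp add: algebra_simps)
    qed
    also have "real k / real N = frac (real k / real N) + of_int \<lfloor>real k / real N\<rfloor>" by (simp add: frac_def)
    finally have "X - (1 - 2 * frac (real k / real N)) = of_int (int k - 1 - 2 * \<lfloor>real k / real N\<rfloor> - (\<Sum>i\<in>S. \<lfloor>real k * (\<theta> i / pi)\<rfloor>))"
      by simp
    then show ?thesis by blast
  qed
  moreover have "frac (real k / real N) > 0"
  proof -
    have "N dvd n" using n(2) by (metis dvd_mult_right)
    then have kN: "coprime k N" using k by (metis coprime_divisors dvd_refl)
    have "k mod N \<noteq> 0"
    proof
      assume "k mod N = 0"
      then have "N dvd k" by auto
      then have "N dvd 1" using kN by (metis coprime_common_divisor dvd_refl)
      then show False using N by simp
    qed
    then show ?thesis using N by (simp add: frac_divide_nat)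
  qed
  ultimately obtain m :: int where m: "X - (1 - 2 * frac (real k / real N)) = of_int m" "of_int m \<le> (0::real)" "of_int m > (-1::real)"
    by (smt (verit))
  then have "m = 0" by linarith
  then have "X = 1 - 2 * frac (real k / real N)" using m(1) by (simp only: of_int_0 right_minus_eq)
  then show "(\<Sum>i\<in>S. frac (real k * (\<theta> i / pi))) = 1 - 2 * frac (real k / real N)" unfolding X_def .
qed


theorem theorem3:
  fixes N :: nat and c w :: complex and T :: "complex set set" and \<alpha> \<beta> \<gamma> :: real
  assumes "N > 6"
    and "w \<noteq> 0"
    and "is_tiling T (regular_polygon N c w)"
    and "\<And>t. t \<in> T \<Longrightarrow> triangle_with_angles \<alpha> \<beta> \<gamma> t"
    and "\<alpha> / pi \<in> \<rat>" and "\<beta> / pi \<in> \<rat>" and "\<gamma> / pi \<in> \<rat>"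
  shows "\<exists>a b d. {#a, b, d#} = {#\<alpha>, \<beta>, \<gamma>#} \<and>
    ((\<forall>j<N. vertex_equation T (regular_vertex N c w j) (regular_angle N) a b d 1 0 0) \<or>
     (\<forall>j<N. vertex_equation T (regular_vertex N c w j) (regular_angle N) a b d 1 1 0) \<or>
     (\<forall>j<N. vertex_equation T (regular_vertex N c w j) (regular_angle N) a b d 2 0 0))"
proof -
  have N: "N > 2" "N > 0" using assms(1) by auto
  obtain A B C where rep: "\<And>t. t \<in> T \<Longrightarrow> t = convex hull {A t, B t, C t} \<and> orient (A t) (B t) (C t) > 0 \<and>
     {#angle_at (B t) (A t) (C t), angle_at (C t) (B t) (A t), angle_at (A t) (C t) (B t)#} = {#\<alpha>, \<beta>, \<gamma>#}"
    using ccw_representation[OF assms(4)] by metis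
  have hull: "convex hull {A t, B t, C t} = t" and ccw: "orient (A t) (B t) (C t) > 0"
    and ang: "{#angle_at (B t) (A t) (C t), angle_at (C t) (B t) (A t), angle_at (A t) (C t) (B t)#} = {#\<alpha>, \<beta>, \<gamma>#}"
    if "t \<in> T" for t using rep[OF that] by simp_all
  have fin: "finite T" and un: "\<Union>T = regular_polygon N c w"
    and disj: "\<And>s t. s \<in> T \<Longrightarrow> t \<in> T \<Longrightarrow> s \<noteq> t \<Longrightarrow> interior s \<inter> interior t = {}"
    using assms(3) by (auto simp: is_tiling_def pairwise_def)
  have tri: "triangulates T A B C (regular_polygon N c w)"
    unfolding triangulates_def
  proof (intro conjI ballI impI allI notI)
    show "finite T" by (rule fin)
    show "orient (A t) (B t) (C t) > 0" if "t \<in> T" for t using ccw[OF that] .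
    show "(\<Union>t\<in>T. convex hull {A t, B t, C t}) = regular_polygon N c w"
      using hull un by simp
    show False if s: "s \<in> T" and t: "t \<in> T" and st: "s \<noteq> t" and z: "inside (A s) (B s) (C s) z \<and> inside (A t) (B t) (C t) z" for s t z
    proof -
      have "z \<in> interior s" using inside_interior[OF ccw[OF s]] z hull[OF s] by simp
      moreover have "z \<in> interior t" using inside_interior[OF ccw[OF t]] z hull[OF t] by simp
      ultimately show False using disj[OF s t st] by blast
    qed
  qed

  obtain p1 q1 where 1: "\<alpha> / pi = of_int p1 / real q1" "q1 \<noteq> 0" using assms(5) unfolding Rats_eq_int_div_nat by blast
  obtain p2 q2 where 2: "\<beta> / pi = of_int p2 / real q2" "q2 \<noteq> 0" using assms(6) unfolding Rats_eq_int_div_nat by blast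
  obtain p3 q3 where 3: "\<gamma> / pi = of_int p3 / real q3" "q3 \<noteq> 0" using assms(7) unfolding Rats_eq_int_div_nat by blast
  \<comment> \<open>the factor \<open>4 N\<close> makes the directions \<open>\<pi> / 2 + \<pi> / N + 2 \<pi> j / N\<close> of the sides of the polygon, relative to \<open>w\<close>, multiples of \<open>2 \<pi> / n\<close>\<close>
  define n where "n = 4 * N * (q1 * q2 * q3)"
  have n4: "4 * N dvd n" unfolding n_def by simp
  have np: "n > 0" using N 1 2 3 by (simp add: n_def)
  then have n2: "n > 2" using n4 N by (auto dest!: dvd_imp_le)
  have Nn: "N dvd n" using n4 by (metis dvd_mult_right)
  have grid: "on_grid n x" if "x / pi = of_int p / real q" "q \<noteq> 0" "n = 4 * N * (q * r)" for x p q r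
  proof -
    have "r \<noteq> 0" using np that by (auto intro: ccontr)
    have "x = pi * of_int p / real q" using that(1) by (simp add: field_simps)
    also have "\<dots> = 2 * pi * of_int (p * int (2 * N * r)) / real n"
      unfolding that(3) using N that(2) \<open>r \<noteq> 0\<close> by (simp add: field_simps)
    finally show ?thesis unfolding on_grid_def by blast
  qed
  have g: "on_grid n \<alpha>" "on_grid n \<beta>" "on_grid n \<gamma>"
    using grid[OF 1, of "q2 * q3"] grid[OF 2, of "q1 * q3"] grid[OF 3, of "q1 * q2"] by (simp_all add: n_def mult_ac)

  define V where "V = regular_vertex N c w"
  define S where "S j = {t \<in> T. V j \<in> {A t, B t, C t}}" for j
  define \<theta> where "\<theta> j t = vertex_angle (A t) (B t) (C t) (V j)" for j t
  define M where "M j = image_mset (\<lambda>t. \<theta> j t / pi) (mset_set (S j))" for j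
  have finS: "finite (S j)" for j using fin by (simp add: S_def)
  have sums: "(\<Sum>t\<in>S j. \<theta> j t) = pi * (1 - 2 / real N)"
    "coprime k n \<Longrightarrow> frac (real k / real N) < 1 / 2 \<Longrightarrow>
      (\<Sum>t\<in>S j. frac (real k * (\<theta> j t / pi))) = 1 - 2 * frac (real k / real N)" if "j < N" for j k
    using vertex_angle_sum_conjugate(1)[OF N(1) assms(2) n2 n4 tri ang g that]
      vertex_angle_sum_conjugate(2)[OF N(1) assms(2) n2 n4 tri ang g that, of k]
    unfolding S_def \<theta>_def V_def by auto
  have angles: "angle_at (B t) (A t) (C t) \<in> {\<alpha>, \<beta>, \<gamma>}" "angle_at (C t) (B t) (A t) \<in> {\<alpha>, \<beta>, \<gamma>}"
    "angle_at (A t) (C t) (B t) \<in> {\<alpha>, \<beta>, \<gamma>}" if "t \<in> T" for t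
  proof -
    have "set_mset {#angle_at (B t) (A t) (C t), angle_at (C t) (B t) (A t), angle_at (A t) (C t) (B t)#} = {\<alpha>, \<beta>, \<gamma>}"
      unfolding ang[OF that] by simp
    then show "angle_at (B t) (A t) (C t) \<in> {\<alpha>, \<beta>, \<gamma>}" "angle_at (C t) (B t) (A t) \<in> {\<alpha>, \<beta>, \<gamma>}"
      "angle_at (A t) (C t) (B t) \<in> {\<alpha>, \<beta>, \<gamma>}" by auto
  qed
  have th: "\<theta> j t \<in> {\<alpha>, \<beta>, \<gamma>}" if "t \<in> T" for j t
    using angles[OF that] by (simp add: \<theta>_def vertex_angle_def)
  have "c \<in> regular_polygon N c w" using centre_in_polygon[of N c w] N by simp
  then obtain t0 where t0: "t0 \<in> T" using un by blast
  have sh0: "triangle_shape (A t0) (B t0) (C t0) (angle_at (B t0) (A t0) (C t0)) (angle_at (C t0) (B t0) (A t0)) (angle_at (A t0) (C t0) (B t0))"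
    by (rule triangle_shape_angles[OF ccw[OF t0]])
  have pos: "0 < \<alpha>" "0 < \<beta>" "0 < \<gamma>"
  proof -
    have "\<forall>x\<in>#{#angle_at (B t0) (A t0) (C t0), angle_at (C t0) (B t0) (A t0), angle_at (A t0) (C t0) (B t0)#}. x > 0"
      using sh0 by (simp add: triangle_shape_def)
    then show "0 < \<alpha>" "0 < \<beta>" "0 < \<gamma>" unfolding ang[OF t0] by simp_all
  qed
  have sum_pi: "\<alpha> + \<beta> + \<gamma> = pi"
    using arg_cong[OF ang[OF t0], of sum_mset] sh0 by (simp add: triangle_shape_def add_ac)
  have range: "0 < x" "x < pi" "on_grid n x" if "x \<in> {\<alpha>, \<beta>, \<gamma>}" for x
    using that pos sum_pi g by auto

  have sys: "star_angle_system N n (M j)" if j: "j < N" for j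
    unfolding star_angle_system_def
  proof (intro conjI ballI allI impI)
    fix x assume "x \<in># M j"
    then obtain t where t: "t \<in> S j" "x = \<theta> j t / pi" using finS by (auto simp: M_def)
    then have m: "\<theta> j t \<in> {\<alpha>, \<beta>, \<gamma>}" using th by (simp add: S_def)
    show "0 < x" "x < 1" using range(1,2)[OF m] t by simp_all
    show "\<exists>u. x = real u / real n" unfolding t(2)
      by (rule grid_angle(1)[OF range(3)[OF m] range(1,2)[OF m] np coprime_1_left])
  next
    fix k assume "coprime k n \<and> frac (real k / real N) < 1 / 2"
    then have "(\<Sum>t\<in>S j. frac (real k * (\<theta> j t / pi))) = 1 - 2 * frac (real k / real N)" using sums(2)[OF j] by blast
    then show "(\<Sum>x\<in>#M j. frac (real k * x)) = 1 - 2 * frac (real k / real N)"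
      by (simp add: M_def multiset.map_comp comp_def sum_unfold_sum_mset)
  qed
  note sol = star_angle_system_solutions[OF sys assms(1) np Nn]
  have Msub: "set_mset (M j) \<subseteq> {\<alpha> / pi, \<beta> / pi, \<gamma> / pi}" for j
    using th[of _ j] finS by (auto simp: M_def S_def)
  have agree: "M j = M 0" if "j < N" for j
  proof (rule solutions_agree[of "\<alpha> / pi" "\<beta> / pi" "\<gamma> / pi" N "M j" "M 0" "M ` {..<N}"])
    show "\<alpha> / pi + \<beta> / pi + \<gamma> / pi = 1" using sum_pi by (simp flip: add_divide_distrib)
    show "M' = {#1 - 2 / real N#} \<or> M' = {#(1 - 2 / real N) / 2, (1 - 2 / real N) / 2#} \<or>
        (N = 10 \<and> (M' = {#1 / 10, 7 / 10#} \<or> M' = {#7 / 30, 17 / 30#}))" if "M' \<in> M ` {..<N}" for M'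
      using that sol by auto
  qed (use pos assms(1) Msub that in auto)

  have equation: "vertex_equation T (V j) (regular_angle N) a b d p q r"
    if j: "j < N" and M: "image_mset (\<lambda>x. x * pi) (M 0) = replicate_mset p a + replicate_mset q b + replicate_mset r d" for j a b d p q r
  proof -
    have "image_mset (\<lambda>x. x * pi) (M j) = image_mset (\<theta> j) (mset_set (S j))"
      by (simp add: M_def multiset.map_comp comp_def)
    then have MA: "image_mset (\<theta> j) (mset_set (S j)) = replicate_mset p a + replicate_mset q b + replicate_mset r d"
      using M agree[OF j] by simp
    have "card {t \<in> T. has_vertex_angle t (V j) x} = count (replicate_mset p a + replicate_mset q b + replicate_mset r d) x" for x
    proof -
      have "has_vertex_angle t (V j) x \<longleftrightarrow> V j \<in> {A t, B t, C t} \<and> \<theta> j t = x" if "t \<in> T" for t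
        using has_vertex_angle_iff[OF ccw[OF that], of "V j" x] unfolding hull[OF that] \<theta>_def .
      then have "{t \<in> T. has_vertex_angle t (V j) x} = {t \<in> S j. \<theta> j t = x}" by (auto simp: S_def)
      then show ?thesis unfolding MA[symmetric] by (simp only: count_image_mset_eq_card_vimage[OF finS])
    qed
    moreover have "real p * a + real q * b + real r * d = regular_angle N"
    proof -
      have "real p * a + real q * b + real r * d = sum_mset (image_mset (\<theta> j) (mset_set (S j)))"
        unfolding MA by simp
      also have "\<dots> = (\<Sum>t\<in>S j. \<theta> j t)" by (simp add: sum_unfold_sum_mset)
      also have "\<dots> = regular_angle N" unfolding sums(1)[OF j] regular_angle_def using N by (simp add: field_simps)
      finally show ?thesis .
    qed
    ultimately show ?thesis unfolding vertex_equation_def by blast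
  qed
  have mem: "x * pi \<in># {#\<alpha>, \<beta>, \<gamma>#}" if "x \<in># M 0" for x
    using Msub[of 0] that by auto
  have one: ?thesis if M0: "M 0 = {#x#}" for x
  proof -
    obtain b d where bd: "{#x * pi, b, d#} = {#\<alpha>, \<beta>, \<gamma>#}" using mset_three_contains_one[OF mem[of x]] M0 by auto
    have "vertex_equation T (V j) (regular_angle N) (x * pi) b d 1 0 0" if "j < N" for j
      by (rule equation[OF that]) (simp add: M0)
    then show ?thesis using bd unfolding V_def by blast
  qed
  have double: ?thesis if M0: "M 0 = {#x, x#}" for x
  proof -
    obtain b d where bd: "{#x * pi, b, d#} = {#\<alpha>, \<beta>, \<gamma>#}" using mset_three_contains_one[OF mem[of x]] M0 by auto
    have "vertex_equation T (V j) (regular_angle N) (x * pi) b d 2 0 0" if "j < N" for j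
      by (rule equation[OF that]) (simp add: M0 numeral_2_eq_2)
    then show ?thesis using bd unfolding V_def by blast
  qed
  have two: ?thesis if M0: "M 0 = {#x, y#}" and xy: "x \<noteq> y" for x y
  proof -
    have "x * pi \<noteq> y * pi" using xy by simp
    then obtain d where bd: "{#x * pi, y * pi, d#} = {#\<alpha>, \<beta>, \<gamma>#}"
      using mset_three_contains_two[OF mem[of x] mem[of y]] M0 by auto
    have "vertex_equation T (V j) (regular_angle N) (x * pi) (y * pi) d 1 1 0" if "j < N" for j
      by (rule equation[OF that]) (simp add: M0)
    then show ?thesis using bd unfolding V_def by blast
  qed
  show ?thesis
    using sol[OF N(2)]
  proof (elim disjE conjE)
    assume "M 0 = {#1 / 10, 7 / 10#}"
    then show ?thesis by (rule two) simp
  next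
    assume "M 0 = {#7 / 30, 17 / 30#}"
    then show ?thesis by (rule two) simp
  qed (rule one double, assumption)+
qed

end
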